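(* Let $f:\mathbb{R}^2\to[0,\infty)$ be defined by $f(z)=e^{-\gamma|z|^2}$ with $\gamma>2\pi$. Suppose that $\Lambda\in\mathcal{L}$ satisfies $D(\Lambda)>4$. Let $$Z_{\lambda,\ell},\quad(\lambda,\ell)\in\Lambda\times\{1,2\},$$ be a sequence of independent $\mathbb{R}^2$-valued random variables, where each $Z_{\lambda,\ell}$ is uniformly distributed on the disk $B_{f(\lambda)}(\lambda)$. Then $\mathcal{U}=\{Z_{\lambda,\ell}:(\lambda,\ell)\in\Lambda\times\{1,2\}\}$ is a uniqueness set for the Gabor phase retrieval problem in $L^2(\mathbb{R},\mathbb{R})$ almost surely.
   Context: The class of lattices $\mathcal{L}$ is $$\mathcal{L}=\left\{\begin{pmatrix}p&0\\ 0& q\end{pmatrix}\mathbb{Z}^2:\ p,q\in\mathbb{R}\setminus\{0\}\right\}\cup\left\{\begin{pmatrix}p&p\\ q&-q\end{pmatrix}\mathbb{Z}^2:\ p,q\in\mathbb{R}\setminus\{0\}\right\}.$$ The density of a lattice $\Lambda$ is $D(\Lambda)=1/s(\Lambda)$, where $s(\Lambda)$ is the area of a period parallelogram of $\Lambda$. $B_r(z)$ is the closed ball of radius $r$ around $z$ in $\mathbb{R}^2$. $L^2(\mathbb{R})$ denotes the complex-valued square-integrable functions on $\mathbb{R}$ and $L^2(\mathbb{R},\mathbb{R})$ its subset of real-valued functions. The Gabor transform of $g\in L^2(\mathbb{R})$ is $\mathcal{G}g(x,\omega)=\int_{\mathbb{R}}g(t)e^{-\pi(t-x)^2}e^{-2\pi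 i\omega t}\,dt$, $(x,\omega)\in\mathbb{R}^2$. A set $\mathcal{U}\subseteq\mathbb{R}^2$ is a uniqueness set for the Gabor phase retrieval problem in $X\subseteq L^2(\mathbb{R})$ if for all $g,h\in X$: whenever $|\mathcal{G}g(u)|=|\mathcal{G}h(u)|$ for all $u\in\mathcal{U}$, there is $\tau\in\mathbb{C}$ with $|\tau|=1$ and $g=\tau h$. *)

theory Defs
  imports "HOL-Probability.Probability"
begin

definition int_lattice :: "(real^2) set" where
  "int_lattice = {z. \<forall>i. z $ i \<in> \<int>}"

text \<open>Matrices are lists of rows.\<close>

definition gabor_lattices :: "(real^2) set set" where
  "gabor_lattices =
     {(*v) (vector [vector [p, 0], vector [0, q]] :: real^2^2) ` int_lattice | p q.
        p \<noteq> 0 \<and> q \<noteq> 0} \<union>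
     {(*v) (vector [vector [p, p], vector [q, - q]] :: real^2^2) ` int_lattice | p q.
        p \<noteq> 0 \<and> q \<noteq> 0}"

definition period_parallelogram :: "(real^2) set \<Rightarrow> (real^2) set \<Rightarrow> bool" where
  "period_parallelogram \<Lambda> P \<longleftrightarrow>
     (\<exists>v w. v \<noteq> w \<and> independent {v, w} \<and>
        \<Lambda> = {of_int m *\<^sub>R v + of_int n *\<^sub>R w | m n. True} \<and>
        P = {s *\<^sub>R v + t *\<^sub>R w | s t. 0 \<le> s \<and> s < 1 \<and> 0 \<le> t \<and> t < 1})"

text \<open>The area does not depend on the chosen parallelogram: any two bases of a
  lattice differ by an integer matrix of determinant \<open>1\<close> or \<open>-1\<close>.\<close>

definition cell_area :: "(real^2) set \<Rightarrow> real" where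
  "cell_area \<Lambda> = measure lebesgue (SOME P. period_parallelogram \<Lambda> P)"

definition lattice_density :: "(real^2) set \<Rightarrow> real" where
  "lattice_density \<Lambda> = 1 / cell_area \<Lambda>"

text \<open>Elements of \<open>L\<^sup>2\<close> are represented by functions, with equality understood almost
  everywhere; correspondingly, real-valued means real-valued almost everywhere.\<close>

definition L2 :: "(real \<Rightarrow> complex) set" where
  "L2 = {g. g \<in> borel_measurable lebesgue \<and> integrable lebesgue (\<lambda>t. (norm (g t))\<^sup>2)}"

definition L2_real :: "(real \<Rightarrow> complex) set" where
  "L2_real = {g \<in> L2. AE t in lebesgue. g t \<in> \<real>}"

text \<open>A point \<open>u\<close> of the plane is the time-frequency pair with time \<open>u $ 1\<close> and
  frequency \<open>u $ 2\<close>.\<close>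

definition gabor :: "(real \<Rightarrow> complex) \<Rightarrow> real^2 \<Rightarrow> complex" where
  "gabor g u =
     (LINT t|lebesgue. g t * of_real (exp (- pi * (t - u $ 1)\<^sup>2)) *
        exp (- 2 * of_real pi * \<i> * of_real (u $ 2) * of_real t))"

definition gabor_uniqueness_set :: "(real^2) set \<Rightarrow> (real \<Rightarrow> complex) set \<Rightarrow> bool" where
  "gabor_uniqueness_set U X \<longleftrightarrow>
     (\<forall>g\<in>X. \<forall>h\<in>X. (\<forall>u\<in>U. norm (gabor g u) = norm (gabor h u)) \<longrightarrow>
        (\<exists>\<tau>. norm \<tau> = 1 \<and> (AE t in lebesgue. g t = \<tau> * h t)))"

end

theory Submission
  imports Defs "HOL-Complex_Analysis.Complex_Analysis"
begin

text \<open>A point \<open>(x, \<omega>)\<close> of the plane is identified with \<open>z = x + \<i> \<omega>\<close>. For a real-valued signal \<open>g\<close> the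
  modulus of the Gabor transform at \<open>z\<close> is \<open>exp (- \<pi> |z|\<^sup>2 / 2) |F z|\<close>, where \<open>F\<close>, the Bargmann transform of
  \<open>g\<close>, is entire, satisfies \<open>|F z| \<le> C exp (\<pi> |z|\<^sup>2 / 2)\<close> and \<open>F (cnj z) = cnj (F z)\<close>, and determines \<open>g\<close>
  (lemmas \<open>norm_gabor\<close>, \<open>bargmann_holomorphic\<close>, \<open>bargmann_growth\<close>, \<open>bargmann_cnj\<close>,
  \<open>bargmann_proportional_imp_AE\<close>). It remains to show that two such functions \<open>F\<close> and \<open>H\<close> with \<open>|F| = |H|\<close> on
  the random set differ by a unimodular factor.

  Near every lattice point \<open>\<lambda>\<close> there are several points where \<open>|F|\<^sup>2 - |H|\<^sup>2\<close> vanishes: the two samples around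
  \<open>\<lambda>\<close>, and the complex conjugates of the samples around \<open>cnj \<lambda>\<close>, because the lattices are symmetric about the
  real axis. These points lie within \<open>exp (- \<gamma> |\<lambda>|\<^sup>2)\<close> of \<open>\<lambda>\<close>, and by a Borel-Cantelli argument they almost surely
  span a triangle that is non-degenerate up to a factor \<open>exp (- \<pi> |\<lambda>|\<^sup>2 / 8)\<close>, with finitely many exceptions
  (\<open>AE_eventually_separated\<close>); at real \<open>\<lambda>\<close>, where by symmetry the gradient considered below is horizontal, it
  is enough that the abscissae of the two samples differ. Hence \<open>|F|\<^sup>2 - |H|\<^sup>2\<close> and its gradient are tiny at \<open>\<lambda>\<close>. Since
  \<open>F' cnj F - H' cnj H\<close> encodes that gradient, the entire function \<open>E = F (F' H - F H')\<close> is tiny at \<open>\<lambda>\<close>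
  as well (\<open>wronskian_bound\<close>). Here \<open>\<gamma> > 2 \<pi>\<close> is used: the three factors of \<open>E\<close> grow like
  \<open>exp (3 \<pi> |\<lambda>|\<^sup>2 / 2)\<close> together, and multiplication with \<open>exp (- \<gamma> |\<lambda>|\<^sup>2)\<close> makes the product decay.

  The density enters through a Liouville theorem (\<open>lattice_sigma.liouville\<close>): an entire function that is
  bounded on a lattice of density \<open>D\<close> and is bounded by \<open>C exp (\<beta> |z|\<^sup>2)\<close> with \<open>\<beta> < \<pi> D / 2\<close> is constant. It
  is proved with a theta function that vanishes exactly on the lattice and whose modulus, divided by
  \<open>exp (\<pi> D |z|\<^sup>2 / 2)\<close>, is periodic. For \<open>D > 4\<close> the bound on \<open>\<beta>\<close> exceeds \<open>2 \<pi>\<close>, so \<open>E\<close> is a constant that is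
  arbitrarily small at far lattice points, that is, \<open>E = 0\<close>. Therefore \<open>F = 0\<close>, in which case the same theorem
  gives \<open>H = 0\<close>, or the quotient \<open>H / F\<close> has derivative zero and \<open>H\<close> is a constant multiple of \<open>F\<close>; the
  constant is unimodular because \<open>|F| = |H|\<close> at a sample where \<open>F\<close> does not vanish
  (\<open>lattice_sigma.equal_modulus_near_lattice\<close>).\<close>

no_notation fps_nth (infixl "$" 75)

section \<open>A theta function with prescribed lattice zeros\<close>

text \<open>The \<open>q\<close>-Pochhammer symbol \<open>(w; q)\<^sub>\<infinity>\<close>.\<close>
definition qprod :: "complex \<Rightarrow> complex \<Rightarrow> complex" where
  "qprod q w = (\<Prod>n. 1 - q ^ n * w)"

text \<open>The factors \<open>1 - q\<^sup>n w\<close> are Weierstrass factors of genus \<open>0\<close> with zeros \<open>q\<^sup>-\<^sup>n\<close>, since these zeros grow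
  geometrically. Holomorphy and the zero set of the product are thus instances of the general theory.\<close>
lemma qprod_weierstrass:
  assumes "q \<noteq> 0" "norm q < 1"
  shows "weierstrass_product (\<lambda>n. inverse q ^ n) (\<lambda>_. 0)"
proof
  show "filterlim (\<lambda>n. inverse q ^ n) at_infinity sequentially"
    by (rule filterlim_realpow_sequentially_gt1) (use assms in \<open>simp add: norm_inverse one_less_inverse\<close>)
  show "summable (\<lambda>n. (r / norm (inverse q ^ n)) ^ Suc 0)" for r
  proof -
    have "(\<lambda>n. (r / norm (inverse q ^ n)) ^ Suc 0) = (\<lambda>n. r * norm q ^ n)"
      using assms by (auto simp: norm_power norm_inverse norm_divide field_simps)
    thus ?thesis using summable_mult[OF summable_geometric[of "norm q"], of r] assms by simp
  qed
qed (use assms in auto)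

lemma
  assumes "q \<noteq> 0" "norm q < 1"
  shows qprod_holomorphic: "qprod q holomorphic_on X"
    and qprod_eq_0_iff: "qprod q w = 0 \<longleftrightarrow> (\<exists>n. q ^ n * w = 1)"
    and qprod_rec: "qprod q w = (1 - w) * qprod q (q * w)"
proof -
  interpret W: weierstrass_product "\<lambda>n. inverse q ^ n" "\<lambda>_. 0"
    by (rule qprod_weierstrass[OF assms])
  have f: "W.f = qprod q"
    unfolding W.f_def qprod_def weierstrass_factor_def fun_eq_iff using assms
    by (simp add: field_simps)
  show "qprod q holomorphic_on X"
    using W.holomorphic[of X] by (simp add: f)
  have "qprod q w = 0 \<longleftrightarrow> (\<exists>n. w = inverse q ^ n)"
    using W.zero[of w] by (auto simp: f)
  also have "\<dots> \<longleftrightarrow> (\<exists>n. q ^ n * w = 1)"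
    using assms by (intro ex_cong1) (auto simp: field_simps)
  finally show "qprod q w = 0 \<longleftrightarrow> (\<exists>n. q ^ n * w = 1)" .
  have c: "(\<lambda>n. 1 - q ^ n * w) has_prod qprod q w" for w
  proof -
    have "(\<lambda>n. weierstrass_factor 0 (w / inverse q ^ n)) = (\<lambda>n. 1 - q ^ n * w)"
      using assms by (auto simp: weierstrass_factor_def field_simps)
    thus ?thesis using W.has_prod[of w] by (simp only: f)
  qed
  have "(\<lambda>n. 1 - q ^ (n + 1) * w) has_prod qprod q (q * w)"
    using c[of "q * w"] by (simp add: mult_ac)
  hence "(\<lambda>n. 1 - q ^ (Suc n) * w) has_prod qprod q (q * w)" by simp
  moreover have "(\<lambda>n. 1 - q ^ n * w) has_prod ((\<Prod>n<1. 1 - q ^ n * w) * (\<Prod>n. 1 - q ^ (n + 1) * w))"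
    using c[of w] by (intro has_prod_ignore_initial_segment' ) (auto simp: has_prod_iff)
  ultimately show "qprod q w = (1 - w) * qprod q (q * w)"
    using c[of w] by (simp add: has_prod_iff)
qed

definition expi :: "complex \<Rightarrow> complex" where
  "expi z = exp (of_real (2 * pi) * \<i> * z)"

lemma expi_add: "expi (z + w) = expi z * expi w"
  by (simp add: expi_def exp_add ring_distribs)

lemma expi_minus: "expi (- z) = inverse (expi z)"
  by (simp add: expi_def exp_minus)

lemma expi_diff: "expi (z - w) = expi z / expi w"
  using expi_add[of z "-w"] by (simp add: expi_minus field_simps)

lemma expi_of_nat_mult: "expi (of_nat n * z) = expi z ^ n"
  by (simp add: expi_def mult_ac flip: exp_of_nat_mult)

lemma expi_nonzero: "expi z \<noteq> 0"
  by (simp add: expi_def)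

lemma norm_expi: "norm (expi z) = exp (- 2 * pi * Im z)"
  by (simp add: expi_def)

lemma expi_0: "expi 0 = 1" and expi_1: "expi 1 = 1"
  by (simp_all add: expi_def exp_two_pi_i')

lemma expi_eq_1_iff: "expi z = 1 \<longleftrightarrow> (\<exists>k. z = of_int k)"
  unfolding expi_def exp_eq_1 by (auto simp: complex_eq_iff)

lemma expi_holomorphic [holomorphic_intros]:
  "f holomorphic_on X \<Longrightarrow> (\<lambda>z. expi (f z)) holomorphic_on X"
  unfolding expi_def by (intro holomorphic_intros)

text \<open>Up to elementary factors, Jacobi's theta function in its triple product form, with \<open>expi \<tau>\<close> as nome.\<close>
definition theta_base :: "complex \<Rightarrow> complex \<Rightarrow> complex" where
  "theta_base \<tau> z = qprod (expi \<tau>) (expi z) * qprod (expi \<tau>) (expi (\<tau> - z))"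

text \<open>The Gaussian factor turns the quasi-periodicity of \<open>theta_base\<close> into genuine double periodicity of
  \<open>|wsigma \<tau> z| exp (- \<pi> |z|\<^sup>2 / (2 Im \<tau>))\<close>: the real part of \<open>\<pi> z\<^sup>2 / (2 Im \<tau>)\<close> symmetrises the growth
  \<open>exp (\<pi> (Im z)\<^sup>2 / Im \<tau>)\<close> of the theta function in both variables, and \<open>- \<i> \<pi> z\<close> removes its linear term.
  The function is a multiple of a Weierstrass sigma function times \<open>exp\<close> of a quadratic polynomial.\<close>
definition wsigma :: "complex \<Rightarrow> complex \<Rightarrow> complex" where
  "wsigma \<tau> z = theta_base \<tau> z * exp (of_real pi * z\<^sup>2 / of_real (2 * Im \<tau>) - \<i> * of_real pi * z)"

lemma norm_expi_less_1: "Im \<tau> > 0 \<Longrightarrow> norm (expi \<tau>) < 1"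
  by (simp add: norm_expi)

lemma qprod_expi_holomorphic:
  assumes "Im \<tau> > 0" "f holomorphic_on X"
  shows "(\<lambda>z. qprod (expi \<tau>) (f z)) holomorphic_on X"
proof -
  note h = qprod_holomorphic[OF expi_nonzero norm_expi_less_1[OF assms(1)], of UNIV]
  have "(qprod (expi \<tau>) \<circ> f) holomorphic_on X"
    by (rule holomorphic_on_compose_gen[OF assms(2) h]) auto
  thus ?thesis by (simp add: o_def)
qed

lemma wsigma_holomorphic: "Im \<tau> > 0 \<Longrightarrow> wsigma \<tau> holomorphic_on X"
  unfolding wsigma_def theta_base_def
  by (intro holomorphic_intros qprod_expi_holomorphic) auto

lemma theta_base_plus_1: "theta_base \<tau> (z + 1) = theta_base \<tau> z"
  by (simp add: theta_base_def expi_add expi_diff expi_1)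

text \<open>The shift by \<open>\<tau>\<close> removes the factor \<open>1 - expi z\<close> from the first product and adds the factor
  \<open>1 - 1 / expi z\<close> to the second; the ratio of the two is
  \<open>- 1 / expi z\<close>.\<close>
lemma theta_base_plus_tau:
  assumes "Im \<tau> > 0"
  shows "theta_base \<tau> (z + \<tau>) = - theta_base \<tau> z / expi z"
proof -
  define q where "q = expi \<tau>"
  define e where "e = expi z"
  note rec = qprod_rec[OF expi_nonzero norm_expi_less_1[OF assms], folded q_def]
  have e0: "e \<noteq> 0" by (simp add: e_def expi_nonzero)
  have "theta_base \<tau> (z + \<tau>) = qprod q (q * e) * qprod q (1 / e)"
    by (simp add: theta_base_def q_def e_def expi_add expi_minus field_simps)
  also have "qprod q (1 / e) = (1 - 1 / e) * qprod q (q / e)"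
    using rec[of "1 / e"] by simp
  also have "qprod q (q * e) * ((1 - 1 / e) * qprod q (q / e)) =
      - ((1 - e) * qprod q (q * e)) * qprod q (q / e) / e"
    using e0 by (simp add: field_simps)
  also have "(1 - e) * qprod q (q * e) = qprod q e"
    using rec[of e] by simp
  finally show ?thesis
    by (simp add: theta_base_def expi_diff flip: q_def e_def)
qed

lemma norm_wsigma_plus_1:
  assumes "Im \<tau> > 0"
  shows "norm (wsigma \<tau> (z + 1)) * exp (- pi / (2 * Im \<tau>) * (norm (z + 1))\<^sup>2) =
         norm (wsigma \<tau> z) * exp (- pi / (2 * Im \<tau>) * (norm z)\<^sup>2)"
proof -
  define Q where "Q z = of_real pi * z\<^sup>2 / of_real (2 * Im \<tau>) - \<i> * of_real pi * z" for z
  define R where "R z = - pi / (2 * Im \<tau>) * (norm z)\<^sup>2" for z :: complex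
  have "Re (Q (z + 1)) + R (z + 1) = Re (Q z) + R z"
    unfolding Q_def R_def cmod_power2 Re_divide_of_real minus_complex.sel times_complex.sel Re_power2
    using assms by (simp add: power2_eq_square field_simps)
  hence "exp (Re (Q (z + 1))) * exp (R (z + 1)) = exp (Re (Q z)) * exp (R z)"
    by (simp flip: exp_add)
  thus ?thesis
    unfolding wsigma_def Q_def[symmetric] R_def[symmetric] theta_base_plus_1 norm_mult norm_exp_eq_Re
    by (simp only: mult.assoc)
qed

lemma norm_wsigma_plus_tau:
  assumes "Im \<tau> > 0"
  shows "norm (wsigma \<tau> (z + \<tau>)) * exp (- pi / (2 * Im \<tau>) * (norm (z + \<tau>))\<^sup>2) =
         norm (wsigma \<tau> z) * exp (- pi / (2 * Im \<tau>) * (norm z)\<^sup>2)"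
proof -
  define Q where "Q z = of_real pi * z\<^sup>2 / of_real (2 * Im \<tau>) - \<i> * of_real pi * z" for z
  define R where "R z = - pi / (2 * Im \<tau>) * (norm z)\<^sup>2" for z :: complex
  have "Re (Q (z + \<tau>)) + R (z + \<tau>) = - 2 * pi * Im z + (Re (Q z) + R z)"
    unfolding Q_def R_def cmod_power2 Re_divide_of_real minus_complex.sel times_complex.sel Re_power2
    using assms by (simp add: power2_eq_square field_simps)
  hence "exp (Re (Q (z + \<tau>))) * exp (R (z + \<tau>)) = norm (expi z) * (exp (Re (Q z)) * exp (R z))"
    unfolding norm_expi by (simp only: flip: exp_add)
  thus ?thesis
    unfolding wsigma_def Q_def[symmetric] R_def[symmetric] theta_base_plus_tau[OF assms]
      norm_mult norm_exp_eq_Re norm_divide norm_minus_cancel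
    using expi_nonzero[of z] by (simp add: mult.assoc)
qed

lemma periodic_of_int:
  fixes f :: "complex \<Rightarrow> 'a"
  assumes "\<And>z. f (z + a) = f z"
  shows "f (z + of_int m * a) = f z"
proof (induction m arbitrary: z rule: int_induct[where k = 0])
  case base
  then show ?case by simp
next
  case (step1 i)
  show ?case using step1(2)[of "z"] assms[of "z + of_int i * a"] by (simp add: algebra_simps)
next
  case (step2 i)
  show ?case using step2(2)[of "z"] assms[of "z + of_int (i - 1) * a"] by (simp add: algebra_simps)
qed

lemma norm_wsigma_periodic:
  assumes "Im \<tau> > 0"
  shows "norm (wsigma \<tau> (z + (of_int m + of_int n * \<tau>))) *
            exp (- pi / (2 * Im \<tau>) * (norm (z + (of_int m + of_int n * \<tau>)))\<^sup>2) =
         norm (wsigma \<tau> z) * exp (- pi / (2 * Im \<tau>) * (norm z)\<^sup>2)"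
  using periodic_of_int[of "\<lambda>z. norm (wsigma \<tau> z) * exp (- pi / (2 * Im \<tau>) * (norm z)\<^sup>2)", OF norm_wsigma_plus_1[OF assms], of z m]
    periodic_of_int[of "\<lambda>z. norm (wsigma \<tau> z) * exp (- pi / (2 * Im \<tau>) * (norm z)\<^sup>2)", OF norm_wsigma_plus_tau[OF assms], of "z + of_int m" n]
  by (simp add: add.assoc)

lemma wsigma_eq_0_iff:
  assumes "Im \<tau> > 0"
  shows "wsigma \<tau> z = 0 \<longleftrightarrow> (\<exists>m n. z = of_int m + of_int n * \<tau>)"
proof
  note zero = qprod_eq_0_iff[OF expi_nonzero norm_expi_less_1[OF assms]]
  {
    assume "wsigma \<tau> z = 0"
    then consider n where "expi (of_nat n * \<tau> + z) = 1" | n where "expi (of_nat n * \<tau> + (\<tau> - z)) = 1"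
      unfolding wsigma_def theta_base_def mult_eq_0_iff zero expi_add expi_of_nat_mult by auto
    thus "\<exists>m n. z = of_int m + of_int n * \<tau>"
    proof cases
      case (1 n)
      then obtain k :: int where "of_nat n * \<tau> + z = of_int k" by (auto simp: expi_eq_1_iff)
      hence "z = of_int k + of_int (- int n) * \<tau>" by (simp add: algebra_simps)
      thus ?thesis by blast
    next
      case (2 n)
      then obtain k :: int where "of_nat n * \<tau> + (\<tau> - z) = of_int k" by (auto simp: expi_eq_1_iff)
      hence "z = of_int (- k) + of_int (int n + 1) * \<tau>" by (simp add: algebra_simps)
      thus ?thesis by blast
    qed
  }
  {
    assume "\<exists>m n. z = of_int m + of_int n * \<tau>"
    then obtain m n where z: "z = 0 + (of_int m + of_int n * \<tau>)" by auto
    have "qprod (expi \<tau>) 1 = 0" unfolding zero by (auto intro: exI[of _ 0])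
    hence "wsigma \<tau> 0 = 0" by (simp add: wsigma_def theta_base_def expi_0)
    thus "wsigma \<tau> z = 0"
      using norm_wsigma_periodic[OF assms, of 0 m n] unfolding z by simp
  }
qed

text \<open>Near \<open>0\<close> the only vanishing factor of the product is \<open>1 - expi z\<close>, whose zero at \<open>0\<close> is simple.\<close>
lemma deriv_wsigma_0:
  assumes "Im \<tau> > 0"
  shows "deriv (wsigma \<tau>) 0 \<noteq> 0"
proof -
  define q where "q = expi \<tau>"
  have q: "q \<noteq> 0" "norm q < 1"
    using norm_expi_less_1[OF assms] by (auto simp: q_def expi_nonzero)
  define g where "g z = qprod q (q * expi z) * qprod q (expi (\<tau> - z)) *
     exp (of_real pi * z\<^sup>2 / of_real (2 * Im \<tau>) - \<i> * of_real pi * z)" for z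
  have "g holomorphic_on UNIV"
    unfolding g_def q_def
    by (intro holomorphic_on_mult qprod_expi_holomorphic[OF assms] expi_holomorphic holomorphic_on_exp
        holomorphic_on_diff holomorphic_on_divide holomorphic_on_power holomorphic_on_const holomorphic_on_id)
      (use assms in \<open>auto intro!: holomorphic_intros\<close>)
  hence g': "(g has_field_derivative deriv g 0) (at 0)"
    by (intro holomorphic_derivI[of _ UNIV]) auto
  have sg: "wsigma \<tau> = (\<lambda>z. (1 - expi z) * g z)"
  proof
    fix z show "wsigma \<tau> z = (1 - expi z) * g z"
      using qprod_rec[OF q, of "expi z"]
      by (simp add: wsigma_def theta_base_def g_def mult_ac flip: q_def)
  qed
  have "((\<lambda>z. (1 - exp (of_real (2 * pi) * \<i> * z)) * g z) has_field_derivative (- (2 * pi * \<i>) * g 0)) (at 0)"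
    by (auto intro!: derivative_eq_intros g')
  hence "deriv (wsigma \<tau>) 0 = - (2 * pi * \<i>) * g 0"
    unfolding sg expi_def by (rule DERIV_imp_deriv)
  moreover have "g 0 = (qprod q q)\<^sup>2"
    by (simp add: g_def q_def power2_eq_square expi_0)
  moreover have "qprod q q \<noteq> 0"
  proof
    assume "qprod q q = 0"
    then obtain n where "q ^ n * q = 1" unfolding qprod_eq_0_iff[OF q] by blast
    hence "norm q ^ Suc n = 1" by (metis mult.commute norm_one norm_power power_Suc)
    with q show False using power_Suc_less_one[of "norm q" n] by auto
  qed
  ultimately show ?thesis by simp
qed

section \<open>Gaussian sums and quotients of entire functions\<close>

lemma summable_on_exp_int:
  fixes c :: real
  assumes "c > 0"
  shows "(\<lambda>n::int. exp (- c * (of_int n)\<^sup>2)) summable_on UNIV"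
proof -
  have sq: "real_of_int \<bar>n\<bar> \<le> (of_int n)\<^sup>2" for n :: int
  proof -
    have "\<bar>n\<bar> \<le> n\<^sup>2"
    proof (cases "n = 0")
      case False
      hence "\<bar>n\<bar> * 1 \<le> \<bar>n\<bar> * \<bar>n\<bar>" by (intro mult_left_mono) auto
      thus ?thesis by (simp add: power2_eq_square)
    qed auto
    thus ?thesis by (simp flip: of_int_power)
  qed
  define g where "g n = exp (- c) ^ nat \<bar>n\<bar>" for n :: int
  have nat: "(\<lambda>n::nat. exp (- c) ^ n) summable_on UNIV"
  proof (rule norm_summable_imp_summable_on)
    have "summable (\<lambda>n. exp (- c) ^ n)" using assms by (intro summable_geometric) simp
    thus "summable (\<lambda>n. norm (exp (- c) ^ n))" by simp
  qed
  have "inj int" "inj (\<lambda>n. - int n)" by (auto simp: inj_on_def)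
  hence "g summable_on range int" "g summable_on range (\<lambda>n. - int n)"
    using nat by (simp_all add: summable_on_reindex o_def g_def)
  hence "g summable_on (range int \<union> (range (\<lambda>n. - int n) - range int))"
    by (intro summable_on_Un_disjoint) (auto intro: summable_on_subset_banach)
  also have "range int \<union> (range (\<lambda>n. - int n) - range int) = UNIV"
  proof -
    have "n \<in> range int \<or> n \<in> range (\<lambda>n. - int n)" for n
      by (cases n rule: int_cases2) auto
    thus ?thesis by auto
  qed
  finally have "(\<lambda>n::int. exp (- c) ^ nat \<bar>n\<bar>) summable_on UNIV" by (simp add: g_def)
  thus ?thesis
  proof (rule summable_on_comparison_test)
    fix n :: int
    have "exp (- c * (of_int n)\<^sup>2) \<le> exp (- c * real_of_int \<bar>n\<bar>)"
      using sq[of n] assms by simp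
    also have "\<dots> = exp (- c) ^ nat \<bar>n\<bar>"
      by (simp add: mult.commute flip: exp_of_nat_mult)
    finally show "exp (- c * (of_int n)\<^sup>2) \<le> exp (- c) ^ nat \<bar>n\<bar>" .
  qed auto
qed

lemma summable_on_gaussian_grid:
  fixes c p q :: real
  assumes "c > 0" "p \<noteq> 0" "q \<noteq> 0"
    and sub: "L \<subseteq> {Complex (p * of_int m) (q * of_int n) | m n. True}"
  shows "(\<lambda>z. exp (- c * (norm z)\<^sup>2)) summable_on L"
proof -
  define g :: "int \<times> int \<Rightarrow> complex" where "g = (\<lambda>(m, n). Complex (p * of_int m) (q * of_int n))"
  define u where "u p n = exp (- (c * p\<^sup>2) * (of_int n)\<^sup>2)" for p :: real and n :: int
  have u: "u p summable_on UNIV" if "p \<noteq> 0" for p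
    unfolding u_def by (rule summable_on_exp_int) (use assms that in auto)
  have "(\<lambda>(m, n). u p m * u q n) summable_on UNIV \<times> UNIV"
  proof (rule summable_on_SigmaI)
    show "((\<lambda>y. case (x, y) of (m, n) \<Rightarrow> u p m * u q n) has_sum (u p x * infsum (u q) UNIV)) UNIV" for x
      using has_sum_cmult_right[OF has_sum_infsum[OF u[of q]]] assms by simp
    show "(\<lambda>x. u p x * infsum (u q) UNIV) summable_on UNIV"
      by (intro summable_on_cmult_left u assms)
  qed (auto simp: u_def)
  also have "(\<lambda>(m, n). u p m * u q n) = (\<lambda>z. exp (- c * (norm z)\<^sup>2)) \<circ> g"
    by (auto simp: fun_eq_iff g_def u_def cmod_power2 power_mult_distrib algebra_simps simp flip: exp_add)
  finally have *: "(\<lambda>z. exp (- c * (norm z)\<^sup>2)) \<circ> g summable_on UNIV"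
    by (simp only: UNIV_Times_UNIV)
  have "inj g" using assms by (auto simp: inj_on_def g_def)
  from * have "(\<lambda>z. exp (- c * (norm z)\<^sup>2)) summable_on range g"
    by (simp only: summable_on_reindex[OF \<open>inj g\<close>])
  moreover have "L \<subseteq> range g" using sub by (force simp: g_def)
  ultimately show ?thesis by (rule summable_on_subset_banach)
qed

text \<open>A translation changes a Gaussian bound only by a constant factor and an arbitrarily small loss \<open>\<eta>\<close> in the
  exponent.\<close>
lemma norm_add_sq_le:
  fixes z a :: complex
  assumes "\<eta> > 0"
  shows "(norm (z + a))\<^sup>2 \<le> (1 + \<eta>) * (norm z)\<^sup>2 + (1 + 1 / \<eta>) * (norm a)\<^sup>2"
proof -
  have "(norm (z + a))\<^sup>2 \<le> (norm z + norm a)\<^sup>2"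
    by (intro power_mono norm_triangle_ineq) auto
  also have "2 * (norm z * norm a) \<le> \<eta> * (norm z)\<^sup>2 + (norm a)\<^sup>2 / \<eta>"
  proof -
    have "0 \<le> (\<eta> * norm z - norm a)\<^sup>2 / \<eta>" using assms by simp
    also have "\<dots> = \<eta> * (norm z)\<^sup>2 + (norm a)\<^sup>2 / \<eta> - 2 * (norm z * norm a)"
      using assms by (simp add: power2_eq_square field_simps)
    finally show ?thesis by simp
  qed
  hence "(norm z + norm a)\<^sup>2 \<le> (1 + \<eta>) * (norm z)\<^sup>2 + (1 + 1 / \<eta>) * (norm a)\<^sup>2"
    by (simp add: power2_eq_square algebra_simps)
  finally show ?thesis .
qed

lemma exp_neg_square_tendsto_0:
  fixes c s :: real
  assumes "c > 0" "s > 0"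
  shows "(\<lambda>n. exp (- c * (s * real n)\<^sup>2)) \<longlonglongrightarrow> 0"
proof (rule filterlim_compose[OF exp_at_bot])
  have "filterlim (\<lambda>n. s * real n) at_top sequentially"
    by (rule filterlim_tendsto_pos_mult_at_top[OF tendsto_const assms(2) filterlim_real_sequentially])
  hence "filterlim (\<lambda>n. (s * real n)\<^sup>2) at_top sequentially"
    by (rule filterlim_pow_at_top[rotated]) simp
  hence "filterlim (\<lambda>n. c * (s * real n)\<^sup>2) at_top sequentially"
    by (rule filterlim_tendsto_pos_mult_at_top[OF tendsto_const assms(1)])
  thus "filterlim (\<lambda>n. - c * (s * real n)\<^sup>2) at_bot sequentially"
    unfolding filterlim_uminus_at_bot by simp
qed

text \<open>At a simple zero of \<open>s\<close> both functions are divisible by the linear factor, so the singularity of the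
  quotient is removable.\<close>
lemma holomorphic_on_quotient_simple_zeros:
  assumes f: "f holomorphic_on U" and s: "s holomorphic_on U" and U: "open U"
    and zero: "\<And>z. z \<in> U \<Longrightarrow> s z = 0 \<Longrightarrow> f z = 0 \<and> deriv s z \<noteq> 0"
  obtains h where "h holomorphic_on U" "\<And>z. z \<in> U \<Longrightarrow> s z \<noteq> 0 \<Longrightarrow> h z = f z / s z"
proof
  define h where "h z = (if s z = 0 then deriv f z / deriv s z else f z / s z)" for z
  show "h z = f z / s z" if "s z \<noteq> 0" for z
    using that by (simp add: h_def)
  have "\<exists>V. open V \<and> z \<in> V \<and> h holomorphic_on V" if z: "z \<in> U" for z
  proof (cases "s z = 0")
    case False
    have "open (U \<inter> s -` (- {0}))"
      using s U by (intro continuous_open_preimage holomorphic_on_imp_continuous_on) auto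
    moreover have "h holomorphic_on (U \<inter> s -` (- {0}))"
    proof (rule holomorphic_transform)
      show "(\<lambda>z. f z / s z) holomorphic_on (U \<inter> s -` (- {0}))"
        by (intro holomorphic_intros holomorphic_on_subset[OF f] holomorphic_on_subset[OF s]) auto
    qed (auto simp: h_def)
    ultimately show ?thesis using z False by blast
  next
    case True
    define f1 where "f1 w = (if w = z then deriv f z else (f w - f z) / (w - z))" for w
    define s1 where "s1 w = (if w = z then deriv s z else (s w - s z) / (w - z))" for w
    have f1: "f1 holomorphic_on U" and s1: "s1 holomorphic_on U"
      unfolding f1_def s1_def by (intro pole_lemma_open f s U)+
    have "open (U \<inter> s1 -` (- {0}))"
      using s1 U by (intro continuous_open_preimage holomorphic_on_imp_continuous_on) auto
    moreover have "h holomorphic_on (U \<inter> s1 -` (- {0}))"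
    proof (rule holomorphic_transform)
      show "(\<lambda>z. f1 z / s1 z) holomorphic_on (U \<inter> s1 -` (- {0}))"
        by (intro holomorphic_intros holomorphic_on_subset[OF f1] holomorphic_on_subset[OF s1]) auto
    qed (use zero[OF z True] True in \<open>auto simp: h_def f1_def s1_def\<close>)
    moreover have "s1 z \<noteq> 0" using zero[OF z True] by (simp add: s1_def)
    ultimately show ?thesis using z by blast
  qed
  hence "\<forall>z\<in>U. h field_differentiable (at z)"
    by (meson holomorphic_on_imp_differentiable_at)
  thus "h holomorphic_on U"
    by (simp add: holomorphic_on_def field_differentiable_at_within)
qed

section \<open>A Liouville theorem for functions bounded on a lattice\<close>

text \<open>What the Liouville theorem needs to know about a lattice \<open>L\<close> and its sigma function \<open>S\<close>: the lattice lies
  between two rectangular ones, so that rectangles with half-integer sides avoid it uniformly; the zeros of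
  \<open>S\<close> are simple and are exactly the lattice points; and \<open>|S z|\<close> is \<open>exp (\<alpha> |z|\<^sup>2)\<close> times a periodic
  function. For a lattice of density \<open>D\<close> one has \<open>\<alpha> = \<pi> D / 2\<close>.\<close>
locale lattice_sigma =
  fixes L :: "complex set" and p q \<alpha> :: real and S :: "complex \<Rightarrow> complex"
  assumes p_pos: "p > 0" and q_pos: "q > 0" and \<alpha>_pos: "\<alpha> > 0"
    and L_sub: "L \<subseteq> {Complex (p * of_int m) (q * of_int n) | m n. True}"
    and L_sup: "\<And>m n. Complex (2 * p * of_int m) (2 * q * of_int n) \<in> L"
    and S_holo: "S holomorphic_on UNIV"
    and S_zero: "\<And>z. S z = 0 \<longleftrightarrow> z \<in> L"
    and S_deriv_0: "deriv S 0 \<noteq> 0"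
    and S_periodic: "\<And>l z. l \<in> L \<Longrightarrow>
      norm (S (z + l)) * exp (- \<alpha> * (norm (z + l))\<^sup>2) = norm (S z) * exp (- \<alpha> * (norm z)\<^sup>2)"
begin

lemma zero_in_L: "0 \<in> L"
proof -
  have "Complex (2 * p * of_int 0) (2 * q * of_int 0) = 0" by (simp add: complex_eq_iff)
  thus ?thesis using L_sup[of 0 0] by simp
qed

lemma add_in_L: "l \<in> L \<Longrightarrow> m \<in> L \<Longrightarrow> m + l \<in> L"
proof -
  assume "l \<in> L" "m \<in> L"
  hence "norm (S (m + l)) * exp (- \<alpha> * (norm (m + l))\<^sup>2) = 0"
    using S_zero[of m] S_periodic[of l m] by simp
  thus ?thesis using S_zero[of "m + l"] by simp
qed

lemma summable_L: "c > 0 \<Longrightarrow> (\<lambda>z. exp (- c * (norm z)\<^sup>2)) summable_on L"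
  by (rule summable_on_gaussian_grid[OF _ _ _ L_sub]) (use p_pos q_pos in auto)

lemma norm_S_add:
  assumes "l \<in> L"
  shows "norm (S (z + l)) = norm (S z) * exp (\<alpha> * ((norm (z + l))\<^sup>2 - (norm z)\<^sup>2))"
proof -
  have "norm (S (z + l)) * (exp (- \<alpha> * (norm (z + l))\<^sup>2) * exp (\<alpha> * (norm (z + l))\<^sup>2)) =
        norm (S z) * exp (\<alpha> * ((norm (z + l))\<^sup>2 - (norm z)\<^sup>2))"
    using S_periodic[OF assms, of z]
    by (simp add: mult.assoc[symmetric] right_diff_distrib exp_diff exp_minus field_simps)
  thus ?thesis by (simp flip: exp_add)
qed

text \<open>Periodicity makes difference quotients of \<open>S\<close> at \<open>l\<close> and at \<open>0\<close> comparable.\<close>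
lemma norm_deriv_S:
  assumes "l \<in> L"
  shows "norm (deriv S l) = norm (deriv S 0) * exp (\<alpha> * (norm l)\<^sup>2)"
proof -
  have D: "((\<lambda>h. (S (x + h) - S x) / h) \<longlongrightarrow> deriv S x) (at 0)" for x
  proof -
    have "(S has_field_derivative deriv S x) (at x)"
      by (rule holomorphic_derivI[OF S_holo]) auto
    thus ?thesis by (simp only: DERIV_def)
  qed
  have "((\<lambda>h. norm ((S (l + h) - S l) / h)) \<longlongrightarrow> norm (deriv S l)) (at 0)"
    by (intro tendsto_norm D)
  moreover have "(\<lambda>h. norm ((S (l + h) - S l) / h)) =
      (\<lambda>h. norm ((S (0 + h) - S 0) / h) * exp (\<alpha> * ((norm (h + l))\<^sup>2 - (norm h)\<^sup>2)))"
    using assms zero_in_L norm_S_add[OF assms] S_zero[of 0] S_zero[of l]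
    by (auto simp: norm_divide fun_eq_iff add.commute[of l])
  moreover have "((\<lambda>h. norm ((S (0 + h) - S 0) / h) * exp (\<alpha> * ((norm (h + l))\<^sup>2 - (norm h)\<^sup>2)))
      \<longlongrightarrow> norm (deriv S 0) * exp (\<alpha> * ((norm (0 + l))\<^sup>2 - (norm (0::complex))\<^sup>2))) (at 0)"
    by (intro tendsto_intros D)
  ultimately show ?thesis
    using tendsto_unique[OF trivial_limit_at] by fastforce
qed

text \<open>The lines half-way between the lines of the grid \<open>p \<int> + \<i> q \<int>\<close>. On them \<open>S\<close> is as large as its growth permits,
  and they contain the boundaries of arbitrarily large rectangles.\<close>
definition mid :: "complex set" where
  "mid = {z. (\<exists>k::int. Re z = p * (of_int k + 1 / 2)) \<or> (\<exists>k::int. Im z = q * (of_int k + 1 / 2))}"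

lemma dist_half_int:
  fixes k m :: int and r :: real
  assumes "r > 0"
  shows "\<bar>r * (of_int k + 1 / 2) - r * of_int m\<bar> \<ge> r / 2"
proof -
  have "\<bar>of_int k + 1 / 2 - of_int m\<bar> \<ge> (1 / 2 :: real)"
  proof (cases "k \<ge> m")
    case True
    hence "real_of_int k \<ge> of_int m" by simp
    thus ?thesis by linarith
  next
    case False
    hence "real_of_int k + 1 \<le> of_int m" by linarith
    thus ?thesis by linarith
  qed
  hence "r * (1 / 2) \<le> r * \<bar>of_int k + 1 / 2 - of_int m\<bar>"
    using assms by (intro mult_left_mono) auto
  also have "\<dots> = \<bar>r * (of_int k + 1 / 2 - of_int m)\<bar>"
    using assms by (simp add: abs_mult)
  finally show ?thesis by (simp add: algebra_simps)
qed

lemma mid_dist_L: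
  assumes "z \<in> mid" "l \<in> L"
  shows "norm (z - l) \<ge> min p q / 2"
proof -
  obtain m n where l: "l = Complex (p * of_int m) (q * of_int n)"
    using L_sub assms(2) by blast
  show ?thesis using assms(1) unfolding mid_def
  proof safe
    fix k :: int assume "Re z = p * (of_int k + 1 / 2)"
    hence "p / 2 \<le> \<bar>Re (z - l)\<bar>" using dist_half_int[OF p_pos, of k m] by (simp add: l)
    also have "\<dots> \<le> norm (z - l)" by (rule abs_Re_le_cmod)
    finally show ?thesis by simp
  next
    fix k :: int assume "Im z = q * (of_int k + 1 / 2)"
    hence "q / 2 \<le> \<bar>Im (z - l)\<bar>" using dist_half_int[OF q_pos, of k n] by (simp add: l)
    also have "\<dots> \<le> norm (z - l)" by (rule abs_Im_le_cmod)
    finally show ?thesis by simp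
  qed
qed

lemma mid_not_L: "z \<in> mid \<Longrightarrow> z \<notin> L"
  using mid_dist_L[of z z] p_pos q_pos by auto

definition cell :: "complex set" where
  "cell = cbox 0 (Complex (2 * p) (2 * q))"

lemma cell_translate:
  assumes "z \<in> mid"
  obtains l where "l \<in> L" "z - l \<in> cell" "z - l \<in> mid"
proof -
  define m n where "m = \<lfloor>Re z / (2 * p)\<rfloor>" and "n = \<lfloor>Im z / (2 * q)\<rfloor>"
  define l where "l = Complex (2 * p * of_int m) (2 * q * of_int n)"
  have m: "of_int m \<le> Re z / (2 * p)" "Re z / (2 * p) \<le> of_int m + 1"
    and n: "of_int n \<le> Im z / (2 * q)" "Im z / (2 * q) \<le> of_int n + 1"
    unfolding m_def n_def by linarith+
  have "z - l \<in> cell"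
    using m n p_pos q_pos by (auto simp: cell_def in_cbox_complex_iff l_def field_simps)
  moreover have "z - l \<in> mid"
    using assms unfolding mid_def
  proof safe
    fix k :: int assume "Re z = p * (of_int k + 1 / 2)"
    hence "Re (z - l) = p * (of_int (k - 2 * m) + 1 / 2)" by (simp add: l_def algebra_simps)
    thus "\<exists>k::int. Re (z - l) = p * (of_int k + 1 / 2)" by blast
  next
    fix k :: int assume "Im z = q * (of_int k + 1 / 2)"
    hence "Im (z - l) = q * (of_int (k - 2 * n) + 1 / 2)" by (simp add: l_def algebra_simps)
    moreover assume "\<nexists>k::int. Im (z - l) = q * (of_int k + 1 / 2)"
    ultimately show "\<exists>k::int. Re (z - l) = p * (of_int k + 1 / 2)" by blast
  qed
  moreover have "l \<in> L" unfolding l_def by (rule L_sup)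
  ultimately show ?thesis using that by blast
qed

lemma compact_mid_cell: "compact (mid \<inter> cell)"
proof -
  have *: "k \<in> {0, 1}" if "r * (of_int k + 1 / 2) \<in> {0..2 * r}" "r > 0" for k :: int and r :: real
  proof -
    have "0 \<le> of_int k + (1 / 2 :: real)" "of_int k + 1 / 2 \<le> (2 :: real)"
      using that by (auto simp: zero_le_mult_iff mult.commute[of r])
    thus ?thesis by auto
  qed
  have "mid \<inter> cell = cell \<inter> ({z. Re z = p / 2} \<union> {z. Re z = 3 * p / 2} \<union> {z. Im z = q / 2} \<union> {z. Im z = 3 * q / 2})"
  proof (intro equalityI subsetI)
    fix z assume z: "z \<in> mid \<inter> cell"
    hence cell: "Re z \<in> {0..2 * p}" "Im z \<in> {0..2 * q}"
      by (auto simp: cell_def in_cbox_complex_iff)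
    from z consider k :: int where "Re z = p * (of_int k + 1 / 2)"
      | k :: int where "Im z = q * (of_int k + 1 / 2)" unfolding mid_def by blast
    hence "Re z = p / 2 \<or> Re z = 3 * p / 2 \<or> Im z = q / 2 \<or> Im z = 3 * q / 2"
    proof cases
      case (1 k)
      with *[of p k] cell p_pos have "k \<in> {0, 1}" by auto
      with 1 show ?thesis by auto
    next
      case (2 k)
      with *[of q k] cell q_pos have "k \<in> {0, 1}" by auto
      with 2 show ?thesis by auto
    qed
    with z show "z \<in> cell \<inter> ({z. Re z = p / 2} \<union> {z. Re z = 3 * p / 2} \<union> {z. Im z = q / 2} \<union> {z. Im z = 3 * q / 2})"
      by auto
  next
    fix z assume "z \<in> cell \<inter> ({z. Re z = p / 2} \<union> {z. Re z = 3 * p / 2} \<union> {z. Im z = q / 2} \<union> {z. Im z = 3 * q / 2})"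
    thus "z \<in> mid \<inter> cell"
      by (auto simp: mid_def intro: exI[of _ "0::int"] exI[of _ "1::int"])
  qed
  moreover have "closed ({z. Re z = p / 2} \<union> {z. Re z = 3 * p / 2} \<union> {z. Im z = q / 2} \<union> {z. Im z = 3 * q / 2})"
    by (intro closed_Un closed_Collect_eq continuous_intros)
  moreover have "compact cell" unfolding cell_def by (rule compact_cbox)
  ultimately show ?thesis by (simp add: compact_Int_closed)
qed

text \<open>By periodicity it suffices to look at the compact set \<open>mid \<inter> cell\<close>, on which \<open>S\<close> has no zeros.\<close>
lemma norm_S_lower:
  obtains c where "c > 0" "\<And>z. z \<in> mid \<Longrightarrow> c * exp (\<alpha> * (norm z)\<^sup>2) \<le> norm (S z)"
proof -
  define \<phi> where "\<phi> z = norm (S z) * exp (- \<alpha> * (norm z)\<^sup>2)" for z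
  have ne: "mid \<inter> cell \<noteq> {}"
  proof -
    have "Complex (p / 2) (q / 2) \<in> mid \<inter> cell"
      using p_pos q_pos by (auto simp: mid_def cell_def in_cbox_complex_iff intro: exI[of _ "0::int"])
    thus ?thesis by blast
  qed
  have "continuous_on (mid \<inter> cell) \<phi>"
    unfolding \<phi>_def
    by (intro continuous_intros holomorphic_on_imp_continuous_on holomorphic_on_subset[OF S_holo]) auto
  then obtain w where w: "w \<in> mid \<inter> cell" "\<And>z. z \<in> mid \<inter> cell \<Longrightarrow> \<phi> w \<le> \<phi> z"
    using continuous_attains_inf[OF compact_mid_cell ne] by blast
  have "\<phi> w > 0" using mid_not_L[of w] w(1) S_zero by (auto simp: \<phi>_def)
  moreover have "\<phi> w * exp (\<alpha> * (norm z)\<^sup>2) \<le> norm (S z)" if "z \<in> mid" for z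
  proof -
    obtain l where l: "l \<in> L" "z - l \<in> cell" "z - l \<in> mid"
      using cell_translate[OF \<open>z \<in> mid\<close>] by metis
    have "\<phi> w \<le> \<phi> (z - l)" using w l by auto
    also have "\<dots> = \<phi> z" using S_periodic[OF l(1), of "z - l"] by (simp add: \<phi>_def)
    finally have "\<phi> w * exp (\<alpha> * (norm z)\<^sup>2) \<le> \<phi> z * exp (\<alpha> * (norm z)\<^sup>2)"
      by (intro mult_right_mono) auto
    also have "\<phi> z * exp (\<alpha> * (norm z)\<^sup>2) = norm (S z)"
      by (simp add: \<phi>_def mult.assoc flip: exp_add)
    finally show ?thesis .
  qed
  ultimately show ?thesis using that by blast
qed

definition gauss_sum where "gauss_sum = infsum (\<lambda>z. exp (- \<alpha> * (norm z)\<^sup>2)) L"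

lemma sum_le_gauss_sum: "finite F \<Longrightarrow> F \<subseteq> L \<Longrightarrow> (\<Sum>l\<in>F. exp (- \<alpha> * (norm l)\<^sup>2)) \<le> gauss_sum"
  unfolding gauss_sum_def using summable_L[OF \<alpha>_pos]
  by (intro finite_sum_le_infsum) auto

lemma finite_L_cbox: "finite (L \<inter> cbox a b)"
proof -
  have "finite {m::int. Re a \<le> p * of_int m \<and> p * of_int m \<le> Re b}"
  proof (rule finite_subset)
    show "{m::int. Re a \<le> p * of_int m \<and> p * of_int m \<le> Re b} \<subseteq> {\<lceil>Re a / p\<rceil>..\<lfloor>Re b / p\<rfloor>}"
      using p_pos by (auto simp: ceiling_le_iff le_floor_iff field_simps)
  qed auto
  moreover have "finite {m::int. Im a \<le> q * of_int m \<and> q * of_int m \<le> Im b}"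
  proof (rule finite_subset)
    show "{m::int. Im a \<le> q * of_int m \<and> q * of_int m \<le> Im b} \<subseteq> {\<lceil>Im a / q\<rceil>..\<lfloor>Im b / q\<rfloor>}"
      using q_pos by (auto simp: ceiling_le_iff le_floor_iff field_simps)
  qed auto
  ultimately have "finite ((\<lambda>(m, n). Complex (p * of_int m) (q * of_int n)) `
      ({m::int. Re a \<le> p * of_int m \<and> p * of_int m \<le> Re b} \<times> {m::int. Im a \<le> q * of_int m \<and> q * of_int m \<le> Im b}))"
    by blast
  moreover have "L \<inter> cbox a b \<subseteq> \<dots>"
    using L_sub by (fastforce simp: in_cbox_complex_iff)
  ultimately show ?thesis by (rule finite_subset[rotated])
qed

definition rect :: "nat \<Rightarrow> complex set" where
  "rect N = cbox (- Complex (p * (N + 1 / 2)) (q * (N + 1 / 2))) (Complex (p * (N + 1 / 2)) (q * (N + 1 / 2)))"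

text \<open>An open neighbourhood of \<open>rect N\<close> that contains no further lattice points.\<close>
definition open_rect :: "nat \<Rightarrow> complex set" where
  "open_rect N = box (- Complex (p * (N + 3 / 4)) (q * (N + 3 / 4))) (Complex (p * (N + 3 / 4)) (q * (N + 3 / 4)))"

lemma rect_subset_open_rect: "rect N \<subseteq> open_rect N"
proof -
  have "p * (N + 1 / 2) < p * (N + 3 / 4)" "q * (N + 1 / 2) < q * (N + 3 / 4)"
    using p_pos q_pos by auto
  thus ?thesis
    unfolding rect_def open_rect_def by (auto simp: in_cbox_complex_iff in_box_complex_iff)
qed

lemma L_open_rect: "l \<in> L \<Longrightarrow> l \<in> open_rect N \<Longrightarrow> l \<in> rect N"
proof -
  assume l: "l \<in> L" "l \<in> open_rect N"
  then obtain m n where lmn: "l = Complex (p * of_int m) (q * of_int n)" using L_sub by blast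
  have *: "\<bar>r * of_int m\<bar> \<le> r * (N + 1 / 2)" if "\<bar>r * of_int m\<bar> < r * (N + 3 / 4)" "r > 0" for r :: real and m :: int
  proof -
    have "r * \<bar>of_int m\<bar> < r * (N + 3 / 4)" using that by (simp add: abs_mult)
    hence "\<bar>real_of_int m\<bar> < N + 3 / 4" using that by (simp only: mult_less_cancel_left_pos)
    hence "\<bar>m\<bar> \<le> int N" by linarith
    hence "\<bar>real_of_int m\<bar> \<le> N + 1 / 2" by linarith
    hence "r * \<bar>of_int m\<bar> \<le> r * (N + 1 / 2)" using that by (intro mult_left_mono) auto
    thus ?thesis using that by (simp add: abs_mult)
  qed
  from l(2) have "\<bar>p * of_int m\<bar> < p * (N + 3 / 4)" "\<bar>q * of_int n\<bar> < q * (N + 3 / 4)"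
    unfolding open_rect_def lmn in_box_complex_iff by auto
  from *[OF this(1) p_pos] *[OF this(2) q_pos] show ?thesis
    unfolding rect_def lmn in_cbox_complex_iff by auto
qed

lemma frontier_rect:
  assumes "z \<in> frontier (rect N)"
  shows "z \<in> mid" "norm z \<ge> min p q * N"
proof -
  have "Re z = - (p * (N + 1 / 2)) \<or> Re z = p * (N + 1 / 2) \<or> Im z = - (q * (N + 1 / 2)) \<or> Im z = q * (N + 1 / 2)"
    using assms unfolding rect_def frontier_cbox by (auto simp: in_cbox_complex_iff in_box_complex_iff)
  moreover have "Re z = p * (of_int (int N) + 1 / 2)" if "Re z = p * (N + 1 / 2)" using that by simp
  moreover have "Re z = p * (of_int (- int N - 1) + 1 / 2)" if "Re z = - (p * (N + 1 / 2))" using that by (simp add: algebra_simps)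
  moreover have "Im z = q * (of_int (int N) + 1 / 2)" if "Im z = q * (N + 1 / 2)" using that by simp
  moreover have "Im z = q * (of_int (- int N - 1) + 1 / 2)" if "Im z = - (q * (N + 1 / 2))" using that by (simp add: algebra_simps)
  ultimately show "z \<in> mid" unfolding mid_def by blast
  have "min p q * N \<le> p * (N + 1 / 2)" "min p q * N \<le> q * (N + 1 / 2)"
    using p_pos q_pos by (intro mult_mono; simp)+
  moreover have "\<bar>Re z\<bar> \<ge> p * (N + 1 / 2) \<or> \<bar>Im z\<bar> \<ge> q * (N + 1 / 2)"
    using \<open>Re z = _ \<or> _\<close> by auto
  ultimately show "norm z \<ge> min p q * N"
    using abs_Re_le_cmod[of z] abs_Im_le_cmod[of z] by linarith
qed

lemma in_rect_large: "\<forall>\<^sub>F N in sequentially. z \<in> rect N"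
proof -
  obtain N0 :: nat where N0: "\<bar>Re z\<bar> / p + \<bar>Im z\<bar> / q \<le> N0" using real_arch_simple by blast
  have "z \<in> rect N" if "N \<ge> N0" for N
  proof -
    have N: "real N0 \<le> N" using that by simp
    have pos: "\<bar>Re z\<bar> / p \<ge> 0" "\<bar>Im z\<bar> / q \<ge> 0" using p_pos q_pos by auto
    have "\<bar>Re z\<bar> / p \<le> N + 1 / 2" "\<bar>Im z\<bar> / q \<le> N + 1 / 2" using N N0 pos by linarith+
    hence "\<bar>Re z\<bar> \<le> p * (N + 1 / 2)" "\<bar>Im z\<bar> \<le> q * (N + 1 / 2)"
      using p_pos q_pos by (auto simp: pos_divide_le_eq mult.commute)
    thus ?thesis unfolding rect_def in_cbox_complex_iff by auto
  qed
  thus ?thesis unfolding eventually_sequentially by blast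
qed

text \<open>The entire function that is \<open>1\<close> at \<open>l\<close> and \<open>0\<close> at all other lattice points.\<close>
definition lagrange :: "complex \<Rightarrow> complex \<Rightarrow> complex" where
  "lagrange l z = (if z = l then 1 else S z / (deriv S l * (z - l)))"

lemma deriv_S_nonzero: "l \<in> L \<Longrightarrow> deriv S l \<noteq> 0"
  using norm_deriv_S[of l] S_deriv_0 by auto

lemma lagrange_holomorphic:
  assumes "l \<in> L"
  shows "lagrange l holomorphic_on UNIV"
proof -
  have "(\<lambda>z. (if z = l then deriv S l else (S z - S l) / (z - l)) / deriv S l) holomorphic_on UNIV"
    using deriv_S_nonzero[OF assms] by (intro holomorphic_intros pole_lemma_open S_holo) auto
  also have "(\<lambda>z. (if z = l then deriv S l else (S z - S l) / (z - l)) / deriv S l) = lagrange l"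
    using deriv_S_nonzero[OF assms] assms S_zero[of l] by (auto simp: lagrange_def)
  finally show ?thesis .
qed

text \<open>After subtracting its Lagrange interpolant on a large rectangle, \<open>E\<close> is divisible by \<open>S\<close> there, and the
  quotient is estimated by the maximum principle. On the boundary of the rectangle \<open>E / S\<close> tends to \<open>0\<close>
  because \<open>\<beta> < \<alpha>\<close>, and the interpolant contributes at most \<open>B\<close> times a convergent Gaussian sum. The bound
  obtained is independent of \<open>C\<close> and \<open>\<beta>\<close>, which makes it applicable to all translates of \<open>E\<close> at once.\<close>
lemma interpolation_bound:
  assumes E: "E holomorphic_on UNIV"
    and growth: "\<And>z. norm (E z) \<le> C * exp (\<beta> * (norm z)\<^sup>2)" and "\<beta> < \<alpha>"
    and B: "\<And>l. l \<in> L \<Longrightarrow> norm (E l) \<le> B"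
    and z: "z \<in> mid"
  shows "norm (E z / S z) \<le> 2 * (B / norm (deriv S 0) * gauss_sum / (min p q / 2))"
proof -
  define d where "d = min p q / 2"
  have d: "d > 0" using p_pos q_pos by (simp add: d_def)
  have B0: "B \<ge> 0" using B[OF zero_in_L] norm_ge_zero order_trans by blast
  define Q where "Q = B / norm (deriv S 0) * gauss_sum / d"
  obtain c where c: "c > 0" "\<And>z. z \<in> mid \<Longrightarrow> c * exp (\<alpha> * (norm z)\<^sup>2) \<le> norm (S z)"
    using norm_S_lower by blast
  have C0: "C \<ge> 0" using order_trans[OF norm_ge_zero growth[of 0]] by simp
  define T where "T w F = (\<Sum>l\<in>F. E l / deriv S l / (w - l))" for w F
  have T_bound: "norm (T w F) \<le> Q" if "w \<in> mid" "finite F" "F \<subseteq> L" for w F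
  proof -
    have "norm (T w F) \<le> (\<Sum>l\<in>F. norm (E l / deriv S l / (w - l)))"
      unfolding T_def by (rule norm_sum)
    also have "\<dots> \<le> (\<Sum>l\<in>F. B / norm (deriv S 0) * exp (- \<alpha> * (norm l)\<^sup>2) / d)"
    proof (rule sum_mono)
      fix l assume "l \<in> F"
      hence l: "l \<in> L" using that by blast
      have "norm (E l / deriv S l / (w - l)) \<le> B / norm (deriv S l) / norm (w - l)"
        unfolding norm_divide using B[OF l] by (intro divide_right_mono) auto
      also have "\<dots> \<le> B / norm (deriv S l) / d"
        using B0 d mid_dist_L[OF that(1) l] by (intro divide_left_mono) (auto simp: d_def intro!: mult_pos_pos)
      also have "\<dots> = B / norm (deriv S 0) * exp (- \<alpha> * (norm l)\<^sup>2) / d"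
        by (simp add: norm_deriv_S[OF l] exp_minus divide_inverse)
      finally show "norm (E l / deriv S l / (w - l)) \<le> B / norm (deriv S 0) * exp (- \<alpha> * (norm l)\<^sup>2) / d" .
    qed
    also have "\<dots> = B / norm (deriv S 0) * (\<Sum>l\<in>F. exp (- \<alpha> * (norm l)\<^sup>2)) / d"
      by (simp add: sum_distrib_left sum_divide_distrib)
    also have "\<dots> \<le> Q"
      unfolding Q_def using that sum_le_gauss_sum B0 d
      by (intro divide_right_mono mult_left_mono) auto
    finally show ?thesis .
  qed
  \<comment> \<open>A bound for \<open>E / S\<close> on the boundary of \<open>rect N\<close>.\<close>
  define \<delta> where "\<delta> N = C / c * exp (- (\<alpha> - \<beta>) * (min p q * N)\<^sup>2)" for N :: nat
  have main: "norm (E z / S z) \<le> \<delta> N + 2 * Q" if zN: "z \<in> rect N" for N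
  proof -
    define F where "F = L \<inter> rect N"
    have F: "finite F" "F \<subseteq> L" unfolding F_def rect_def using finite_L_cbox by auto
    define f where "f w = E w - (\<Sum>l\<in>F. E l * lagrange l w)" for w
    have f_holo: "f holomorphic_on open_rect N"
      unfolding f_def using F
      by (intro holomorphic_intros holomorphic_on_subset[OF E] holomorphic_on_subset[OF lagrange_holomorphic]) auto
    have fz: "f w = 0" if "w \<in> L" "w \<in> open_rect N" for w
    proof -
      have "w \<in> F" using L_open_rect[OF that] that by (auto simp: F_def)
      have "(\<Sum>l\<in>F. E l * lagrange l w) = (\<Sum>l\<in>F. if l = w then E w else 0)"
        using that S_zero[of w] by (intro sum.cong) (auto simp: lagrange_def)
      also have "\<dots> = E w" using F \<open>w \<in> F\<close> by simp
      finally show ?thesis by (simp add: f_def)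
    qed
    obtain h where h: "h holomorphic_on open_rect N" "\<And>w. w \<in> open_rect N \<Longrightarrow> S w \<noteq> 0 \<Longrightarrow> h w = f w / S w"
    proof (rule holomorphic_on_quotient_simple_zeros[OF f_holo])
      show "S holomorphic_on open_rect N" using S_holo by (rule holomorphic_on_subset) auto
      show "open (open_rect N)" unfolding open_rect_def by (rule open_box)
      show "f z = 0 \<and> deriv S z \<noteq> 0" if "z \<in> open_rect N" "S z = 0" for z
        using that fz S_zero deriv_S_nonzero by blast
    qed (use that in blast)
    have h_mid: "h w = E w / S w - T w F" if "w \<in> mid" "w \<in> rect N" for w
    proof -
      have w: "w \<notin> L" "S w \<noteq> 0" using mid_not_L[OF that(1)] S_zero by auto
      have "h w = f w / S w" using h(2) that w rect_subset_open_rect by auto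
      also have "\<dots> = E w / S w - (\<Sum>l\<in>F. E l * lagrange l w) / S w"
        by (simp add: f_def diff_divide_distrib)
      also have "(\<Sum>l\<in>F. E l * lagrange l w) / S w = T w F"
        unfolding T_def sum_divide_distrib
        using w F by (intro sum.cong) (auto simp: lagrange_def)
      finally show ?thesis .
    qed
    have "norm (h z) \<le> \<delta> N + Q"
    proof (rule maximum_modulus_frontier[of h "rect N"])
      show "h holomorphic_on interior (rect N)"
        using h(1) by (rule holomorphic_on_subset) (use rect_subset_open_rect interior_subset in blast)
      show "continuous_on (closure (rect N)) h"
        using holomorphic_on_imp_continuous_on[OF h(1)] rect_subset_open_rect[of N]
        by (auto simp: rect_def intro: continuous_on_subset)
      show "bounded (rect N)" by (simp add: rect_def)
      show "z \<in> rect N" by fact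
      fix w assume w: "w \<in> frontier (rect N)"
      hence w_in: "w \<in> rect N" by (auto simp: rect_def frontier_cbox)
      note w' = frontier_rect[OF w]
      have "norm (E w / S w) \<le> (C * exp (\<beta> * (norm w)\<^sup>2)) / (c * exp (\<alpha> * (norm w)\<^sup>2))"
        unfolding norm_divide using c w' growth[of w] C0 by (intro frac_le) auto
      also have "\<dots> = C / c * exp (- (\<alpha> - \<beta>) * (norm w)\<^sup>2)"
        by (simp add: exp_minus exp_diff left_diff_distrib field_simps)
      also have "\<dots> \<le> \<delta> N"
      proof -
        have "(min p q * N)\<^sup>2 \<le> (norm w)\<^sup>2"
          using w'(2) p_pos q_pos by (intro power_mono) auto
        hence "- (\<alpha> - \<beta>) * (norm w)\<^sup>2 \<le> - (\<alpha> - \<beta>) * (min p q * N)\<^sup>2"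
          using assms(3) by (intro mult_left_mono_neg) auto
        thus ?thesis unfolding \<delta>_def using C0 c by (intro mult_left_mono) auto
      qed
      finally have 1: "norm (E w / S w) \<le> \<delta> N" .
      have "norm (h w) \<le> norm (E w / S w) + norm (T w F)"
        unfolding h_mid[OF w'(1) w_in] by (rule norm_triangle_ineq4)
      with 1 T_bound[OF w'(1) F] show "norm (h w) \<le> \<delta> N + Q" by linarith
    qed
    moreover have "norm (E z / S z) \<le> norm (h z) + norm (T z F)"
      using h_mid[OF z zN] by (metis add.commute diff_add_cancel norm_triangle_ineq)
    ultimately show ?thesis using T_bound[OF z F] by linarith
  qed
  have "\<delta> \<longlonglongrightarrow> C / c * 0"
    unfolding \<delta>_def using assms(3) p_pos q_pos
    by (intro tendsto_mult tendsto_const exp_neg_square_tendsto_0) auto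
  hence "(\<lambda>N. \<delta> N + 2 * Q) \<longlonglongrightarrow> 2 * Q" 
    using tendsto_add[of \<delta> 0 sequentially "\<lambda>_. 2 * Q" "2 * Q"] by simp
  moreover have "\<forall>\<^sub>F N in sequentially. norm (E z / S z) \<le> \<delta> N + 2 * Q"
    using in_rect_large[of z] by eventually_elim (rule main)
  ultimately have "norm (E z / S z) \<le> 2 * Q"
    by (intro tendsto_lowerbound[of "\<lambda>N. \<delta> N + 2 * Q"]) auto
  thus ?thesis by (simp add: Q_def d_def)
qed

text \<open>A lattice translate of \<open>E\<close> satisfies the same hypotheses with the same \<open>B\<close>, only \<open>C\<close> and \<open>\<beta>\<close> change. So
  the interpolation bound in one period cell holds in all of them, \<open>E\<close> is bounded, and the classical
  Liouville theorem applies.\<close>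
theorem liouville:
  assumes E: "E holomorphic_on UNIV"
    and growth: "\<And>z. norm (E z) \<le> C * exp (\<beta> * (norm z)\<^sup>2)" and \<beta>: "0 < \<beta>" "\<beta> < \<alpha>"
    and B: "\<And>l. l \<in> L \<Longrightarrow> norm (E l) \<le> B"
  shows "E constant_on UNIV"
proof -
  have C0: "C \<ge> 0" using order_trans[OF norm_ge_zero growth[of 0]] by simp
  define Q where "Q = 2 * (B / norm (deriv S 0) * gauss_sum / (min p q / 2))"
  have "bounded (S ` (mid \<inter> cell))"
    by (intro compact_imp_bounded compact_continuous_image compact_mid_cell
        holomorphic_on_imp_continuous_on holomorphic_on_subset[OF S_holo]) auto
  then obtain M where M: "M > 0" "\<And>z. z \<in> mid \<inter> cell \<Longrightarrow> norm (S z) \<le> M"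
    by (auto simp: bounded_pos)
  have mid_bound: "norm (E z) \<le> M * Q" if "z \<in> mid" for z
  proof -
    obtain l where l: "l \<in> L" "z - l \<in> cell" "z - l \<in> mid"
      using cell_translate[OF \<open>z \<in> mid\<close>] by metis
    \<comment> \<open>Any \<open>\<eta> > 0\<close> with \<open>\<beta> (1 + \<eta>) < \<alpha>\<close> would do.\<close>
    define \<eta> where "\<eta> = (\<alpha> / \<beta> - 1) / 2"
    have \<eta>: "\<eta> > 0" "\<beta> * (1 + \<eta>) < \<alpha>"
      using \<beta> by (simp_all add: \<eta>_def field_simps)
    have "norm (E (z - l + l) / S (z - l)) \<le> Q"
      unfolding Q_def
    proof (rule interpolation_bound[where E = "\<lambda>w. E (w + l)"])
      have "E \<circ> (\<lambda>w. w + l) holomorphic_on UNIV"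
        by (rule holomorphic_on_compose_gen[OF _ E]) (auto intro!: holomorphic_intros)
      thus "(\<lambda>w. E (w + l)) holomorphic_on UNIV" by (simp add: o_def)
      show "norm (E (w + l)) \<le> C * exp (\<beta> * ((1 + 1 / \<eta>) * (norm l)\<^sup>2)) * exp (\<beta> * (1 + \<eta>) * (norm w)\<^sup>2)" for w
      proof -
        have "\<beta> * (norm (w + l))\<^sup>2 \<le> \<beta> * ((1 + \<eta>) * (norm w)\<^sup>2 + (1 + 1 / \<eta>) * (norm l)\<^sup>2)"
          using \<beta> by (intro mult_left_mono norm_add_sq_le \<eta>) auto
        hence "exp (\<beta> * (norm (w + l))\<^sup>2) \<le> exp (\<beta> * ((1 + 1 / \<eta>) * (norm l)\<^sup>2)) * exp (\<beta> * (1 + \<eta>) * (norm w)\<^sup>2)"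
          by (simp add: exp_add[symmetric] algebra_simps)
        with growth[of "w + l"] C0 show ?thesis
          by (smt (verit) mult.assoc mult_left_mono)
      qed
      show "norm (E (m + l)) \<le> B" if "m \<in> L" for m
        using B[OF add_in_L[OF l(1) that]] .
    qed (use \<eta> l in auto)
    moreover have "S (z - l) \<noteq> 0" using mid_not_L[OF l(3)] S_zero by blast
    ultimately have "norm (E z) \<le> norm (S (z - l)) * Q"
      by (simp add: norm_divide pos_divide_le_eq mult.commute)
    also have "\<dots> \<le> M * Q"
    proof -
      have "Q \<ge> 0" using \<open>norm (E (z - l + l) / S (z - l)) \<le> Q\<close> norm_ge_zero order_trans by blast
      thus ?thesis using M l by (intro mult_right_mono) auto
    qed
    finally show ?thesis .
  qed
  have "norm (E z) \<le> M * Q" for z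
  proof -
    obtain N where N: "z \<in> rect N"
      using in_rect_large[of z] eventually_happens'[OF sequentially_bot] by blast
    show ?thesis
    proof (rule maximum_modulus_frontier[of E "rect N"])
      show "norm (E w) \<le> M * Q" if "w \<in> frontier (rect N)" for w
        using mid_bound frontier_rect(1)[OF that] by blast
      show "E holomorphic_on interior (rect N)" "continuous_on (closure (rect N)) E"
        using E holomorphic_on_imp_continuous_on[OF E] by (auto intro: holomorphic_on_subset continuous_on_subset)
      show "bounded (rect N)" by (simp add: rect_def)
    qed fact
  qed
  hence "bounded (range E)" by (auto simp: bounded_iff)
  thus ?thesis by (rule Liouville_theorem[OF E])
qed

end

section \<open>Derivatives of entire functions of Gaussian growth\<close>

text \<open>Cauchy's inequality on unit circles bounds the first two derivatives by the function itself on nearby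
  points, which costs an arbitrarily small increase of the exponent.\<close>
lemma entire_growth_estimates:
  assumes F: "F holomorphic_on UNIV"
    and growth: "\<And>z. norm (F z) \<le> C0 * exp (b0 * (norm z)\<^sup>2)" and b: "0 < b0" "b0 < b"
  obtains C where "C > 0" "\<And>z. norm (F z) \<le> C * exp (b * (norm z)\<^sup>2)"
    "\<And>z. norm (deriv F z) \<le> C * exp (b * (norm z)\<^sup>2)"
    "\<And>z d. norm d \<le> 1 \<Longrightarrow> norm (F (z + d) - F z - deriv F z * d) \<le> C * exp (b * (norm z)\<^sup>2) * (norm d)\<^sup>2"
proof -
  have C0: "C0 \<ge> 0" using order_trans[OF norm_ge_zero growth[of 0]] by simp
  define \<eta> where "\<eta> = b / b0 - 1"
  have \<eta>: "\<eta> > 0" "b0 * (1 + \<eta>) = b" using b by (auto simp: \<eta>_def field_simps)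
  \<comment> \<open>Discs of radius \<open>3\<close> cover the unit circles around points at distance at most \<open>2\<close>, whence the \<open>9 = 3\<^sup>2\<close>. Adding \<open>1\<close> to \<open>C0\<close> makes the constant positive, and the factor \<open>2\<close> absorbs the \<open>2!\<close> of the second derivative.\<close>
  define C where "C = 2 * (C0 + 1) * exp (b0 * ((1 + 1 / \<eta>) * 9))"
  have C: "C > 0" using C0 by (simp add: C_def)
  have near: "norm (F (z + d)) \<le> C / 2 * exp (b * (norm z)\<^sup>2)" if d: "norm d \<le> 3" for z d
  proof -
    have "(norm (z + d))\<^sup>2 \<le> (1 + \<eta>) * (norm z)\<^sup>2 + (1 + 1 / \<eta>) * (norm d)\<^sup>2"
      by (rule norm_add_sq_le[OF \<eta>(1)])
    also have "(norm d)\<^sup>2 \<le> 9" using power_mono[OF d, of 2] by simp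
    hence "(1 + \<eta>) * (norm z)\<^sup>2 + (1 + 1 / \<eta>) * (norm d)\<^sup>2 \<le> (1 + \<eta>) * (norm z)\<^sup>2 + (1 + 1 / \<eta>) * 9"
      using \<eta> by (intro add_left_mono mult_left_mono) auto
    finally have "b0 * (norm (z + d))\<^sup>2 \<le> b0 * ((1 + \<eta>) * (norm z)\<^sup>2 + (1 + 1 / \<eta>) * 9)"
      using b by (intro mult_left_mono) auto
    also have "\<dots> = b * (norm z)\<^sup>2 + b0 * ((1 + 1 / \<eta>) * 9)"
      unfolding \<eta>(2)[symmetric] by (simp add: algebra_simps)
    finally have "exp (b0 * (norm (z + d))\<^sup>2) \<le> exp (b0 * ((1 + 1 / \<eta>) * 9)) * exp (b * (norm z)\<^sup>2)"
      by (simp add: exp_add[symmetric] add.commute)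
    hence "C0 * exp (b0 * (norm (z + d))\<^sup>2) \<le> (C0 + 1) * (exp (b0 * ((1 + 1 / \<eta>) * 9)) * exp (b * (norm z)\<^sup>2))"
      using C0 by (intro mult_mono) auto
    hence "norm (F (z + d)) \<le> (C0 + 1) * (exp (b0 * ((1 + 1 / \<eta>) * 9)) * exp (b * (norm z)\<^sup>2))"
      by (rule order_trans[OF growth])
    also have "\<dots> = C / 2 * exp (b * (norm z)\<^sup>2)" by (simp only: C_def mult.assoc mult_2 field_sum_of_halves) simp
    finally show ?thesis .
  qed
  have cauchy: "norm ((deriv ^^ n) F (z + d)) \<le> fact n * (C / 2 * exp (b * (norm z)\<^sup>2))" if d: "norm d \<le> 2" for z d n
  proof -
    have "norm ((deriv ^^ n) F (z + d)) \<le> fact n * (C / 2 * exp (b * (norm z)\<^sup>2)) / 1 ^ n"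
    proof (rule Cauchy_inequality)
      show "F holomorphic_on ball (z + d) 1" "continuous_on (cball (z + d) 1) F"
        using F holomorphic_on_imp_continuous_on[OF F]
        by (auto intro: holomorphic_on_subset continuous_on_subset)
      fix x assume "norm (z + d - x) = 1"
      hence "norm (x - z) \<le> 3" using d norm_triangle_ineq4[of d "z + d - x"] by (simp add: algebra_simps)
      from near[OF this, of z] show "norm (F x) \<le> C / 2 * exp (b * (norm z)\<^sup>2)" by simp
    qed auto
    thus ?thesis by simp
  qed
  have D: "(deriv F) holomorphic_on UNIV" by (intro holomorphic_deriv F) auto
  show ?thesis
  proof (rule that[OF C])
    have half: "C / 2 * exp (b * (norm z)\<^sup>2) \<le> C * exp (b * (norm z)\<^sup>2)" for z :: complex
      using C by simp
    show "norm (F z) \<le> C * exp (b * (norm z)\<^sup>2)" for z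
      using near[of 0 z] half[of z] by simp
    show "norm (deriv F z) \<le> C * exp (b * (norm z)\<^sup>2)" for z
      using cauchy[of 0 1 z] half[of z] by simp
    fix z d :: complex assume d: "norm d \<le> 1"
    define f where "f i = (deriv ^^ i) F" for i
    have "norm (f 0 (z + d) - (\<Sum>i\<le>1. f i z * (z + d - z) ^ i / fact i)) \<le>
        (C * exp (b * (norm z)\<^sup>2)) * norm (z + d - z) ^ Suc 1 / fact 1"
    proof (rule field_Taylor[where S = "cball z 1" and f = f])
      fix i x assume "i \<le> (1::nat)"
      thus "(f i has_field_derivative f (Suc i) x) (at x within cball z 1)"
        using holomorphic_derivI[OF F open_UNIV] holomorphic_derivI[OF D open_UNIV]
        by (cases i) (auto simp: f_def)
    next
      fix x assume "x \<in> cball z 1"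
      hence "norm (x - z) \<le> 2" by (simp add: dist_norm norm_minus_commute)
      from cauchy[OF this, of "Suc 1" z] show "norm (f (Suc 1) x) \<le> C * exp (b * (norm z)\<^sup>2)"
        by (simp add: f_def)
    qed (use d in \<open>auto simp: dist_norm\<close>)
    thus "norm (F (z + d) - F z - deriv F z * d) \<le> C * exp (b * (norm z)\<^sup>2) * (norm d)\<^sup>2"
      by (simp add: f_def power2_eq_square algebra_simps)
  qed
qed

section \<open>Equal moduli at three nearby points\<close>

text \<open>First-order expansion of the squared modulus of a function with value \<open>f0\<close> and derivative \<open>f1\<close> at the
  centre, displacement \<open>d\<close> and Taylor remainder \<open>\<rho>\<close>.\<close>
lemma norm_sq_first_order:
  fixes f0 f1 d \<rho> :: complex
  assumes m: "norm f0 \<le> m" "norm f1 \<le> m" and r: "norm d \<le> r" "r \<le> 1" and \<rho>: "norm \<rho> \<le> m * r\<^sup>2"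
  shows "\<bar>(norm (f0 + f1 * d + \<rho>))\<^sup>2 - (norm f0)\<^sup>2 - 2 * Re (f1 * cnj f0 * d)\<bar> \<le> 6 * m\<^sup>2 * r\<^sup>2"
proof -
  have m0: "m \<ge> 0" and r0: "r \<ge> 0" using m r norm_ge_zero order_trans by blast+
  have eq: "(norm (f0 + f1 * d + \<rho>))\<^sup>2 - (norm f0)\<^sup>2 - 2 * Re (f1 * cnj f0 * d) =
      (norm (f1 * d))\<^sup>2 + 2 * Re (cnj (f0 + f1 * d) * \<rho>) + (norm \<rho>)\<^sup>2"
    unfolding cmod_power2 by (simp add: power2_eq_square algebra_simps)
  have fd: "norm (f1 * d) \<le> m * r" unfolding norm_mult using m r m0 by (intro mult_mono) auto
  have "\<bar>Re (cnj (f0 + f1 * d) * \<rho>)\<bar> \<le> norm (cnj (f0 + f1 * d) * \<rho>)" by (rule abs_Re_le_cmod)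
  also have "\<dots> = norm (f0 + f1 * d) * norm \<rho>" by (metis complex_mod_cnj norm_mult)
  also have "\<dots> \<le> (2 * m) * (m * r\<^sup>2)"
  proof (intro mult_mono \<rho>)
    have "m * r \<le> m" using m0 r by (simp add: mult_left_le)
    thus "norm (f0 + f1 * d) \<le> 2 * m" using norm_triangle_ineq[of f0 "f1 * d"] m fd by linarith
  qed (use m0 in auto)
  finally have 1: "\<bar>Re (cnj (f0 + f1 * d) * \<rho>)\<bar> \<le> 2 * m\<^sup>2 * r\<^sup>2" by (simp add: power2_eq_square)
  have 2: "(norm (f1 * d))\<^sup>2 \<le> m\<^sup>2 * r\<^sup>2"
    using power_mono[OF fd, of 2] by (simp add: power_mult_distrib)
  have "norm \<rho> \<le> m * r"
  proof -
    have "r\<^sup>2 \<le> r" using r r0 by (simp add: power2_eq_square mult_left_le)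
    hence "m * r\<^sup>2 \<le> m * r" using m0 by (rule mult_left_mono)
    with \<rho> show ?thesis by linarith
  qed
  hence 3: "(norm \<rho>)\<^sup>2 \<le> m\<^sup>2 * r\<^sup>2"
    using power_mono[of "norm \<rho>" "m * r" 2] by (simp add: power_mult_distrib)
  have 4: "0 \<le> (norm (f1 * d))\<^sup>2" "0 \<le> (norm \<rho>)\<^sup>2" by auto
  have "X + 2 * Y + Z \<le> 6 * W \<and> - (X + 2 * Y + Z) \<le> 6 * W"
    if "X \<le> W" "\<bar>Y\<bar> \<le> 2 * W" "Z \<le> W" "0 \<le> X" "0 \<le> Z" for X Y Z W :: real
    using that by linarith
  from this[OF 2 _ 3 4, of "Re (cnj (f0 + f1 * d) * \<rho>)"] 1 show ?thesis
    unfolding eq abs_le_iff by (simp add: mult.assoc)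
qed

text \<open>A real-linear form on the plane that is small on two vectors is small, up to the inverse of the area
  that the two vectors span.\<close>
lemma linear_form_bound:
  fixes A v1 v2 :: complex
  assumes "\<bar>Re (A * v1)\<bar> \<le> e" "\<bar>Re (A * v2)\<bar> \<le> e" "norm v1 \<le> \<rho>" "norm v2 \<le> \<rho>"
  shows "norm A * \<bar>Im (cnj v1 * v2)\<bar> \<le> 2 * \<rho> * e"
proof -
  have eq: "of_real (Re (A * v1)) * v2 - of_real (Re (A * v2)) * v1 = \<i> * of_real (Im (cnj v1 * v2)) * cnj A"
    by (simp add: complex_eq_iff algebra_simps)
  have "norm A * \<bar>Im (cnj v1 * v2)\<bar> = norm (of_real (Re (A * v1)) * v2 - of_real (Re (A * v2)) * v1)"
    unfolding eq by (simp only: norm_mult norm_ii norm_of_real complex_mod_cnj mult_1_left mult.commute)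
  also have "\<dots> \<le> \<bar>Re (A * v1)\<bar> * norm v2 + \<bar>Re (A * v2)\<bar> * norm v1"
    by (rule order_trans[OF norm_triangle_ineq4]) (simp only: norm_mult norm_of_real order_refl)
  also have "\<dots> \<le> e * \<rho> + e * \<rho>"
    using assms by (intro add_mono mult_mono) auto
  finally show ?thesis by simp
qed

text \<open>With \<open>A = f1 cnj f0 - h1 cnj h0\<close> and \<open>D = |f0|\<^sup>2 - |h0|\<^sup>2\<close>, the function \<open>|F|\<^sup>2 - |H|\<^sup>2\<close> has the first-order
  expansion \<open>D + 2 Re (A d)\<close>. Its vanishing at three well separated points forces \<open>A\<close> to be small; when \<open>A\<close> is
  known to be real, two points with different abscissae suffice. Then also \<open>D\<close> is small, and
  \<open>cnj f0 (f1 h0 - f0 h1) = A h0 - D h1\<close> transfers this to the Wronskian. The three displacements are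
  \<open>d1\<close>, \<open>d2\<close>, \<open>d3\<close>; \<open>r\<close> bounds their size and \<open>\<kappa>\<close> measures their separation relative to \<open>r\<close>.\<close>
lemma wronskian_bound:
  fixes f0 f1 h0 h1 d1 d2 d3 :: complex
  assumes m: "norm f0 \<le> m" "norm f1 \<le> m" "norm h0 \<le> m" "norm h1 \<le> m"
    and r: "0 < r" "r \<le> 1" and \<kappa>: "0 < \<kappa>" "\<kappa> \<le> 1"
    and near: "\<And>d. d \<in> {d1, d2, d3} \<Longrightarrow> norm d \<le> r \<and>
       (\<exists>\<rho> \<sigma>. norm \<rho> \<le> m * r\<^sup>2 \<and> norm \<sigma> \<le> m * r\<^sup>2 \<and> norm (f0 + f1 * d + \<rho>) = norm (h0 + h1 * d + \<sigma>))"
    and sep: "\<bar>Im (cnj (d2 - d1) * (d3 - d1))\<bar> \<ge> r\<^sup>2 * \<kappa>\<^sup>2 \<or>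
       f1 * cnj f0 - h1 * cnj h0 \<in> \<real> \<and> \<bar>Re (d2 - d1)\<bar> \<ge> r * \<kappa>"
  shows "norm (f0 * (f1 * h0 - f0 * h1)) \<le> 64 * m ^ 3 * r / \<kappa>\<^sup>2"
proof -
  define A where "A = f1 * cnj f0 - h1 * cnj h0"
  define D where "D = (norm f0)\<^sup>2 - (norm h0)\<^sup>2"
  have m0: "m \<ge> 0" using m norm_ge_zero order_trans by blast
  have first: "\<bar>D + 2 * Re (A * d)\<bar> \<le> 12 * m\<^sup>2 * r\<^sup>2" if dd: "d \<in> {d1, d2, d3}" for d
  proof -
    obtain \<rho> \<sigma> where *: "norm \<rho> \<le> m * r\<^sup>2" "norm \<sigma> \<le> m * r\<^sup>2" "norm (f0 + f1 * d + \<rho>) = norm (h0 + h1 * d + \<sigma>)"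
      using near[OF dd] by blast
    have "\<bar>(norm (f0 + f1 * d + \<rho>))\<^sup>2 - (norm f0)\<^sup>2 - 2 * Re (f1 * cnj f0 * d)\<bar> \<le> 6 * m\<^sup>2 * r\<^sup>2"
      "\<bar>(norm (h0 + h1 * d + \<sigma>))\<^sup>2 - (norm h0)\<^sup>2 - 2 * Re (h1 * cnj h0 * d)\<bar> \<le> 6 * m\<^sup>2 * r\<^sup>2"
      using near[OF dd] by (intro norm_sq_first_order m r *; simp)+
    moreover have "Re (A * d) = Re (f1 * cnj f0 * d) - Re (h1 * cnj h0 * d)"
      by (simp add: A_def left_diff_distrib)
    ultimately show ?thesis unfolding *(3) D_def by linarith
  qed
  define e where "e = 12 * m\<^sup>2 * r\<^sup>2"
  have e: "e \<ge> 0" by (simp add: e_def)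
  have v: "\<bar>Re (A * (d - d1))\<bar> \<le> e" if "d \<in> {d1, d2, d3}" for d
  proof -
    have "Re (A * (d - d1)) = Re (A * d) - Re (A * d1)" by (simp add: right_diff_distrib)
    thus ?thesis using first[OF that] first[of d1] unfolding e_def by auto
  qed
  have nv: "norm (d - d1) \<le> 2 * r" if "d \<in> {d1, d2, d3}" for d
    using near[OF that] near[of d1] norm_triangle_ineq4[of d d1] by auto
  have A: "norm A \<le> 48 * m\<^sup>2 * r / \<kappa>\<^sup>2"
    using sep
  proof
    assume s: "\<bar>Im (cnj (d2 - d1) * (d3 - d1))\<bar> \<ge> r\<^sup>2 * \<kappa>\<^sup>2"
    have "norm A * (r\<^sup>2 * \<kappa>\<^sup>2) \<le> norm A * \<bar>Im (cnj (d2 - d1) * (d3 - d1))\<bar>"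
      using s by (intro mult_left_mono) auto
    also have "\<dots> \<le> 2 * (2 * r) * e"
      by (intro linear_form_bound v nv) auto
    also have "\<dots> = (48 * m\<^sup>2 * r) * r\<^sup>2" by (simp add: e_def power2_eq_square)
    finally have "norm A * \<kappa>\<^sup>2 * r\<^sup>2 \<le> (48 * m\<^sup>2 * r) * r\<^sup>2" by (simp add: mult_ac)
    hence "norm A * \<kappa>\<^sup>2 \<le> 48 * m\<^sup>2 * r" by (rule mult_right_le_imp_le) (use r in simp)
    thus ?thesis using \<kappa> by (simp add: pos_le_divide_eq)
  next
    assume s: "f1 * cnj f0 - h1 * cnj h0 \<in> \<real> \<and> \<bar>Re (d2 - d1)\<bar> \<ge> r * \<kappa>"
    then obtain a :: real where a: "A = of_real a" unfolding A_def Reals_def by auto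
    have "norm A * (r * \<kappa>) \<le> norm A * \<bar>Re (d2 - d1)\<bar>"
      using s by (intro mult_left_mono) auto
    also have "\<dots> = \<bar>Re (A * (d2 - d1))\<bar>" by (simp add: a abs_mult)
    also have "\<dots> \<le> e" by (rule v) simp
    finally have "norm A * \<kappa> * r \<le> (12 * m\<^sup>2 * r) * r" by (simp add: e_def power2_eq_square mult_ac)
    hence *: "norm A * \<kappa> \<le> 12 * m\<^sup>2 * r" by (rule mult_right_le_imp_le) (use r in simp)
    have "norm A * \<kappa>\<^sup>2 = norm A * \<kappa> * \<kappa>" by (simp add: power2_eq_square)
    also have "\<dots> \<le> norm A * \<kappa>" using \<kappa> by (intro mult_left_le) auto
    also have "\<dots> \<le> 48 * m\<^sup>2 * r" 
    proof -
      have "12 * m\<^sup>2 * r \<le> 48 * m\<^sup>2 * r" using r by (intro mult_right_mono) auto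
      with * show ?thesis by linarith
    qed
    finally show ?thesis using \<kappa> by (simp add: pos_le_divide_eq)
  qed
  have D: "\<bar>D\<bar> \<le> 16 * m\<^sup>2 * r"
  proof -
    have d1: "norm d1 \<le> r" using near[of d1] by simp
    have mm: "norm x * norm y \<le> m * m" if "norm x \<le> m" "norm y \<le> m" for x y :: complex
      using that m0 by (intro mult_mono) auto
    have "norm A \<le> norm (f1 * cnj f0) + norm (h1 * cnj h0)"
      unfolding A_def by (rule norm_triangle_ineq4)
    also have "\<dots> \<le> 2 * m\<^sup>2"
      using mm[OF m(2,1)] mm[OF m(4,3)] by (simp add: norm_mult power2_eq_square)
    finally have "norm A * norm d1 \<le> 2 * m\<^sup>2 * r" using d1 by (intro mult_mono) auto
    moreover have "\<bar>Re (A * d1)\<bar> \<le> norm A * norm d1" using abs_Re_le_cmod[of "A * d1"] by (simp add: norm_mult)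
    moreover have "m\<^sup>2 * r\<^sup>2 \<le> m\<^sup>2 * r"
      using r by (intro mult_left_mono) (auto simp: power2_eq_square mult_left_le)
    ultimately show ?thesis using first[of d1] by simp
  qed
  have "norm (f0 * (f1 * h0 - f0 * h1)) = norm (cnj f0 * (f1 * h0 - f0 * h1))"
    by (simp add: norm_mult)
  also have "cnj f0 * (f1 * h0 - f0 * h1) = A * h0 - of_real D * h1"
    unfolding A_def D_def of_real_diff complex_norm_square by (simp add: algebra_simps)
  also have "norm \<dots> \<le> norm A * norm h0 + \<bar>D\<bar> * norm h1"
    by (rule order_trans[OF norm_triangle_ineq4]) (simp add: norm_mult)
  also have "\<dots> \<le> (48 * m\<^sup>2 * r / \<kappa>\<^sup>2) * m + (16 * m\<^sup>2 * r) * m"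
    using A D m m0 r by (intro add_mono mult_mono) auto
  also have "(16 * m\<^sup>2 * r) * m \<le> (16 * m\<^sup>2 * r) * m / \<kappa>\<^sup>2"
  proof -
    have "\<kappa>\<^sup>2 \<le> 1" using \<kappa> by (simp add: power_le_one)
    moreover have "(16 * m\<^sup>2 * r) * m \<ge> 0" using r m0 by auto
    ultimately have "(16 * m\<^sup>2 * r) * m * \<kappa>\<^sup>2 \<le> (16 * m\<^sup>2 * r) * m" by (intro mult_left_le) auto
    thus ?thesis using \<kappa> by (simp add: pos_le_divide_eq)
  qed
  finally show ?thesis by (simp add: power2_eq_square power3_eq_cube field_simps)
qed

section \<open>Entire functions with equal moduli near a lattice\<close>

context lattice_sigma
begin

text \<open>By the Liouville theorem the function is constant, and its values at far lattice points tend to \<open>0\<close>.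
  Finitely many exceptional lattice points only influence the bound.\<close>
lemma vanishes_if_decays:
  assumes E: "E holomorphic_on UNIV"
    and growth: "\<And>z. norm (E z) \<le> C * exp (\<beta> * (norm z)\<^sup>2)" and \<beta>: "0 < \<beta>" "\<beta> < \<alpha>"
    and X: "finite X" and decay: "\<And>l. l \<in> L - X \<Longrightarrow> norm (E l) \<le> C' * exp (- \<epsilon> * (norm l)\<^sup>2)"
    and \<epsilon>: "\<epsilon> > 0"
  shows "E z = 0"
proof -
  have "E constant_on UNIV"
  proof (rule liouville[OF E growth \<beta>])
    fix l assume l: "l \<in> L"
    show "norm (E l) \<le> \<bar>C'\<bar> + (\<Sum>x\<in>X. norm (E x))"
    proof (cases "l \<in> X")
      case True
      hence "norm (E l) \<le> (\<Sum>x\<in>X. norm (E x))"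
        using X by (intro member_le_sum) auto
      thus ?thesis by simp
    next
      case False
      have "norm (E l) \<le> C' * exp (- \<epsilon> * (norm l)\<^sup>2)" using decay l False by blast
      also have "\<dots> \<le> \<bar>C'\<bar> * 1" using \<epsilon> by (intro mult_mono) auto
      also have "\<dots> \<le> \<bar>C'\<bar> + (\<Sum>x\<in>X. norm (E x))" by (simp add: sum_nonneg)
      finally show ?thesis .
    qed
  qed
  then obtain k where k: "\<And>z. E z = k" by (auto simp: constant_on_def)
  define l where "l n = Complex (2 * p * of_int (int n)) (2 * q * of_int 0)" for n
  have l: "l n \<in> L" for n unfolding l_def by (rule L_sup)
  have nl: "norm (l n) = 2 * p * real n" for n
    using p_pos by (simp add: l_def cmod_def)
  have inj: "inj l" using p_pos by (auto simp: inj_on_def l_def)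
  have "\<forall>\<^sub>F n in sequentially. l n \<notin> X"
  proof -
    have "finite (l -` X)" using X inj by (rule finite_vimageI)
    hence "\<forall>\<^sub>F n in cofinite. n \<notin> l -` X" by (simp add: eventually_cofinite vimage_def)
    thus ?thesis by (simp add: cofinite_eq_sequentially)
  qed
  hence "\<forall>\<^sub>F n in sequentially. norm k \<le> C' * exp (- \<epsilon> * (2 * p * real n)\<^sup>2)"
  proof eventually_elim
    case (elim n)
    thus ?case using decay[of "l n"] l[of n] k nl[of n] by simp
  qed
  moreover have "(\<lambda>n. C' * exp (- \<epsilon> * (2 * p * real n)\<^sup>2)) \<longlonglongrightarrow> C' * 0"
    using \<epsilon> p_pos by (intro tendsto_mult tendsto_const exp_neg_square_tendsto_0) auto
  ultimately have "norm k \<le> C' * 0"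
    by (intro tendsto_lowerbound[of "\<lambda>n. C' * exp (- \<epsilon> * (2 * p * real n)\<^sup>2)"]) auto
  thus ?thesis using k by simp
qed

text \<open>A zero at distance \<open>exp (- \<gamma> |l|\<^sup>2)\<close> makes \<open>G l\<close> smaller than \<open>exp (- \<gamma> |l|\<^sup>2)\<close> times the derivative, and
  \<open>\<gamma>\<close> exceeds the growth exponent of the derivative.\<close>
lemma vanishes_if_zeros_near:
  assumes \<alpha>: "\<alpha> > 2 * pi" and \<gamma>: "\<gamma> > 2 * pi"
    and G: "G holomorphic_on UNIV" and growth: "\<And>z. norm (G z) \<le> C * exp (pi / 2 * (norm z)\<^sup>2)"
    and w: "\<And>l. l \<in> L \<Longrightarrow> norm (w l - l) \<le> exp (- \<gamma> * (norm l)\<^sup>2)" "\<And>l. l \<in> L \<Longrightarrow> G (w l) = 0"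
  shows "G z = 0"
proof -
  obtain C1 where C1: "C1 > 0" "\<And>z. norm (G z) \<le> C1 * exp (pi * (norm z)\<^sup>2)"
    "\<And>z. norm (deriv G z) \<le> C1 * exp (pi * (norm z)\<^sup>2)"
    "\<And>z d. norm d \<le> 1 \<Longrightarrow> norm (G (z + d) - G z - deriv G z * d) \<le> C1 * exp (pi * (norm z)\<^sup>2) * (norm d)\<^sup>2"
    by (rule entire_growth_estimates[OF G growth, of pi]) auto
  show ?thesis
  proof (rule vanishes_if_decays[OF G growth _ _ finite.emptyI])
    show "pi / 2 < \<alpha>" using \<alpha> pi_gt_zero by linarith
    show "pi > 0" by simp
    fix l assume "l \<in> L - {}"
    hence l: "l \<in> L" by simp
    define d where "d = w l - l"
    define r where "r = exp (- \<gamma> * (norm l)\<^sup>2)"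
    have d: "norm d \<le> r" unfolding d_def r_def using w l by auto
    have "\<gamma> \<ge> 0" using \<gamma> pi_gt_zero by linarith
    hence r: "r \<le> 1" by (simp add: r_def)
    have "G (l + d) = 0" using w l by (simp add: d_def)
    define m where "m = C1 * exp (pi * (norm l)\<^sup>2)"
    have "G l = - (G (l + d) - G l - deriv G l * d) - deriv G l * d"
      using \<open>G (l + d) = 0\<close> by simp
    also have "norm \<dots> \<le> m * (norm d)\<^sup>2 + m * norm d"
    proof (rule order_trans[OF norm_triangle_ineq4 add_mono])
      have "norm d \<le> 1" using d r by linarith
      thus "norm (- (G (l + d) - G l - deriv G l * d)) \<le> m * (norm d)\<^sup>2"
        unfolding m_def norm_minus_cancel by (rule C1(4))
      show "norm (deriv G l * d) \<le> m * norm d"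
        unfolding m_def norm_mult by (intro mult_right_mono C1(3)) auto
    qed
    also have "\<dots> \<le> m * r + m * r"
    proof -
      have "(norm d)\<^sup>2 \<le> norm d" using d r by (simp add: power2_eq_square mult_left_le)
      thus ?thesis using d C1(1) by (intro add_mono mult_left_mono) (auto simp: m_def)
    qed
    also have "\<dots> = 2 * C1 * exp (- (\<gamma> - pi) * (norm l)\<^sup>2)"
      by (simp add: m_def r_def algebra_simps flip: exp_add)
    also have "\<dots> \<le> 2 * C1 * exp (- pi * (norm l)\<^sup>2)"
      using C1(1) \<gamma> by (intro mult_left_mono iffD2[OF exp_le_cancel_iff] mult_right_mono) auto
    finally show "norm (G l) \<le> 2 * C1 * exp (- pi * (norm l)\<^sup>2)" .
  qed auto
qed

text \<open>Complex conjugation supplies the third point: \<open>|F| = |H|\<close> at \<open>cnj (w (cnj l) 1)\<close>, which is close to \<open>l\<close>. At a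
  real lattice point this is just the conjugate of the first one; there the symmetry of \<open>F\<close> and \<open>H\<close> makes
  their values and derivatives real, and the separation of abscissae is enough.\<close>
theorem equal_modulus_near_lattice:
  fixes w :: "complex \<Rightarrow> nat \<Rightarrow> complex"
  assumes \<alpha>: "\<alpha> > 2 * pi" and \<gamma>: "\<gamma> > 2 * pi"
    and L_cnj: "\<And>l. l \<in> L \<Longrightarrow> cnj l \<in> L"
    and F: "F holomorphic_on UNIV" "\<And>z. norm (F z) \<le> CF * exp (pi / 2 * (norm z)\<^sup>2)" "\<And>z. F (cnj z) = cnj (F z)"
    and H: "H holomorphic_on UNIV" "\<And>z. norm (H z) \<le> CH * exp (pi / 2 * (norm z)\<^sup>2)" "\<And>z. H (cnj z) = cnj (H z)"
    and w: "\<And>l i. l \<in> L \<Longrightarrow> i \<in> {1, 2} \<Longrightarrow> norm (w l i - l) \<le> exp (- \<gamma> * (norm l)\<^sup>2)"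
    and X: "finite X"
    and sep1: "\<And>l. l \<in> L - X \<Longrightarrow> \<bar>Re (w l 2 - w l 1)\<bar> \<ge> exp (- \<gamma> * (norm l)\<^sup>2) * exp (- pi / 16 * (norm l)\<^sup>2)"
    and sep2: "\<And>l. l \<in> L - X \<Longrightarrow> Im l \<noteq> 0 \<Longrightarrow>
       \<bar>Im (cnj (w l 2 - w l 1) * (cnj (w (cnj l) 1) - w l 1))\<bar> \<ge>
       (exp (- \<gamma> * (norm l)\<^sup>2))\<^sup>2 * (exp (- pi / 16 * (norm l)\<^sup>2))\<^sup>2"
    and eq: "\<And>l i. l \<in> L \<Longrightarrow> i \<in> {1, 2} \<Longrightarrow> norm (F (w l i)) = norm (H (w l i))"
  shows "\<exists>c. norm c = 1 \<and> (\<forall>z. F z = c * H z)"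
proof -
  \<comment> \<open>The exponent \<open>b\<close> exceeds \<open>\<pi> / 2\<close>, and \<open>3 b = 7 \<pi> / 4\<close> stays below \<open>2 \<pi>\<close> by enough to absorb the loss \<open>\<pi> / 8\<close> caused by \<open>\<kappa>\<^sup>2\<close>.\<close>
  define b where "b = 7 * pi / 12"
  have b: "pi / 2 < b" "0 < b" by (simp_all add: b_def)
  obtain C1 where C1: "C1 > 0" "\<And>z. norm (F z) \<le> C1 * exp (b * (norm z)\<^sup>2)"
    "\<And>z. norm (deriv F z) \<le> C1 * exp (b * (norm z)\<^sup>2)"
    "\<And>z d. norm d \<le> 1 \<Longrightarrow> norm (F (z + d) - F z - deriv F z * d) \<le> C1 * exp (b * (norm z)\<^sup>2) * (norm d)\<^sup>2"
    by (rule entire_growth_estimates[OF F(1,2) _ b(1)]) auto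
  obtain C2 where C2: "C2 > 0" "\<And>z. norm (H z) \<le> C2 * exp (b * (norm z)\<^sup>2)"
    "\<And>z. norm (deriv H z) \<le> C2 * exp (b * (norm z)\<^sup>2)"
    "\<And>z d. norm d \<le> 1 \<Longrightarrow> norm (H (z + d) - H z - deriv H z * d) \<le> C2 * exp (b * (norm z)\<^sup>2) * (norm d)\<^sup>2"
    by (rule entire_growth_estimates[OF H(1,2) _ b(1)]) auto
  define C where "C = max C1 C2"
  define m where "m z = C * exp (b * (norm z)\<^sup>2)" for z :: complex
  have C: "C > 0" using C1(1) by (simp add: C_def)
  have m1: "C1 * exp (b * (norm z)\<^sup>2) \<le> m z" and m2: "C2 * exp (b * (norm z)\<^sup>2) \<le> m z" for z
    by (auto simp: m_def C_def)
  note Fm = order_trans[OF C1(2) m1] order_trans[OF C1(3) m1]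
  note Hm = order_trans[OF C2(2) m2] order_trans[OF C2(3) m2]
  have F_taylor: "norm (F (z + d) - F z - deriv F z * d) \<le> m z * r\<^sup>2" if "norm d \<le> r" "r \<le> 1" for z d r
  proof -
    have "norm d \<le> 1" "m z \<ge> 0" using that C by (auto simp: m_def)
    thus ?thesis using that m1[of z]
      by (intro order_trans[OF C1(4)] mult_mono power_mono) auto
  qed
  have H_taylor: "norm (H (z + d) - H z - deriv H z * d) \<le> m z * r\<^sup>2" if "norm d \<le> r" "r \<le> 1" for z d r
  proof -
    have "norm d \<le> 1" "m z \<ge> 0" using that C by (auto simp: m_def)
    thus ?thesis using that m2[of z]
      by (intro order_trans[OF C2(4)] mult_mono power_mono) auto
  qed
  define W where "W z = deriv F z * H z - F z * deriv H z" for z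
  define E where "E z = F z * W z" for z
  have holo: "deriv F holomorphic_on UNIV" "deriv H holomorphic_on UNIV"
    by (intro holomorphic_deriv F H open_UNIV)+
  have W_holo: "W holomorphic_on UNIV"
    unfolding W_def by (intro holomorphic_intros holo F H)
  have E_holo: "E holomorphic_on UNIV"
    unfolding E_def by (intro holomorphic_intros W_holo F)
  have E_growth: "norm (E z) \<le> 2 * C ^ 3 * exp (7 * pi / 4 * (norm z)\<^sup>2)" for z
  proof -
    have "m z \<ge> 0" using C by (simp add: m_def)
    have "norm (W z) \<le> norm (deriv F z) * norm (H z) + norm (F z) * norm (deriv H z)"
      unfolding W_def norm_mult[symmetric] by (rule norm_triangle_ineq4)
    also have "\<dots> \<le> m z * m z + m z * m z"
      using Fm Hm \<open>m z \<ge> 0\<close> by (intro add_mono mult_mono) auto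
    finally have "norm (F z) * norm (W z) \<le> m z * (2 * (m z)\<^sup>2)"
      using Fm \<open>m z \<ge> 0\<close> by (intro mult_mono) (auto simp: power2_eq_square)
    also have "\<dots> = 2 * m z ^ 3" by (simp add: power2_eq_square power3_eq_cube)
    also have "\<dots> = 2 * C ^ 3 * exp (7 * pi / 4 * (norm z)\<^sup>2)"
      by (simp add: m_def b_def power_mult_distrib flip: exp_of_nat_mult)
    finally show ?thesis by (simp add: E_def norm_mult)
  qed
  have E_decay: "norm (E l) \<le> 64 * C ^ 3 * exp (- (pi / 8) * (norm l)\<^sup>2)" if l: "l \<in> L - X" for l
  proof -
    define r where "r = exp (- \<gamma> * (norm l)\<^sup>2)"
    define \<kappa> where "\<kappa> = exp (- pi / 16 * (norm l)\<^sup>2)"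
    have "\<gamma> \<ge> 0" using \<gamma> pi_gt_zero by linarith
    hence r: "0 < r" "r \<le> 1" by (simp_all add: r_def)
    have \<kappa>: "0 < \<kappa>" "\<kappa> \<le> 1" using pi_gt_zero by (simp_all add: \<kappa>_def)
    have lL: "l \<in> L" "cnj l \<in> L" using l L_cnj by auto
    define d1 d2 d3 where "d1 = w l 1 - l" and "d2 = w l 2 - l" and "d3 = cnj (w (cnj l) 1) - l"
    have diffs: "d2 - d1 = w l 2 - w l 1" "d3 - d1 = cnj (w (cnj l) 1) - w l 1"
      by (simp_all add: d1_def d2_def d3_def)
    have eqs: "norm (F (l + d)) = norm (H (l + d)) \<and> norm d \<le> r" if "d \<in> {d1, d2, d3}" for d
    proof -
      have "norm d3 = norm (cnj (w (cnj l) 1 - cnj l))" by (simp add: d3_def)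
      also have "\<dots> \<le> r" using w[OF lL(2), of 1] by (simp add: r_def del: complex_cnj_diff)
      finally have d3: "norm d3 \<le> r" .
      have "norm (F (l + d3)) = norm (H (l + d3))"
        using eq[OF lL(2), of 1] by (simp add: d3_def F(3) H(3))
      with d3 that w[OF lL(1)] eq[OF lL(1)] show ?thesis
        by (auto simp: d1_def d2_def r_def)
    qed
    have "norm (F l * (deriv F l * H l - F l * deriv H l)) \<le> 64 * (m l) ^ 3 * r / \<kappa>\<^sup>2"
    proof (rule wronskian_bound[OF Fm Hm r \<kappa>])
      fix d assume d: "d \<in> {d1, d2, d3}"
      show "norm d \<le> r \<and> (\<exists>\<rho> \<sigma>. norm \<rho> \<le> m l * r\<^sup>2 \<and> norm \<sigma> \<le> m l * r\<^sup>2 \<and>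
          norm (F l + deriv F l * d + \<rho>) = norm (H l + deriv H l * d + \<sigma>))"
        using eqs[OF d] F_taylor[of d r l] H_taylor[of d r l] r
        by (intro conjI exI[of _ "F (l + d) - F l - deriv F l * d"] exI[of _ "H (l + d) - H l - deriv H l * d"]) auto
    next
      show "\<bar>Im (cnj (d2 - d1) * (d3 - d1))\<bar> \<ge> r\<^sup>2 * \<kappa>\<^sup>2 \<or>
         deriv F l * cnj (F l) - deriv H l * cnj (H l) \<in> \<real> \<and> \<bar>Re (d2 - d1)\<bar> \<ge> r * \<kappa>"
      proof (cases "Im l = 0")
        case False
        thus ?thesis using sep2[OF l] unfolding diffs r_def \<kappa>_def by blast
      next
        case True
        have real: "G l \<in> \<real> \<and> deriv G l \<in> \<real>"
          if G: "G holomorphic_on UNIV" "\<And>z. G (cnj z) = cnj (G z)" for G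
        proof -
          have cnj_l: "cnj l = l" using True by (simp add: complex_eq_iff)
          have "G l = cnj (G l)" using G(2)[of l] by (simp add: cnj_l)
          moreover have "deriv G l = cnj (deriv G l)"
          proof -
            have "(G has_field_derivative deriv G l) (at l)"
              by (rule holomorphic_derivI[OF G(1)]) auto
            hence "(cnj \<circ> G \<circ> cnj has_field_derivative cnj (deriv G l)) (at (cnj l))"
              by (simp add: has_field_derivative_cnj_cnj)
            moreover have "cnj \<circ> G \<circ> cnj = G" using G(2) by (simp add: fun_eq_iff)
            ultimately show ?thesis by (metis DERIV_imp_deriv cnj_l)
          qed
          ultimately show ?thesis by (metis Reals_cnj_iff)
        qed
        have "deriv F l * cnj (F l) - deriv H l * cnj (H l) \<in> \<real>"
          using real[OF F(1,3)] real[OF H(1,3)] by (auto simp: Reals_cnj_iff intro!: Reals_diff Reals_mult)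
        thus ?thesis using sep1[OF l] unfolding diffs r_def \<kappa>_def by blast
      qed
    qed
    also have "\<dots> = 64 * C ^ 3 * exp ((7 * pi / 4 - \<gamma> + pi / 8) * (norm l)\<^sup>2)"
      unfolding m_def r_def \<kappa>_def power_mult_distrib divide_inverse b_def
      by (simp add: exp_minus[symmetric] algebra_simps flip: exp_of_nat_mult exp_add)
    also have "\<dots> \<le> 64 * C ^ 3 * exp (- (pi / 8) * (norm l)\<^sup>2)"
      using C \<gamma> by (intro mult_left_mono iffD2[OF exp_le_cancel_iff] mult_right_mono) auto
    finally show ?thesis by (simp add: E_def W_def)
  qed
  have E0: "E z = 0" for z
  proof (rule vanishes_if_decays[OF E_holo E_growth _ _ X E_decay])
    show "7 * pi / 4 < \<alpha>" using \<alpha> pi_gt_zero by linarith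
  qed auto
  have vanish: "F z = 0" if "\<And>l. l \<in> L \<Longrightarrow> F (w l 1) = 0" for z
  proof (rule vanishes_if_zeros_near[OF \<alpha> \<gamma> F(1,2)])
    show "norm (w l 1 - l) \<le> exp (- \<gamma> * (norm l)\<^sup>2)" if "l \<in> L" for l
      by (rule w[OF that]) simp
  qed (rule that)
  have vanishH: "H z = 0" if "\<And>l. l \<in> L \<Longrightarrow> H (w l 1) = 0" for z
  proof (rule vanishes_if_zeros_near[OF \<alpha> \<gamma> H(1,2)])
    show "norm (w l 1 - l) \<le> exp (- \<gamma> * (norm l)\<^sup>2)" if "l \<in> L" for l
      by (rule w[OF that]) simp
  qed (rule that)
  show ?thesis
  proof (cases "\<forall>z. F z = 0")
    case True
    hence "H (w l 1) = 0" if "l \<in> L" for l using eq[OF that, of 1] by simp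
    hence "\<forall>z. H z = 0" using vanishH by blast
    thus ?thesis using True by (intro exI[of _ 1]) auto
  next
    case False
    then obtain z0 where z0: "F z0 \<noteq> 0" by blast
    have "open (F -` (- {0}))"
      using continuous_open_preimage[OF holomorphic_on_imp_continuous_on[OF F(1)] open_UNIV, of "- {0}"]
      by (simp add: open_Compl)
    then obtain e where e: "e > 0" "ball z0 e \<subseteq> F -` (- {0})"
      using z0 open_contains_ball[of "F -` (- {0})"] by blast
    \<comment> \<open>Where \<open>F\<close> does not vanish, \<open>E = 0\<close> says that \<open>H / F\<close> is locally constant.\<close>
    have "((\<lambda>z. H z / F z) has_field_derivative 0) (at z within ball z0 e)" if z: "z \<in> ball z0 e" for z
    proof -
      have Fz: "F z \<noteq> 0" using e z by auto
      have "W z = 0" using E0[of z] Fz by (simp add: E_def)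
      have "(H has_field_derivative deriv H z) (at z)" "(F has_field_derivative deriv F z) (at z)"
        by (rule holomorphic_derivI[OF H(1)] holomorphic_derivI[OF F(1)]; simp)+
      from DERIV_divide[OF this Fz]
      have "((\<lambda>z. H z / F z) has_field_derivative (deriv H z * F z - H z * deriv F z) / (F z * F z)) (at z)" .
      also have "deriv H z * F z - H z * deriv F z = 0"
        using \<open>W z = 0\<close> by (simp add: W_def mult.commute)
      finally show ?thesis by (simp add: has_field_derivative_at_within)
    qed
    then obtain k where k: "\<And>z. z \<in> ball z0 e \<Longrightarrow> H z / F z = k"
      using has_field_derivative_zero_constant[of "ball z0 e" "\<lambda>z. H z / F z"] by auto
    have Hk: "H z = k * F z" for z
    proof -
      have "H z - k * F z = 0"
      proof (rule analytic_continuation_open[where s = "ball z0 e" and s' = UNIV and g = "\<lambda>_. 0" and f = "\<lambda>z. H z - k * F z"])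
        show "H w - k * F w = 0" if "w \<in> ball z0 e" for w
        proof -
          have "F w \<noteq> 0" using e that by blast
          thus ?thesis using k[OF that] by (auto simp: divide_eq_eq)
        qed
      qed (use e in \<open>auto intro!: holomorphic_intros H F\<close>)
      thus ?thesis by simp
    qed
    obtain l where l: "l \<in> L" "F (w l 1) \<noteq> 0" using False vanish by blast
    have "norm (F (w l 1)) = norm k * norm (F (w l 1))"
      using eq[OF l(1), of 1] unfolding Hk norm_mult by simp
    hence k1: "norm k = 1" using l by simp
    have "F z = inverse k * H z" for z
      using k1 by (auto simp: Hk field_simps)
    thus ?thesis using k1 by (intro exI[of _ "inverse k"]) (auto simp: norm_inverse)
  qed
qed

end

section \<open>The Bargmann transform\<close>

lemma integrable_exp_neg_square:
  "integrable lborel (\<lambda>t. exp (- 2 * pi * (t - a)\<^sup>2))"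
  and integral_exp_neg_square_shift:
  "(LBINT t. exp (- 2 * pi * (t - a)\<^sup>2)) = (LBINT t. exp (- 2 * pi * t\<^sup>2))"
proof -
  have n: "normal_density a (1 / (2 * sqrt pi)) = (\<lambda>t. sqrt 2 * exp (- 2 * pi * (t - a)\<^sup>2))" for a
    by (simp add: fun_eq_iff normal_density_def power_divide real_sqrt_mult real_sqrt_divide field_simps)
  have i: "integrable lborel (\<lambda>t. sqrt 2 * exp (- 2 * pi * (t - a)\<^sup>2))" for a
    using integrable_normal_density[of "1 / (2 * sqrt pi)" a] unfolding n by simp
  thus "integrable lborel (\<lambda>t. exp (- 2 * pi * (t - a)\<^sup>2))" by simp
  have "(LBINT t. sqrt 2 * exp (- 2 * pi * (t - a)\<^sup>2)) = 1" for a
    using integral_normal_density[of "1 / (2 * sqrt pi)" a] unfolding n by simp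
  hence "(LBINT t. exp (- 2 * pi * (t - a)\<^sup>2)) = 1 / sqrt 2" for a
    by (simp add: field_simps)
  from this[of a] this[of 0] show "(LBINT t. exp (- 2 * pi * (t - a)\<^sup>2)) = (LBINT t. exp (- 2 * pi * t\<^sup>2))"
    by simp
qed

text \<open>The factor \<open>exp (- \<pi> z\<^sup>2 / 2)\<close> makes the growth isotropic; its modulus turns the bound
  \<open>exp (\<pi> (Re z)\<^sup>2)\<close> for the integral into \<open>exp (\<pi> |z|\<^sup>2 / 2)\<close>.\<close>
definition bargmann :: "(real \<Rightarrow> complex) \<Rightarrow> complex \<Rightarrow> complex" where
  "bargmann g z = (LINT t|lebesgue. g t * exp (of_real (- pi * t\<^sup>2) + 2 * of_real pi * of_real t * z)) *
     exp (- (of_real pi * z\<^sup>2 / 2))"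

lemma L2_measurable: "g \<in> L2 \<Longrightarrow> g \<in> borel_measurable lebesgue"
  and L2_integrable: "g \<in> L2 \<Longrightarrow> integrable lebesgue (\<lambda>t. (norm (g t))\<^sup>2)"
  by (auto simp: L2_def)

text \<open>By \<open>a b \<le> a\<^sup>2 + b\<^sup>2\<close>; the bound is independent of the centre \<open>a\<close> of the window because Lebesgue measure is
  translation invariant.\<close>
lemma integrable_L2_gauss:
  assumes "g \<in> L2"
  shows "integrable lebesgue (\<lambda>t. norm (g t) * exp (- pi * (t - a)\<^sup>2))"
    and "(LINT t|lebesgue. norm (g t) * exp (- pi * (t - a)\<^sup>2)) \<le>
      (LINT t|lebesgue. (norm (g t))\<^sup>2) + (LINT t|lebesgue. exp (- 2 * pi * t\<^sup>2))"
proof -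
  note [measurable] = L2_measurable[OF assms]
  have e: "integrable lebesgue (\<lambda>t. exp (- 2 * pi * (t - a)\<^sup>2))"
    using integrable_exp_neg_square[of a] by (simp add: integrable_completion)
  have meas: "(\<lambda>t. exp (- pi * (t - a)\<^sup>2)) \<in> borel_measurable lebesgue"
    by (intro measurable_completion) simp
  have le: "norm (g t) * exp (- pi * (t - a)\<^sup>2) \<le> (norm (g t))\<^sup>2 + exp (- 2 * pi * (t - a)\<^sup>2)" for t
  proof -
    have "exp (- 2 * pi * (t - a)\<^sup>2) = (exp (- pi * (t - a)\<^sup>2))\<^sup>2"
      by (simp flip: exp_double)
    moreover have "0 \<le> (norm (g t) - exp (- pi * (t - a)\<^sup>2))\<^sup>2" by simp
    moreover have "0 \<le> norm (g t) * exp (- pi * (t - a)\<^sup>2)" by simp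
    ultimately show ?thesis unfolding power2_diff by linarith
  qed
  have i: "integrable lebesgue (\<lambda>t. (norm (g t))\<^sup>2 + exp (- 2 * pi * (t - a)\<^sup>2))"
    by (intro Bochner_Integration.integrable_add e L2_integrable assms)
  show int: "integrable lebesgue (\<lambda>t. norm (g t) * exp (- pi * (t - a)\<^sup>2))"
    using le meas by (intro Bochner_Integration.integrable_bound[OF i]) (auto intro!: AE_I2 borel_measurable_times)
  have "(LINT t|lebesgue. norm (g t) * exp (- pi * (t - a)\<^sup>2)) \<le> (LINT t|lebesgue. (norm (g t))\<^sup>2 + exp (- 2 * pi * (t - a)\<^sup>2))"
    by (intro integral_mono int i le)
  also have "\<dots> = (LINT t|lebesgue. (norm (g t))\<^sup>2) + (LINT t|lebesgue. exp (- 2 * pi * (t - a)\<^sup>2))"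
    by (intro Bochner_Integration.integral_add e L2_integrable assms)
  also have "(LINT t|lebesgue. exp (- 2 * pi * (t - a)\<^sup>2)) = (LINT t|lebesgue. exp (- 2 * pi * t\<^sup>2))"
    using integral_exp_neg_square_shift[of a] by (simp add: integral_completion)
  finally show "(LINT t|lebesgue. norm (g t) * exp (- pi * (t - a)\<^sup>2)) \<le>
      (LINT t|lebesgue. (norm (g t))\<^sup>2) + (LINT t|lebesgue. exp (- 2 * pi * t\<^sup>2))" .
qed

lemma norm_bargmann_kernel:
  "norm (exp (of_real (- pi * t\<^sup>2) + 2 * of_real pi * of_real t * z)) = exp (- pi * (t - Re z)\<^sup>2) * exp (pi * (Re z)\<^sup>2)"
  by (simp add: power2_eq_square algebra_simps flip: exp_add)

lemma bargmann_kernel_measurable: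
  "(\<lambda>t. exp (of_real (- pi * t\<^sup>2) + 2 * of_real pi * of_real t * z) :: complex) \<in> borel_measurable lebesgue"
  by (intro measurable_completion) (auto intro!: borel_measurable_continuous_onI continuous_intros)

lemma integrable_bargmann:
  assumes "g \<in> L2"
  shows "integrable lebesgue (\<lambda>t. g t * exp (of_real (- pi * t\<^sup>2) + 2 * of_real pi * of_real t * z))"
proof (rule Bochner_Integration.integrable_bound)
  show "integrable lebesgue (\<lambda>t. norm (g t) * exp (- pi * (t - Re z)\<^sup>2) * exp (pi * (Re z)\<^sup>2))"
    by (intro integrable_mult_left integrable_L2_gauss assms)
  show "(\<lambda>t. g t * exp (of_real (- pi * t\<^sup>2) + 2 * of_real pi * of_real t * z)) \<in> borel_measurable lebesgue"
    by (intro borel_measurable_times L2_measurable assms bargmann_kernel_measurable)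
  show "AE t in lebesgue. norm (g t * exp (of_real (- pi * t\<^sup>2) + 2 * of_real pi * of_real t * z))
      \<le> norm (norm (g t) * exp (- pi * (t - Re z)\<^sup>2) * exp (pi * (Re z)\<^sup>2))"
    unfolding norm_mult norm_bargmann_kernel by (intro AE_I2) simp
qed

lemma bargmann_growth:
  assumes "g \<in> L2"
  obtains C where "\<And>z. norm (bargmann g z) \<le> C * exp (pi / 2 * (norm z)\<^sup>2)"
proof
  fix z
  let ?C = "(LINT t|lebesgue. (norm (g t))\<^sup>2) + (LINT t|lebesgue. exp (- 2 * pi * t\<^sup>2))"
  have "norm (LINT t|lebesgue. g t * exp (of_real (- pi * t\<^sup>2) + 2 * of_real pi * of_real t * z)) \<le>
      (LINT t|lebesgue. norm (g t * exp (of_real (- pi * t\<^sup>2) + 2 * of_real pi * of_real t * z)))"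
    by (rule integral_norm_bound)
  also have "\<dots> = (LINT t|lebesgue. norm (g t) * exp (- pi * (t - Re z)\<^sup>2)) * exp (pi * (Re z)\<^sup>2)"
    unfolding norm_mult norm_bargmann_kernel by (simp add: mult.assoc[symmetric])
  also have "\<dots> \<le> ?C * exp (pi * (Re z)\<^sup>2)"
    by (intro mult_right_mono integrable_L2_gauss assms) auto
  finally have "norm (bargmann g z) \<le> ?C * exp (pi * (Re z)\<^sup>2) * norm (exp (- (of_real pi * z\<^sup>2 / 2)))"
    unfolding bargmann_def norm_mult by (intro mult_right_mono) auto
  also have "\<dots> = ?C * exp (pi * (Re z)\<^sup>2 + Re (- (of_real pi * z\<^sup>2 / 2)))"
    by (simp only: exp_add norm_exp_eq_Re mult.assoc)
  also have "pi * (Re z)\<^sup>2 + Re (- (of_real pi * z\<^sup>2 / 2)) = pi / 2 * (norm z)\<^sup>2"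
    unfolding cmod_power2 by (simp add: power2_eq_square field_simps)
  finally show "norm (bargmann g z) \<le> ?C * exp (pi / 2 * (norm z)\<^sup>2)" .
qed

text \<open>Expanding \<open>exp (2 \<pi> t z)\<close> and integrating term by term gives an everywhere convergent power series.\<close>
lemma bargmann_holomorphic:
  assumes g: "g \<in> L2"
  shows "bargmann g holomorphic_on UNIV"
proof -
  define k where "k t = g t * exp (of_real (- pi * t\<^sup>2))" for t
  define a where "a n = (LINT t|lebesgue. k t * (of_real (2 * pi * t) ^ n /\<^sub>R fact n))" for n
  have kern: "g t * exp (of_real (- pi * t\<^sup>2) + 2 * of_real pi * of_real t * z) = k t * exp (of_real (2 * pi * t) * z)" for t z
    by (simp only: k_def exp_add of_real_mult of_real_numeral mult.assoc)
  note int = integrable_bargmann[OF g, unfolded kern]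
  have k_meas [measurable]: "k \<in> borel_measurable lebesgue"
    using borel_measurable_integrable[OF int[of 0]] by simp
  have "(\<lambda>n. a n * z ^ n) sums (LINT t|lebesgue. k t * exp (of_real (2 * pi * t) * z))" for z
  proof -
    define f where "f n t = k t * ((of_real (2 * pi * t) * z) ^ n /\<^sub>R fact n)" for n t
    \<comment> \<open>A dominating function for all partial sums.\<close>
    define G where "G t = norm (k t) * exp (2 * pi * \<bar>t\<bar> * norm z)" for t
    have t_meas: "(\<lambda>t::real. t) \<in> borel_measurable lebesgue" by (intro measurable_completion) simp
    have f_meas: "f n \<in> borel_measurable lebesgue" for n
      unfolding f_def using t_meas by (intro borel_measurable_times k_meas borel_measurable_scaleR borel_measurable_const borel_measurable_power borel_measurable_of_real) auto
    have norm_f: "norm (f n t) = norm (k t) * ((2 * pi * \<bar>t\<bar> * norm z) ^ n /\<^sub>R fact n)" for n t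
      by (simp add: f_def norm_mult norm_power abs_mult)
    have G_int: "integrable lebesgue G"
    proof (rule Bochner_Integration.integrable_bound)
      show "integrable lebesgue (\<lambda>t. norm (k t * exp (of_real (2 * pi * t) * of_real (norm z))) + norm (k t * exp (of_real (2 * pi * t) * of_real (- norm z))))"
        by (intro Bochner_Integration.integrable_add integrable_norm int)
      show "G \<in> borel_measurable lebesgue"
        unfolding G_def using t_meas by (intro borel_measurable_times borel_measurable_norm k_meas borel_measurable_exp borel_measurable_abs) auto
      show "AE t in lebesgue. norm (G t) \<le> norm (norm (k t * exp (of_real (2 * pi * t) * of_real (norm z))) + norm (k t * exp (of_real (2 * pi * t) * of_real (- norm z))))"
      proof (rule AE_I2)
        fix t :: real
        have "exp (2 * pi * \<bar>t\<bar> * norm z) \<le> exp (2 * pi * t * norm z) + exp (2 * pi * t * (- norm z))"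
          by (cases "t \<ge> 0") auto
        hence "norm (k t) * exp (2 * pi * \<bar>t\<bar> * norm z) \<le> norm (k t) * (exp (2 * pi * t * norm z) + exp (2 * pi * t * (- norm z)))"
          by (intro mult_left_mono) auto
        thus "norm (G t) \<le> norm (norm (k t * exp (of_real (2 * pi * t) * of_real (norm z))) + norm (k t * exp (of_real (2 * pi * t) * of_real (- norm z))))"
          by (simp add: G_def norm_mult distrib_left)
      qed
    qed
    have sum_le: "(\<Sum>i<n. norm (f i t)) \<le> G t" for n t
    proof -
      have "(\<Sum>i<n. (2 * pi * \<bar>t\<bar> * norm z) ^ i /\<^sub>R fact i) \<le> exp (2 * pi * \<bar>t\<bar> * norm z)"
        unfolding exp_def by (intro sum_le_suminf summable_exp_generic) auto
      thus ?thesis unfolding norm_f G_def sum_distrib_left[symmetric] by (intro mult_left_mono) auto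
    qed
    have f_int: "integrable lebesgue (f n)" for n
    proof (rule Bochner_Integration.integrable_bound[OF G_int f_meas])
      show "AE t in lebesgue. norm (f n t) \<le> norm (G t)"
      proof (rule AE_I2)
        fix t
        have "norm (f n t) \<le> (\<Sum>i<Suc n. norm (f i t))" by (intro member_le_sum) auto
        also have "\<dots> \<le> G t" by (rule sum_le)
        finally show "norm (f n t) \<le> norm (G t)" by simp
      qed
    qed
    have f_sums: "(\<lambda>n. f n t) sums (k t * exp (of_real (2 * pi * t) * z))" for t
      unfolding f_def by (intro sums_mult exp_converges)
    have "(\<lambda>n. integral\<^sup>L lebesgue (f n)) sums (LINT t|lebesgue. (\<Sum>n. f n t))"
    proof (rule sums_integral[OF f_int])
      show "AE t in lebesgue. summable (\<lambda>n. norm (f n t))"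
        using sum_le by (intro AE_I2 summableI_nonneg_bounded[of _ "G _"]) auto
      show "summable (\<lambda>n. LINT t|lebesgue. norm (f n t))"
      proof (rule summableI_nonneg_bounded)
        fix n
        have "(\<Sum>i<n. LINT t|lebesgue. norm (f i t)) = (LINT t|lebesgue. (\<Sum>i<n. norm (f i t)))"
          by (intro Bochner_Integration.integral_sum[symmetric] integrable_norm f_int)
        also have "\<dots> \<le> integral\<^sup>L lebesgue G"
          by (intro integral_mono G_int sum_le Bochner_Integration.integrable_sum integrable_norm f_int)
        finally show "(\<Sum>i<n. LINT t|lebesgue. norm (f i t)) \<le> integral\<^sup>L lebesgue G" .
      qed auto
    qed
    also have "(\<lambda>t. (\<Sum>n. f n t)) = (\<lambda>t. k t * exp (of_real (2 * pi * t) * z))"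
      using f_sums by (auto simp: sums_iff)
    also have "(\<lambda>n. integral\<^sup>L lebesgue (f n)) = (\<lambda>n. a n * z ^ n)"
    proof
      fix n
      have "f n = (\<lambda>t. (k t * (of_real (2 * pi * t) ^ n /\<^sub>R fact n)) * z ^ n)"
        by (simp add: fun_eq_iff f_def power_mult_distrib scaleR_conv_of_real)
      thus "integral\<^sup>L lebesgue (f n) = a n * z ^ n"
        unfolding a_def by (simp only: integral_mult_left_zero)
    qed
    finally show ?thesis .
  qed
  hence "(\<lambda>z. LINT t|lebesgue. k t * exp (of_real (2 * pi * t) * z)) holomorphic_on ball 0 r" for r
    by (intro power_series_holomorphic[where a = a]) auto
  hence "(\<lambda>z. LINT t|lebesgue. k t * exp (of_real (2 * pi * t) * z)) analytic_on UNIV"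
    unfolding analytic_on_holomorphic
  proof -
    assume h: "\<And>r. (\<lambda>z. LINT t|lebesgue. k t * exp (of_real (2 * pi * t) * z)) holomorphic_on ball 0 r"
    have "(\<lambda>z. LINT t|lebesgue. k t * exp (of_real (2 * pi * t) * z)) field_differentiable (at z)" for z
      using h[of "norm z + 1"] by (auto intro!: holomorphic_on_imp_differentiable_at[of _ "ball 0 (norm z + 1)"])
    thus "\<exists>S. open S \<and> UNIV \<subseteq> S \<and> (\<lambda>z. LINT t|lebesgue. k t * exp (of_real (2 * pi * t) * z)) holomorphic_on S"
      by (intro exI[of _ UNIV]) (auto simp: holomorphic_on_def)
  qed
  hence "(\<lambda>z. LINT t|lebesgue. k t * exp (of_real (2 * pi * t) * z)) holomorphic_on UNIV"
    by (rule analytic_imp_holomorphic)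
  thus ?thesis unfolding bargmann_def kern by (intro holomorphic_intros) auto
qed

lemma bargmann_cnj:
  assumes "g \<in> L2_real"
  shows "bargmann g (cnj z) = cnj (bargmann g z)"
proof -
  have real: "AE t in lebesgue. g t \<in> \<real>" and L2: "g \<in> L2" using assms by (auto simp: L2_real_def)
  have "(LINT t|lebesgue. g t * exp (of_real (- pi * t\<^sup>2) + 2 * of_real pi * of_real t * cnj z)) =
      (LINT t|lebesgue. cnj (g t * exp (of_real (- pi * t\<^sup>2) + 2 * of_real pi * of_real t * z)))"
  proof (rule integral_cong_AE)
    show "(\<lambda>t. cnj (g t * exp (of_real (- pi * t\<^sup>2) + 2 * of_real pi * of_real t * z))) \<in> borel_measurable lebesgue"
      using borel_measurable_integrable[OF integrable_bargmann[OF L2, of z]]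
      by (intro measurable_compose[OF _ borel_measurable_continuous_onI[of cnj]]) (auto intro: continuous_intros)
    show "AE t in lebesgue. g t * exp (of_real (- pi * t\<^sup>2) + 2 * of_real pi * of_real t * cnj z) =
        cnj (g t * exp (of_real (- pi * t\<^sup>2) + 2 * of_real pi * of_real t * z))"
      using real by eventually_elim (simp add: exp_cnj Reals_cnj_iff)
  qed (intro borel_measurable_integrable integrable_bargmann L2)
  also have "\<dots> = cnj (LINT t|lebesgue. g t * exp (of_real (- pi * t\<^sup>2) + 2 * of_real pi * of_real t * z))"
    by (rule Bochner_Integration.integral_cnj)
  finally show ?thesis by (simp add: bargmann_def exp_cnj)
qed

lemma norm_gabor:
  "norm (gabor g u) = exp (- pi / 2 * ((u $ 1)\<^sup>2 + (u $ 2)\<^sup>2)) * norm (bargmann g (Complex (u $ 1) (- u $ 2)))"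
proof -
  define x y where "x = u $ 1" and "y = u $ 2"
  define z where "z = Complex x (- y)"
  have z: "z = of_real x - \<i> * of_real y" by (simp add: z_def complex_eq_iff)
  have "gabor g u = (LINT t|lebesgue. of_real (exp (- pi * x\<^sup>2)) * (g t * exp (of_real (- pi * t\<^sup>2) + 2 * of_real pi * of_real t * z)))"
    unfolding gabor_def x_def[symmetric] y_def[symmetric]
  proof (intro Bochner_Integration.integral_cong refl)
    fix t
    have "of_real (exp (- pi * (t - x)\<^sup>2)) * exp (- 2 * of_real pi * \<i> * of_real y * of_real t) =
        of_real (exp (- pi * x\<^sup>2)) * exp (of_real (- pi * t\<^sup>2) + 2 * of_real pi * of_real t * z)"
      unfolding exp_of_real[symmetric] exp_add[symmetric] z
      by (rule arg_cong[of _ _ exp]) (simp add: power2_eq_square algebra_simps)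
    note * = this
    have "g t * of_real (exp (- pi * (t - x)\<^sup>2)) * exp (- 2 * of_real pi * \<i> * of_real y * of_real t) =
        g t * (of_real (exp (- pi * (t - x)\<^sup>2)) * exp (- 2 * of_real pi * \<i> * of_real y * of_real t))"
      by (rule mult.assoc)
    also note *
    also have "g t * (of_real (exp (- pi * x\<^sup>2)) * exp (of_real (- pi * t\<^sup>2) + 2 * of_real pi * of_real t * z)) =
        of_real (exp (- pi * x\<^sup>2)) * (g t * exp (of_real (- pi * t\<^sup>2) + 2 * of_real pi * of_real t * z))"
      by (rule mult.left_commute)
    finally show "g t * of_real (exp (- pi * (t - x)\<^sup>2)) * exp (- 2 * of_real pi * \<i> * of_real y * of_real t) =
        of_real (exp (- pi * x\<^sup>2)) * (g t * exp (of_real (- pi * t\<^sup>2) + 2 * of_real pi * of_real t * z))" .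
  qed
  also have "\<dots> = of_real (exp (- pi * x\<^sup>2)) * (LINT t|lebesgue. g t * exp (of_real (- pi * t\<^sup>2) + 2 * of_real pi * of_real t * z))"
    by simp
  also have "\<dots> = of_real (exp (- pi * x\<^sup>2)) * (bargmann g z * exp (of_real pi * z\<^sup>2 / 2))"
    by (simp add: bargmann_def exp_minus)
  finally have "norm (gabor g u) = exp (- pi * x\<^sup>2 + Re (of_real pi * z\<^sup>2 / 2)) * norm (bargmann g z)"
    by (simp only: norm_mult exp_add norm_exp_eq_Re norm_of_real abs_exp_cancel mult_ac)
  also have "- pi * x\<^sup>2 + Re (of_real pi * z\<^sup>2 / 2) = - pi / 2 * (x\<^sup>2 + y\<^sup>2)"
    unfolding z_def by (simp add: power2_eq_square field_simps)
  finally show ?thesis by (simp add: x_def y_def z_def)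
qed

section \<open>Injectivity of the Bargmann transform\<close>

text \<open>The positive and the negative part of \<open>k\<close> have the same Fourier transform, in particular the same
  integral. After normalisation they are probability densities with equal characteristic functions, hence
  equal by Levy's uniqueness theorem, and \<open>k\<close> is their difference.\<close>
lemma fourier_zero_borel:
  fixes k :: "real \<Rightarrow> real"
  assumes k: "integrable lborel k"
    and zero: "\<And>\<omega>. (CLINT t|lborel. iexp (\<omega> * t) * of_real (k t)) = 0"
  shows "AE t in lborel. k t = 0"
proof -
  have [measurable]: "k \<in> borel_measurable borel" using borel_measurable_integrable[OF k] by simp
  define P where "P t = max 0 (k t)" for t
  define N where "N t = max 0 (- k t)" for t
  have int: "integrable lborel P" "integrable lborel N"
    unfolding P_def N_def using k by (auto intro!: integrable_max)
  have [measurable]: "P \<in> borel_measurable borel" "N \<in> borel_measurable borel"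
    unfolding P_def N_def by measurable
  have kPN: "k t = P t - N t" and nonneg: "P t \<ge> 0" "N t \<ge> 0" for t by (auto simp: P_def N_def)
  have ie [measurable]: "(\<lambda>t. iexp (\<omega> * t)) \<in> borel_measurable borel" for \<omega>
    by (intro borel_measurable_continuous_onI continuous_intros)
  have intc: "complex_integrable lborel (\<lambda>t. iexp (\<omega> * t) * of_real (f t))" if "integrable lborel f" for \<omega> and f :: "real \<Rightarrow> real"
  proof (rule Bochner_Integration.integrable_bound[OF that])
    have [measurable]: "f \<in> borel_measurable borel" using borel_measurable_integrable[OF that] by simp
    show "(\<lambda>t. iexp (\<omega> * t) * of_real (f t)) \<in> borel_measurable lborel" by measurable
  qed (simp add: norm_mult)
  have fPN: "(CLINT t|lborel. iexp (\<omega> * t) * of_real (P t)) = (CLINT t|lborel. iexp (\<omega> * t) * of_real (N t))" for \<omega>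
  proof -
    have "(CLINT t|lborel. iexp (\<omega> * t) * of_real (P t)) - (CLINT t|lborel. iexp (\<omega> * t) * of_real (N t)) =
        (CLINT t|lborel. iexp (\<omega> * t) * of_real (P t) - iexp (\<omega> * t) * of_real (N t))"
      by (intro Bochner_Integration.integral_diff[symmetric] intc int)
    also have "\<dots> = (CLINT t|lborel. iexp (\<omega> * t) * of_real (k t))"
      by (simp only: kPN of_real_diff right_diff_distrib)
    finally show ?thesis using zero by simp
  qed
  define m where "m = integral\<^sup>L lborel P"
  have mP: "integral\<^sup>L lborel P = m" by (simp add: m_def)
  have mN: "integral\<^sup>L lborel N = m" using fPN[of 0] by (simp add: m_def)
  show ?thesis
  proof (cases "m = 0")
    case True
    have "AE t in lborel. P t = 0" "AE t in lborel. N t = 0"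
      using integral_nonneg_eq_0_iff_AE[OF int(1)] integral_nonneg_eq_0_iff_AE[OF int(2)] nonneg mP mN True by auto
    thus ?thesis by eventually_elim (simp add: kPN)
  next
    case False
    have m: "m > 0"
    proof -
      have "0 \<le> m" unfolding m_def by (intro Bochner_Integration.integral_nonneg nonneg)
      with False show ?thesis by simp
    qed
    define D where "D f = density lborel (\<lambda>t. ennreal (f t / m))" for f :: "real \<Rightarrow> real"
    have D: "real_distribution (D f) \<and> char (D f) = (\<lambda>\<omega>. (CLINT t|lborel. iexp (\<omega> * t) * of_real (f t)) / of_real m)"
      if f: "integrable lborel f" "\<And>t. f t \<ge> 0" "integral\<^sup>L lborel f = m" for f
    proof
      have [measurable]: "f \<in> borel_measurable borel" using borel_measurable_integrable[OF f(1)] by simp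
      have "emeasure (D f) (space (D f)) = (\<integral>\<^sup>+t. ennreal (f t / m) \<partial>lborel)"
        by (simp add: D_def emeasure_density)
      also have "\<dots> = ennreal (LINT t|lborel. f t / m)"
        using f m by (intro nn_integral_eq_integral) auto
      also have "\<dots> = 1" using f m by simp
      finally have "prob_space (D f)" by (intro prob_spaceI)
      thus "real_distribution (D f)"
        by (simp add: real_distribution_def real_distribution_axioms_def D_def)
      show "char (D f) = (\<lambda>\<omega>. (CLINT t|lborel. iexp (\<omega> * t) * of_real (f t)) / of_real m)"
      proof
        fix \<omega>
        have "char (D f) \<omega> = (CLINT t|lborel. (f t / m) *\<^sub>R iexp (\<omega> * t))"
          unfolding char_def D_def by (intro integral_density) (use f m in auto)
        also have "\<dots> = (CLINT t|lborel. iexp (\<omega> * t) * of_real (f t) / of_real m)"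
          by (simp add: scaleR_conv_of_real mult.commute)
        finally show "char (D f) \<omega> = (CLINT t|lborel. iexp (\<omega> * t) * of_real (f t)) / of_real m"
          by simp
      qed
    qed
    note DP = D[OF int(1) nonneg(1) mP] and DN = D[OF int(2) nonneg(2) mN]
    have "D P = D N"
    proof (rule Levy_uniqueness)
      show "char (D P) = char (D N)"
        unfolding DP[THEN conjunct2] DN[THEN conjunct2] fPN ..
    qed (use DP DN in auto)
    hence "AE t in lborel. ennreal (P t / m) = ennreal (N t / m)"
      unfolding D_def by (intro sigma_finite_measure.density_unique[OF sigma_finite_lborel]) auto
    thus ?thesis
    proof eventually_elim
      case (elim t)
      hence "P t / m = N t / m" using nonneg m by (subst (asm) ennreal_inj) auto
      thus ?case using m by (simp add: kPN)
    qed
  qed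
qed

text \<open>Reduction to Borel measurable real-valued functions. The Fourier transform of \<open>cnj k\<close> at \<open>\<omega>\<close> is the
  conjugate of that of \<open>k\<close> at \<open>- \<omega>\<close>, so real and imaginary parts have vanishing transforms as well.\<close>
lemma fourier_zero:
  fixes k :: "real \<Rightarrow> complex"
  assumes k: "integrable lebesgue k"
    and zero: "\<And>\<omega>. (CLINT t|lebesgue. iexp (\<omega> * t) * k t) = 0"
  shows "AE t in lebesgue. k t = 0"
proof -
  have ie: "(\<lambda>t. iexp (\<omega> * t)) \<in> borel_measurable lebesgue" for \<omega>
    by (intro measurable_completion) (auto intro!: borel_measurable_continuous_onI continuous_intros)
  have of_real_meas: "(\<lambda>t. complex_of_real (f t)) \<in> borel_measurable lebesgue"
    if "f \<in> borel_measurable lebesgue" for f :: "real \<Rightarrow> real"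
    by (rule borel_measurable_continuous_on[OF _ that]) (intro continuous_intros)
  have real_case: "AE t in lebesgue. f t = 0"
    if f: "integrable lebesgue f" and z: "\<And>\<omega>. (CLINT t|lebesgue. iexp (\<omega> * t) * of_real (f t)) = 0" for f :: "real \<Rightarrow> real"
  proof -
    obtain f' where f': "f' \<in> borel_measurable lborel" "AE t in lborel. f t = f' t"
      using completion_ex_borel_measurable_real[OF borel_measurable_integrable[OF f]] by blast
    have AE: "AE t in lebesgue. f t = f' t" using f'(2) by (rule AE_completion)
    have f'm: "f' \<in> borel_measurable lebesgue" using f'(1) by (rule measurable_completion)
    have "integrable lebesgue f'"
      by (rule integrable_cong_AE_imp[OF f f'm]) (use AE in \<open>auto elim: eventually_mono\<close>)
    hence "integrable lborel f'" using f' by (simp add: integrable_completion)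
    hence "AE t in lborel. f' t = 0"
    proof (rule fourier_zero_borel)
      fix \<omega>
      have "(CLINT t|lborel. iexp (\<omega> * t) * of_real (f' t)) = (CLINT t|lebesgue. iexp (\<omega> * t) * of_real (f' t))"
        using f'(1) by (intro integral_completion[symmetric]) (auto intro!: borel_measurable_times borel_measurable_of_real borel_measurable_continuous_onI continuous_intros)
      also have "\<dots> = (CLINT t|lebesgue. iexp (\<omega> * t) * of_real (f t))"
      proof (rule integral_cong_AE)
        show "AE t in lebesgue. iexp (\<omega> * t) * of_real (f' t) = iexp (\<omega> * t) * of_real (f t)"
          using AE by eventually_elim simp
      qed (intro borel_measurable_times ie of_real_meas f'm borel_measurable_integrable[OF f])+
      finally show "(CLINT t|lborel. iexp (\<omega> * t) * of_real (f' t)) = 0" using z by simp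
    qed
    hence "AE t in lebesgue. f' t = 0" by (rule AE_completion)
    with AE show ?thesis by eventually_elim simp
  qed
  have int: "complex_integrable lebesgue (\<lambda>t. iexp (\<omega> * t) * k t)" for \<omega>
  proof (rule Bochner_Integration.integrable_bound[OF k])
    show "(\<lambda>t. iexp (\<omega> * t) * k t) \<in> borel_measurable lebesgue"
      by (intro borel_measurable_times ie borel_measurable_integrable[OF k])
    show "AE t in lebesgue. norm (iexp (\<omega> * t) * k t) \<le> norm (k t)"
      by (intro AE_I2) (simp add: norm_mult)
  qed
  have zero': "(CLINT t|lebesgue. iexp (\<omega> * t) * cnj (k t)) = 0" for \<omega>
  proof -
    have "(\<lambda>t. iexp (\<omega> * t) * cnj (k t)) = (\<lambda>t. cnj (iexp (- \<omega> * t) * k t))"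
      by (simp add: exp_cnj fun_eq_iff)
    hence "(CLINT t|lebesgue. iexp (\<omega> * t) * cnj (k t)) = cnj (CLINT t|lebesgue. iexp (- \<omega> * t) * k t)"
      by (simp only: Bochner_Integration.integral_cnj)
    thus ?thesis using zero[of "- \<omega>"] by simp
  qed
  have int': "complex_integrable lebesgue (\<lambda>t. iexp (\<omega> * t) * cnj (k t))" for \<omega>
  proof -
    have "(\<lambda>t. iexp (\<omega> * t) * cnj (k t)) = (\<lambda>t. cnj (iexp (- \<omega> * t) * k t))"
      by (simp add: exp_cnj fun_eq_iff)
    thus ?thesis using int[of "- \<omega>"] by (simp only: complex_integrable_cnj)
  qed
  have "AE t in lebesgue. Re (k t) = 0"
  proof (rule real_case)
    show "integrable lebesgue (\<lambda>t. Re (k t))" using k by simp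
    fix \<omega>
    have "(\<lambda>t. iexp (\<omega> * t) * of_real (Re (k t))) = (\<lambda>t. (iexp (\<omega> * t) * k t + iexp (\<omega> * t) * cnj (k t)) / 2)"
      by (simp add: fun_eq_iff complex_add_cnj flip: distrib_left)
    thus "(CLINT t|lebesgue. iexp (\<omega> * t) * of_real (Re (k t))) = 0"
      using Bochner_Integration.integral_add[OF int[of \<omega>] int'[of \<omega>]] zero[of \<omega>] zero'[of \<omega>] by simp
  qed
  moreover have "AE t in lebesgue. Im (k t) = 0"
  proof (rule real_case)
    show "integrable lebesgue (\<lambda>t. Im (k t))" using k by simp
    fix \<omega>
    have "(\<lambda>t. iexp (\<omega> * t) * of_real (Im (k t))) = (\<lambda>t. (iexp (\<omega> * t) * k t - iexp (\<omega> * t) * cnj (k t)) / (2 * \<i>))"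
    proof
      fix t
      have "of_real (Im (k t)) = (k t - cnj (k t)) / (2 * \<i>)" by (simp add: complex_eq_iff)
      thus "iexp (\<omega> * t) * of_real (Im (k t)) = (iexp (\<omega> * t) * k t - iexp (\<omega> * t) * cnj (k t)) / (2 * \<i>)"
        by (simp add: right_diff_distrib diff_divide_distrib mult.left_commute)
    qed
    thus "(CLINT t|lebesgue. iexp (\<omega> * t) * of_real (Im (k t))) = 0"
      using Bochner_Integration.integral_diff[OF int[of \<omega>] int'[of \<omega>]] zero[of \<omega>] zero'[of \<omega>] by simp
  qed
  ultimately show ?thesis by eventually_elim (simp add: complex_eq_iff)
qed

text \<open>On the imaginary axis the Bargmann transform is the Fourier transform of the integrable function
  \<open>g t exp (- \<pi> t\<^sup>2)\<close>.\<close>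
lemma bargmann_proportional_imp_AE:
  assumes g: "g \<in> L2" and h: "h \<in> L2" and eq: "\<And>z. bargmann g z = c * bargmann h z"
  shows "AE t in lebesgue. g t = c * h t"
proof -
  define E :: "complex \<Rightarrow> real \<Rightarrow> complex" where "E z t = exp (of_real (- pi * t\<^sup>2) + 2 * of_real pi * of_real t * z)" for z t
  have int: "integrable lebesgue (\<lambda>t. g t * E z t)" "integrable lebesgue (\<lambda>t. h t * E z t)" for z
    unfolding E_def by (rule integrable_bargmann g h)+
  have "AE t in lebesgue. g t * E 0 t - c * (h t * E 0 t) = 0"
  proof (rule fourier_zero)
    show "integrable lebesgue (\<lambda>t. g t * E 0 t - c * (h t * E 0 t))"
      by (intro Bochner_Integration.integrable_diff integrable_mult_right int)
    fix \<omega>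
    define z where "z = \<i> * of_real (\<omega> / (2 * pi))"
    have Ez: "E z t = iexp (\<omega> * t) * E 0 t" for t
      unfolding E_def z_def exp_add[symmetric] by (rule arg_cong[of _ _ exp]) simp
    have "iexp (\<omega> * t) * (g t * E 0 t - c * (h t * E 0 t)) = g t * E z t - c * (h t * E z t)" for t
      unfolding Ez by (simp add: algebra_simps)
    hence "(CLINT t|lebesgue. iexp (\<omega> * t) * (g t * E 0 t - c * (h t * E 0 t))) =
        (LINT t|lebesgue. g t * E z t - c * (h t * E z t))" by simp
    also have "\<dots> = (LINT t|lebesgue. g t * E z t) - c * (LINT t|lebesgue. h t * E z t)"
      using int by (simp add: Bochner_Integration.integral_diff)
    also have "\<dots> = 0" using eq[of z] by (simp add: bargmann_def E_def)
    finally show "(CLINT t|lebesgue. iexp (\<omega> * t) * (g t * E 0 t - c * (h t * E 0 t))) = 0" .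
  qed
  thus ?thesis
  proof eventually_elim
    case (elim t)
    hence "(g t - c * h t) * E 0 t = 0" by (simp add: algebra_simps)
    thus ?case by (simp add: E_def)
  qed
qed

section \<open>Random points in strips\<close>

lemma content_cbox_2: "a $ 1 \<le> b $ 1 \<Longrightarrow> a $ 2 \<le> b $ 2 \<Longrightarrow> measure lborel (cbox a b :: (real^2) set) = (b $ 1 - a $ 1) * (b $ 2 - a $ 2)"
  by (subst content_cbox_cart) (auto simp: interval_ne_empty_cart UNIV_2 forall_2)

lemma measure_linear_image_2:
  fixes f :: "real^2 \<Rightarrow> real^2"
  assumes "linear f" "S \<in> lmeasurable"
  shows "measure lebesgue (f ` S) = \<bar>f (axis 1 1) $ 1 * f (axis 2 1) $ 2 - f (axis 2 1) $ 1 * f (axis 1 1) $ 2\<bar> * measure lebesgue S"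
  by (subst measure_linear_image[OF assms]) (simp add: det_2 matrix_def)

text \<open>A shear of determinant \<open>1\<close> straightens the strip: it maps its intersection with the disk into a
  rectangle with sides \<open>2 r\<close> and at most \<open>2 h / m\<close>.\<close>
lemma measure_cball_strip_le:
  fixes z :: "real^2"
  assumes r: "r > 0" and h: "h \<ge> 0" and m: "m > 0" and pq: "m \<le> \<bar>p\<bar> \<or> m \<le> \<bar>q\<bar>"
  shows "measure lborel (cball z r \<inter> {w. \<bar>p * w $ 1 + q * w $ 2 - c\<bar> \<le> h}) \<le> 4 * h * r / m"
proof -
  define T where "T = cball z r \<inter> {w. \<bar>p * w $ 1 + q * w $ 2 - c\<bar> \<le> h}"
  have "closed {w::real^2. \<bar>p * w $ 1 + q * w $ 2 - c\<bar> \<le> h}"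
    by (intro closed_Collect_le continuous_intros)
  hence "compact T" unfolding T_def by (intro compact_Int_closed compact_cball)
  hence T: "T \<in> lmeasurable"
    by (rule lmeasurable_compact)
  have T_borel: "T \<in> sets borel"
    using \<open>compact T\<close> by (rule borel_compact)
  have Tz: "\<bar>w $ i - z $ i\<bar> \<le> r" if "w \<in> T" for w i
  proof -
    have "\<bar>w $ i - z $ i\<bar> \<le> norm (w - z)" using component_le_norm_cart[of "w - z" i] by simp
    also have "\<dots> \<le> r" using that by (simp add: T_def dist_norm norm_minus_commute)
    finally show ?thesis .
  qed
  have *: "measure lborel T \<le> 2 * r * (2 * h / \<bar>s\<bar>)"
    if f: "linear f" "\<bar>f (axis 1 1) $ 1 * f (axis 2 1) $ 2 - f (axis 2 1) $ 1 * f (axis 1 1) $ 2\<bar> = 1"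
      and s: "s \<noteq> 0" and ab: "f ` T \<subseteq> cbox a b" "a $ 1 \<le> b $ 1" "a $ 2 \<le> b $ 2" "(b $ 1 - a $ 1) * (b $ 2 - a $ 2) = 2 * r * (2 * h / \<bar>s\<bar>)"
    for f :: "real^2 \<Rightarrow> real^2" and s :: real and a b
  proof -
    have "measure lborel T = measure lebesgue (f ` T)"
      using measure_linear_image_2[OF f(1) T] f(2) T_borel by simp
    also have "\<dots> \<le> measure lebesgue (cbox a b)"
      by (intro measure_mono_fmeasurable ab) (auto intro: fmeasurableD measurable_linear_image[OF f(1) T])
    also have "\<dots> = 2 * r * (2 * h / \<bar>s\<bar>)" using ab(2-4) by (simp add: content_cbox_2)
    finally show ?thesis .
  qed
  have d: "\<bar>x / s - c / s\<bar> \<le> h / \<bar>s\<bar>" if "\<bar>x - c\<bar> \<le> h" "s \<noteq> 0" for x s :: real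
    using divide_right_mono[OF that(1), of "\<bar>s\<bar>"] by (simp add: abs_divide flip: diff_divide_distrib)
  have "\<exists>s. m \<le> \<bar>s\<bar> \<and> measure lborel T \<le> 2 * r * (2 * h / \<bar>s\<bar>)"
    using pq
  proof
    assume p: "m \<le> \<bar>p\<bar>"
    hence p0: "p \<noteq> 0" using m by auto
    define f :: "real^2 \<Rightarrow> real^2" where "f w = (\<chi> i. if i = 1 then (p * w $ 1 + q * w $ 2) / p else w $ 2)" for w
    have "measure lborel T \<le> 2 * r * (2 * h / \<bar>p\<bar>)"
    proof (rule *[where f = f and s = p and a = "\<chi> i. if i = 1 then c / p - h / \<bar>p\<bar> else z $ 2 - r" and b = "\<chi> i. if i = 1 then c / p + h / \<bar>p\<bar> else z $ 2 + r"])
      show "linear f" using p0 by (intro linearI) (auto simp: f_def vec_eq_iff field_simps)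
      show "f ` T \<subseteq> cbox (\<chi> i. if i = 1 then c / p - h / \<bar>p\<bar> else z $ 2 - r) (\<chi> i. if i = 1 then c / p + h / \<bar>p\<bar> else z $ 2 + r)"
      proof
        fix y assume "y \<in> f ` T"
        then obtain w where w: "w \<in> T" "y = f w" by blast
        have "\<bar>p * w $ 1 + q * w $ 2 - c\<bar> \<le> h" using w by (simp add: T_def)
        from d[OF this p0] Tz[OF w(1), of 2]
        show "y \<in> cbox (\<chi> i. if i = 1 then c / p - h / \<bar>p\<bar> else z $ 2 - r) (\<chi> i. if i = 1 then c / p + h / \<bar>p\<bar> else z $ 2 + r)"
          by (auto simp: w f_def mem_box_cart forall_2 abs_le_iff)
      qed
    qed (use p0 h r in \<open>auto simp: f_def axis_def\<close>)
    with p show ?thesis by blast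
  next
    assume q: "m \<le> \<bar>q\<bar>"
    hence q0: "q \<noteq> 0" using m by auto
    define f :: "real^2 \<Rightarrow> real^2" where "f w = (\<chi> i. if i = 1 then w $ 1 else (p * w $ 1 + q * w $ 2) / q)" for w
    have "measure lborel T \<le> 2 * r * (2 * h / \<bar>q\<bar>)"
    proof (rule *[where f = f and s = q and a = "\<chi> i. if i = 1 then z $ 1 - r else c / q - h / \<bar>q\<bar>" and b = "\<chi> i. if i = 1 then z $ 1 + r else c / q + h / \<bar>q\<bar>"])
      show "linear f" using q0 by (intro linearI) (auto simp: f_def vec_eq_iff field_simps)
      show "f ` T \<subseteq> cbox (\<chi> i. if i = 1 then z $ 1 - r else c / q - h / \<bar>q\<bar>) (\<chi> i. if i = 1 then z $ 1 + r else c / q + h / \<bar>q\<bar>)"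
      proof
        fix y assume "y \<in> f ` T"
        then obtain w where w: "w \<in> T" "y = f w" by blast
        have "\<bar>p * w $ 1 + q * w $ 2 - c\<bar> \<le> h" using w by (simp add: T_def)
        from d[OF this q0] Tz[OF w(1), of 1]
        show "y \<in> cbox (\<chi> i. if i = 1 then z $ 1 - r else c / q - h / \<bar>q\<bar>) (\<chi> i. if i = 1 then z $ 1 + r else c / q + h / \<bar>q\<bar>)"
          by (auto simp: w f_def mem_box_cart forall_2 abs_le_iff)
      qed
    qed (use q0 h r in \<open>auto simp: f_def axis_def\<close>)
    with q show ?thesis by blast
  qed
  then obtain s where s: "m \<le> \<bar>s\<bar>" "measure lborel T \<le> 2 * r * (2 * h / \<bar>s\<bar>)" by blast
  have "2 * h / \<bar>s\<bar> \<le> 2 * h / m" using s(1) h m by (intro divide_left_mono) auto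
  hence "2 * r * (2 * h / \<bar>s\<bar>) \<le> 2 * r * (2 * h / m)" using r by (intro mult_left_mono) auto
  with s(2) have "measure lborel T \<le> 4 * h * r / m" by (simp add: mult_ac)
  thus ?thesis by (simp add: T_def)
qed

lemma emeasure_uniform_strip_le:
  fixes z :: "real^2"
  assumes r: "r > 0" and h: "h \<ge> 0" and m: "m > 0" and pq: "m \<le> \<bar>p\<bar> \<or> m \<le> \<bar>q\<bar>"
  shows "emeasure (uniform_measure lborel (cball z r)) {w. \<bar>p * w $ 1 + q * w $ 2 - c\<bar> \<le> h} \<le> ennreal (4 * h / (pi * r * m))"
proof -
  have [measurable]: "{w::real^2. \<bar>p * w $ 1 + q * w $ 2 - c\<bar> \<le> h} \<in> sets borel"
    by measurable
  have fin: "emeasure lborel (cball z r \<inter> {w. \<bar>p * w $ 1 + q * w $ 2 - c\<bar> \<le> h}) \<noteq> \<infinity>"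
    using emeasure_bounded_finite[of "cball z r \<inter> {w. \<bar>p * w $ 1 + q * w $ 2 - c\<bar> \<le> h}"] by (auto simp: bounded_Int)
  have "emeasure (uniform_measure lborel (cball z r)) {w. \<bar>p * w $ 1 + q * w $ 2 - c\<bar> \<le> h} =
      emeasure lborel (cball z r \<inter> {w. \<bar>p * w $ 1 + q * w $ 2 - c\<bar> \<le> h}) / emeasure lborel (cball z r)"
    by (subst emeasure_uniform_measure) auto
  also have "emeasure lborel (cball z r) = ennreal (pi * r\<^sup>2)"
    using r by (subst emeasure_cball) (auto simp: unit_ball_vol_2)
  also have "emeasure lborel (cball z r \<inter> {w. \<bar>p * w $ 1 + q * w $ 2 - c\<bar> \<le> h}) =
      ennreal (measure lborel (cball z r \<inter> {w. \<bar>p * w $ 1 + q * w $ 2 - c\<bar> \<le> h}))"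
    using fin by (simp add: emeasure_eq_ennreal_measure)
  also have "\<dots> / ennreal (pi * r\<^sup>2) \<le> ennreal (4 * h * r / m) / ennreal (pi * r\<^sup>2)"
    by (intro divide_right_mono_ennreal ennreal_leI measure_cball_strip_le assms)
  also have "\<dots> = ennreal (4 * h * r / m / (pi * r\<^sup>2))"
    using r h m by (intro divide_ennreal) auto
  also have "4 * h * r / m / (pi * r\<^sup>2) = 4 * h / (pi * r * m)"
    using r m by (simp add: power2_eq_square field_simps)
  finally show ?thesis .
qed

lemma strip_event_measurable:
  fixes P Q C x y :: "'a \<Rightarrow> real"
  assumes [measurable]: "P \<in> borel_measurable N" "Q \<in> borel_measurable N" "C \<in> borel_measurable N"
    "x \<in> borel_measurable N" "y \<in> borel_measurable N"
  shows "{v \<in> space N. (m \<le> \<bar>P v\<bar> \<or> m \<le> \<bar>Q v\<bar>) \<and> \<bar>P v * x v + Q v * y v - C v\<bar> \<le> h} \<in> sets N"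
  by measurable

lemma borel_measurable_vec_nth: "(\<lambda>x::real^2. x $ i) \<in> borel_measurable borel"
  by measurable

text \<open>The strip may depend on other variables of the independent family: conditionally on these it is fixed,
  and Fubini's theorem integrates the uniform bound for fixed strips. The lower bound \<open>m\<close> for one of the
  coefficients keeps the strip thin.\<close>
lemma (in prob_space) prob_random_strip_le:
  fixes Z :: "'i \<Rightarrow> 'a \<Rightarrow> real^2"
  assumes ind: "indep_vars (\<lambda>_. borel) Z I" and A: "A \<subseteq> I" and j: "j \<in> I" "j \<notin> A"
    and unif: "distr M borel (Z j) = uniform_measure lborel (cball z r)"
    and r: "r > 0" and h: "h \<ge> 0" and m: "m > 0"
    and P [measurable]: "P \<in> borel_measurable (PiM A (\<lambda>_. borel))"
    and Q [measurable]: "Q \<in> borel_measurable (PiM A (\<lambda>_. borel))"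
    and C [measurable]: "C \<in> borel_measurable (PiM A (\<lambda>_. borel))"
  defines "X \<equiv> \<lambda>\<omega>. restrict (\<lambda>i. Z i \<omega>) A"
  shows "prob {\<omega> \<in> space M. (m \<le> \<bar>P (X \<omega>)\<bar> \<or> m \<le> \<bar>Q (X \<omega>)\<bar>) \<and>
      \<bar>P (X \<omega>) * Z j \<omega> $ 1 + Q (X \<omega>) * Z j \<omega> $ 2 - C (X \<omega>)\<bar> \<le> h} \<le> 4 * h / (pi * r * m)"
proof -
  define Y where "Y \<omega> = restrict (\<lambda>i. Z i \<omega>) {j}" for \<omega>
  define S :: "(('i \<Rightarrow> real^2) \<times> ('i \<Rightarrow> real^2)) set" where "S = {v \<in> space (PiM A (\<lambda>_. borel) \<Otimes>\<^sub>M PiM {j} (\<lambda>_. borel)).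
     (m \<le> \<bar>P (fst v)\<bar> \<or> m \<le> \<bar>Q (fst v)\<bar>) \<and>
     \<bar>P (fst v) * snd v j $ 1 + Q (fst v) * snd v j $ 2 - C (fst v)\<bar> \<le> h}"
  have iv: "indep_var (PiM A (\<lambda>_. borel)) X (PiM {j} (\<lambda>_. borel)) Y"
    unfolding X_def Y_def using A j by (intro indep_var_restrict[OF ind]) auto
  have rv [measurable]: "random_variable (PiM A (\<lambda>_. borel)) X" "random_variable (PiM {j} (\<lambda>_. borel)) Y"
    using indep_var_rv1[OF iv] indep_var_rv2[OF iv] by auto
  have Zj [measurable]: "random_variable borel (Z j)"
    using ind j by (auto simp: indep_vars_def)
  have joint: "distr M (PiM A (\<lambda>_. borel)) X \<Otimes>\<^sub>M distr M (PiM {j} (\<lambda>_. borel)) Y =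
      distr M (PiM A (\<lambda>_. borel) \<Otimes>\<^sub>M PiM {j} (\<lambda>_. borel)) (\<lambda>x. (X x, Y x))"
    using iv unfolding indep_var_distribution_eq by blast
  interpret Y: prob_space "distr M (PiM {j} (\<lambda>_. borel)) Y" by (rule prob_space_distr) (rule rv)
  interpret X: prob_space "distr M (PiM A (\<lambda>_. borel)) X" by (rule prob_space_distr) (rule rv)
  have S: "S \<in> sets (PiM A (\<lambda>_. borel) \<Otimes>\<^sub>M PiM {j} (\<lambda>_. borel))"
  proof -
    have comp: "(\<lambda>v. snd v j) \<in> borel_measurable (PiM A (\<lambda>_. borel :: (real^2) measure) \<Otimes>\<^sub>M PiM {j} (\<lambda>_. borel :: (real^2) measure))"
      by (rule measurable_compose[OF measurable_snd measurable_component_singleton]) simp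
    show ?thesis unfolding S_def
      by (intro strip_event_measurable measurable_compose[OF measurable_fst] P Q C
          measurable_compose[OF comp borel_measurable_vec_nth])
  qed
  have "emeasure M ((\<lambda>x. (X x, Y x)) -` S \<inter> space M) =
      emeasure (distr M (PiM A (\<lambda>_. borel)) X \<Otimes>\<^sub>M distr M (PiM {j} (\<lambda>_. borel)) Y) S"
    unfolding joint using S by (intro emeasure_distr[symmetric] measurable_Pair rv)
  also have "\<dots> = (\<integral>\<^sup>+x. emeasure (distr M (PiM {j} (\<lambda>_. borel)) Y) (Pair x -` S) \<partial>distr M (PiM A (\<lambda>_. borel)) X)"
    using S by (intro Y.emeasure_pair_measure_alt) (simp cong: sets_pair_measure_cong)
  also have "\<dots> \<le> (\<integral>\<^sup>+x. ennreal (4 * h / (pi * r * m)) \<partial>distr M (PiM A (\<lambda>_. borel)) X)"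
  proof (rule nn_integral_mono)
    fix x assume "x \<in> space (distr M (PiM A (\<lambda>_. borel)) X)"
    hence x: "x \<in> space (PiM A (\<lambda>_. borel :: (real^2) measure))" by simp
    show "emeasure (distr M (PiM {j} (\<lambda>_. borel)) Y) (Pair x -` S) \<le> ennreal (4 * h / (pi * r * m))"
    proof (cases "m \<le> \<bar>P x\<bar> \<or> m \<le> \<bar>Q x\<bar>")
      case True
      define W :: "(real^2) set" where "W = {w. \<bar>P x * w $ 1 + Q x * w $ 2 - C x\<bar> \<le> h}"
      have W [measurable]: "W \<in> sets borel" unfolding W_def by measurable
      have "Pair x -` S = (\<lambda>\<sigma>. \<sigma> j) -` W \<inter> space (PiM {j} (\<lambda>_. borel))"
        using True x by (auto simp: S_def W_def space_pair_measure)
      moreover have "(\<lambda>\<sigma>. \<sigma> j) -` W \<inter> space (PiM {j} (\<lambda>_. borel)) \<in> sets (PiM {j} (\<lambda>_. borel))"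
        by (rule measurable_sets[OF _ W]) (auto intro: measurable_component_singleton)
      ultimately have "emeasure (distr M (PiM {j} (\<lambda>_. borel)) Y) (Pair x -` S) =
          emeasure M (Y -` ((\<lambda>\<sigma>. \<sigma> j) -` W \<inter> space (PiM {j} (\<lambda>_. borel))) \<inter> space M)"
        using emeasure_distr[OF rv(2)] by simp
      also have "Y -` ((\<lambda>\<sigma>. \<sigma> j) -` W \<inter> space (PiM {j} (\<lambda>_. borel))) \<inter> space M = Z j -` W \<inter> space M"
        using measurable_space[OF rv(2)] by (auto simp: Y_def)
      also have "emeasure M \<dots> = emeasure (distr M borel (Z j)) W"
        by (rule emeasure_distr[symmetric]) auto
      also have "\<dots> \<le> ennreal (4 * h / (pi * r * m))"
        unfolding unif W_def by (rule emeasure_uniform_strip_le[OF r h m True])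
      finally show ?thesis .
    next
      case False
      hence "Pair x -` S = {}" by (auto simp: S_def)
      thus ?thesis by simp
    qed
  qed
  also have "\<dots> = ennreal (4 * h / (pi * r * m))"
    using X.emeasure_space_1 by simp
  also have "(\<lambda>x. (X x, Y x)) -` S \<inter> space M = {\<omega> \<in> space M. (m \<le> \<bar>P (X \<omega>)\<bar> \<or> m \<le> \<bar>Q (X \<omega>)\<bar>) \<and>
      \<bar>P (X \<omega>) * Z j \<omega> $ 1 + Q (X \<omega>) * Z j \<omega> $ 2 - C (X \<omega>)\<bar> \<le> h}"
    using measurable_space[OF rv(1)] measurable_space[OF rv(2)]
    by (auto simp: S_def space_pair_measure Y_def)
  finally show ?thesis
    using r h m by (subst (asm) emeasure_eq_measure) (auto simp: ennreal_le_iff)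
qed

section \<open>The lattices and their densities\<close>

lemma dvd_add_of_dvd_diff:
  assumes "d \<in> {1, 2 :: int}" "d dvd j - k"
  shows "d dvd j + k"
proof -
  have "d dvd (j - k) + 2 * k" using assms by (intro dvd_add) auto
  moreover have "(j - k) + 2 * k = j + k" by simp
  ultimately show ?thesis by (simp only:)
qed

text \<open>With \<open>d = 1\<close> the rectangular and with \<open>d = 2\<close> the rhombic lattices: the points
  \<open>(p (m + n), q (m - n))\<close> are those whose two integer coordinates have the same parity.\<close>
definition parity_lattice :: "int \<Rightarrow> real \<Rightarrow> real \<Rightarrow> complex set" where
  "parity_lattice d p q = {Complex (p * of_int j) (q * of_int k) | j k. d dvd j - k}"

lemma wsigma_rescaled:
  assumes "Im \<tau> > 0" "a > 0"
  shows "(\<lambda>z. wsigma \<tau> (z / of_real a)) holomorphic_on UNIV"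
    "deriv (\<lambda>z. wsigma \<tau> (z / of_real a)) 0 = deriv (wsigma \<tau>) 0 / of_real a"
proof -
  have "wsigma \<tau> \<circ> (\<lambda>z. z / of_real a) holomorphic_on UNIV"
    using assms by (intro holomorphic_on_compose_gen[OF _ wsigma_holomorphic[of \<tau> UNIV]]) (auto intro!: holomorphic_intros)
  thus "(\<lambda>z. wsigma \<tau> (z / of_real a)) holomorphic_on UNIV" by (simp add: o_def)
  have "(wsigma \<tau> has_field_derivative deriv (wsigma \<tau>) (0 / of_real a)) (at (0 / of_real a))"
    by (rule holomorphic_derivI[OF wsigma_holomorphic[OF assms(1), of UNIV]]) auto
  hence "((\<lambda>z. wsigma \<tau> (z / of_real a)) has_field_derivative deriv (wsigma \<tau>) (0 / of_real a) * (1 / of_real a)) (at 0)"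
    by (rule DERIV_chain2) (use assms in \<open>auto intro!: derivative_eq_intros\<close>)
  thus "deriv (\<lambda>z. wsigma \<tau> (z / of_real a)) 0 = deriv (wsigma \<tau>) 0 / of_real a"
    by (intro DERIV_imp_deriv) simp
qed

text \<open>The lattice is \<open>a (\<int> + \<tau> \<int>)\<close> with \<open>a = d p\<close> and \<open>\<tau> = 1 / d + \<i> q / a\<close>. Its covolume is \<open>d p q\<close>, and rescaling
  the sigma function of \<open>\<int> + \<tau> \<int>\<close> by \<open>a\<close> gives the exponent \<open>\<pi> / (2 d p q)\<close>.\<close>
lemma lattice_sigma_parity_lattice:
  assumes d: "d \<in> {1, 2}" and p: "p > 0" and q: "q > 0"
  obtains S where "lattice_sigma (parity_lattice d p q) p q (pi / (2 * of_int d * p * q)) S"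
proof -
  define a where "a = of_int d * p"
  define \<tau> where "\<tau> = Complex (1 / of_int d) (q / a)"
  have d0: "of_int d > (0 :: real)" using d by auto
  have a: "a > 0" using d0 p by (simp add: a_def)
  have \<tau>: "Im \<tau> > 0" using a q by (simp add: \<tau>_def)
  define S where "S z = wsigma \<tau> (z / of_real a)" for z
  have gen: "of_real a * (of_int m + of_int n * \<tau>) = Complex (p * of_int (d * m + n)) (q * of_int n)" for m n
    using a d0 by (simp add: complex_eq_iff \<tau>_def) (simp add: a_def field_simps)
  have mem: "z \<in> parity_lattice d p q \<longleftrightarrow> (\<exists>m n. z / of_real a = of_int m + of_int n * \<tau>)" for z
  proof
    assume "z \<in> parity_lattice d p q"
    then obtain j k where jk: "z = Complex (p * of_int j) (q * of_int k)" "d dvd j - k"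
      by (auto simp: parity_lattice_def)
    from jk(2) obtain m where "j - k = d * m" by (auto simp: dvd_def)
    hence "j = d * m + k" by simp
    hence "z = of_real a * (of_int m + of_int k * \<tau>)" using gen jk by simp
    thus "\<exists>m n. z / of_real a = of_int m + of_int n * \<tau>" using a by auto
  next
    assume "\<exists>m n. z / of_real a = of_int m + of_int n * \<tau>"
    then obtain m n where "z / of_real a = of_int m + of_int n * \<tau>" by blast
    hence "z = of_real a * (of_int m + of_int n * \<tau>)" using a by (auto simp: field_simps)
    hence "z = Complex (p * of_int (d * m + n)) (q * of_int n)" unfolding gen .
    moreover have "d dvd (d * m + n) - n" by simp
    ultimately show "z \<in> parity_lattice d p q" unfolding parity_lattice_def by blast
  qed
  have \<alpha>: "pi / (2 * Im \<tau>) / a\<^sup>2 = pi / (2 * of_int d * p * q)"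
    using a by (simp add: \<tau>_def power2_eq_square) (simp add: a_def mult_ac)
  have "lattice_sigma (parity_lattice d p q) p q (pi / (2 * of_int d * p * q)) S"
  proof
    show "0 < pi / (2 * of_int d * p * q)" using d0 p q by simp
    show "parity_lattice d p q \<subseteq> {Complex (p * of_int m) (q * of_int n) | m n. True}"
      by (auto simp: parity_lattice_def)
    show "Complex (2 * p * of_int m) (2 * q * of_int n) \<in> parity_lattice d p q" for m n
    proof -
      have "Complex (2 * p * of_int m) (2 * q * of_int n) = Complex (p * of_int (2 * m)) (q * of_int (2 * n))" by simp
      moreover have "d dvd 2 * m - 2 * n" using d by auto
      ultimately show ?thesis unfolding parity_lattice_def by blast
    qed
    show "S holomorphic_on UNIV" unfolding S_def by (rule wsigma_rescaled[OF \<tau> a])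
    show "S z = 0 \<longleftrightarrow> z \<in> parity_lattice d p q" for z
      unfolding S_def wsigma_eq_0_iff[OF \<tau>] mem ..
    show "deriv S 0 \<noteq> 0"
      unfolding S_def wsigma_rescaled(2)[OF \<tau> a] using deriv_wsigma_0[OF \<tau>] a by simp
    fix l z assume "l \<in> parity_lattice d p q"
    then obtain m n where l: "l / of_real a = of_int m + of_int n * \<tau>" using mem by blast
    have e: "- pi / (2 * Im \<tau>) * (norm (w / of_real a))\<^sup>2 = - (pi / (2 * of_int d * p * q)) * (norm w)\<^sup>2" for w :: complex
      unfolding \<alpha>[symmetric] using a by (simp add: norm_divide power_divide)
    show "norm (S (z + l)) * exp (- (pi / (2 * of_int d * p * q)) * (norm (z + l))\<^sup>2) =
        norm (S z) * exp (- (pi / (2 * of_int d * p * q)) * (norm z)\<^sup>2)"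
      using norm_wsigma_periodic[OF \<tau>, of "z / of_real a" m n]
      unfolding l[symmetric] add_divide_distrib[symmetric] e S_def[symmetric] .
  qed (use p q in auto)
  thus ?thesis using that by blast
qed

lemma parity_lattice_abs:
  assumes "d \<in> {1, 2}"
  shows "parity_lattice d \<bar>p\<bar> \<bar>q\<bar> = parity_lattice d p q"
proof -
  have 1: "parity_lattice d (- p) q \<subseteq> parity_lattice d p q" for p q
  proof
    fix z assume "z \<in> parity_lattice d (- p) q"
    then obtain j k where "z = Complex (p * of_int (- j)) (q * of_int k)" "d dvd j - k" by (auto simp: parity_lattice_def)
    moreover have "d dvd (- j) - k"
      using dvd_add_of_dvd_diff[OF assms \<open>d dvd j - k\<close>] by (metis dvd_minus_iff minus_add_distrib diff_conv_add_uminus)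
    ultimately show "z \<in> parity_lattice d p q" unfolding parity_lattice_def by blast
  qed
  have 2: "parity_lattice d p (- q) \<subseteq> parity_lattice d p q" for p q
  proof
    fix z assume "z \<in> parity_lattice d p (- q)"
    then obtain j k where "z = Complex (p * of_int j) (q * of_int (- k))" "d dvd j - k" by (auto simp: parity_lattice_def)
    moreover have "d dvd j - (- k)"
      using dvd_add_of_dvd_diff[OF assms \<open>d dvd j - k\<close>] by simp
    ultimately show "z \<in> parity_lattice d p q" unfolding parity_lattice_def by blast
  qed
  have "parity_lattice d (- p) q = parity_lattice d p q" "parity_lattice d p (- q) = parity_lattice d p q" for p q
    using 1[of p q] 1[of "- p" q] 2[of p q] 2[of p "- q"] by auto
  thus ?thesis by (auto simp: abs_if)
qed

lemma parity_lattice_cnj: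
  assumes "d \<in> {1, 2}" "z \<in> parity_lattice d p q"
  shows "cnj z \<in> parity_lattice d p q"
proof -
  obtain j k where jk: "z = Complex (p * of_int j) (q * of_int k)" "d dvd j - k"
    using assms by (auto simp: parity_lattice_def)
  have "cnj z = Complex (p * of_int j) (q * of_int (- k))" by (simp add: jk complex_eq_iff)
  moreover have "d dvd j - (- k)" using dvd_add_of_dvd_diff[OF assms(1) jk(2)] by simp
  ultimately show ?thesis unfolding parity_lattice_def by blast
qed

definition complex_of_vec :: "real^2 \<Rightarrow> complex" where
  "complex_of_vec v = Complex (v $ 1) (v $ 2)"

lemma complex_of_vec_inj: "inj complex_of_vec"
  by (auto simp: inj_on_def complex_of_vec_def vec_eq_iff forall_2)

lemma norm_complex_of_vec: "norm (complex_of_vec v) = norm v"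
  by (simp add: complex_of_vec_def cmod_def norm_vec_def L2_set_def sum_2)

lemma complex_of_vec_diff: "complex_of_vec (v - w) = complex_of_vec v - complex_of_vec w"
  by (simp add: complex_of_vec_def complex_eq_iff)

lemma gabor_lattices_parity:
  assumes "\<Lambda> \<in> gabor_lattices"
  obtains d p q where "d \<in> {1, 2}" "p \<noteq> 0" "q \<noteq> 0" "complex_of_vec ` \<Lambda> = parity_lattice d p q"
proof -
  have vec: "\<exists>v \<in> int_lattice. v $ 1 = of_int m \<and> v $ 2 = of_int n" for m n
    by (rule bexI[of _ "\<chi> i. if i = 1 then of_int m else of_int n"]) (auto simp: int_lattice_def)
  from assms consider
    p q where "p \<noteq> 0" "q \<noteq> 0" "\<Lambda> = (*v) (vector [vector [p, 0], vector [0, q]] :: real^2^2) ` int_lattice"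
  | p q where "p \<noteq> 0" "q \<noteq> 0" "\<Lambda> = (*v) (vector [vector [p, p], vector [q, - q]] :: real^2^2) ` int_lattice"
    unfolding gabor_lattices_def by blast
  thus ?thesis
  proof cases
    case (1 p q)
    have c: "complex_of_vec ((vector [vector [p, 0], vector [0, q]] :: real^2^2) *v v) = Complex (p * v $ 1) (q * v $ 2)" for v
      by (simp add: complex_of_vec_def matrix_vector_mult_def sum_2)
    have "complex_of_vec ` \<Lambda> = parity_lattice 1 p q"
    proof (intro equalityI subsetI)
      fix z assume "z \<in> complex_of_vec ` \<Lambda>"
      then obtain v where v: "v \<in> int_lattice" "z = Complex (p * v $ 1) (q * v $ 2)"
        unfolding 1 using c by auto
      have "v $ 1 \<in> \<int>" "v $ 2 \<in> \<int>" using v(1) by (auto simp: int_lattice_def)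
      then obtain m n :: int where "v $ 1 = of_int m" "v $ 2 = of_int n" by (auto elim!: Ints_cases)
      thus "z \<in> parity_lattice 1 p q" unfolding parity_lattice_def v by auto
    next
      fix z assume "z \<in> parity_lattice 1 p q"
      then obtain m n :: int where z: "z = Complex (p * of_int m) (q * of_int n)" by (auto simp: parity_lattice_def)
      obtain v where "v \<in> int_lattice" "v $ 1 = of_int m" "v $ 2 = of_int n" using vec by blast
      thus "z \<in> complex_of_vec ` \<Lambda>" unfolding 1 z using c[of v] by (auto intro!: image_eqI)
    qed
    with 1 that[of 1 p q] show ?thesis by simp
  next
    case (2 p q)
    have c: "complex_of_vec ((vector [vector [p, p], vector [q, - q]] :: real^2^2) *v v) = Complex (p * (v $ 1 + v $ 2)) (q * (v $ 1 - v $ 2))" for v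
      by (simp add: complex_of_vec_def matrix_vector_mult_def sum_2 algebra_simps)
    have "complex_of_vec ` \<Lambda> = parity_lattice 2 p q"
    proof (intro equalityI subsetI)
      fix z assume "z \<in> complex_of_vec ` \<Lambda>"
      then obtain v where v: "v \<in> int_lattice" "z = Complex (p * (v $ 1 + v $ 2)) (q * (v $ 1 - v $ 2))"
        unfolding 2 using c by auto
      have "v $ 1 \<in> \<int>" "v $ 2 \<in> \<int>" using v(1) by (auto simp: int_lattice_def)
      then obtain m n :: int where "v $ 1 = of_int m" "v $ 2 = of_int n" by (auto elim!: Ints_cases)
      hence "z = Complex (p * of_int (m + n)) (q * of_int (m - n))" by (simp add: v)
      moreover have "2 dvd (m + n) - (m - n)" by simp
      ultimately show "z \<in> parity_lattice 2 p q" unfolding parity_lattice_def by blast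
    next
      fix z assume "z \<in> parity_lattice 2 p q"
      then obtain j k :: int where z: "z = Complex (p * of_int j) (q * of_int k)" "2 dvd j - k" by (auto simp: parity_lattice_def)
      from z(2) obtain n where "j - k = 2 * n" by (auto simp: dvd_def)
      hence n: "j = 2 * n + k" by simp
      obtain v where v: "v \<in> int_lattice" "v $ 1 = of_int (n + k)" "v $ 2 = of_int n" using vec by blast
      have "z = complex_of_vec ((vector [vector [p, p], vector [q, - q]] :: real^2^2) *v v)"
        unfolding c z n by (simp add: v algebra_simps)
      thus "z \<in> complex_of_vec ` \<Lambda>" unfolding 2 using v(1) by blast
    qed
    with 2 that[of 2 p q] show ?thesis by simp
  qed
qed

lemma measure_parallelogram:
  fixes v w :: "real^2"
  shows "measure lebesgue {s *\<^sub>R v + t *\<^sub>R w | s t. 0 \<le> s \<and> s < 1 \<and> 0 \<le> t \<and> t < 1} = \<bar>v $ 1 * w $ 2 - w $ 1 * v $ 2\<bar>"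
proof -
  define B where "B = {x :: real^2. 0 \<le> x $ 1 \<and> x $ 1 < 1 \<and> 0 \<le> x $ 2 \<and> x $ 2 < 1}"
  define f where "f x = x $ 1 *\<^sub>R v + x $ 2 *\<^sub>R w" for x :: "real^2"
  have sub: "box 0 1 \<subseteq> B" "B \<subseteq> cbox 0 1" by (auto simp: B_def mem_box_cart forall_2)
  have "B \<in> sets borel" unfolding B_def by measurable
  hence B: "B \<in> lmeasurable"
    using sub by (intro bounded_set_imp_lmeasurable bounded_subset[OF bounded_cbox sub(2)]) auto
  have "measure lebesgue (box 0 1 :: (real^2) set) \<le> measure lebesgue B"
    by (intro measure_mono_fmeasurable sub B) auto
  moreover have "measure lebesgue B \<le> measure lebesgue (cbox 0 1 :: (real^2) set)"
    using B by (intro measure_mono_fmeasurable sub) (auto intro: fmeasurableD)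
  moreover have "measure lebesgue (box 0 1 :: (real^2) set) = measure lebesgue (cbox 0 1 :: (real^2) set)"
    by (simp add: measure_lborel_box_eq measure_lborel_cbox_eq)
  moreover have "measure lebesgue (cbox 0 1 :: (real^2) set) = 1"
    using content_cbox_2[of 0 1] by simp
  ultimately have "measure lebesgue B = 1" by linarith
  moreover have "linear f" by (intro linearI) (auto simp: f_def algebra_simps)
  moreover have "{s *\<^sub>R v + t *\<^sub>R w | s t. 0 \<le> s \<and> s < 1 \<and> 0 \<le> t \<and> t < 1} = f ` B"
  proof (intro equalityI subsetI)
    fix x assume "x \<in> {s *\<^sub>R v + t *\<^sub>R w | s t. 0 \<le> s \<and> s < 1 \<and> 0 \<le> t \<and> t < 1}"
    then obtain s t where st: "x = s *\<^sub>R v + t *\<^sub>R w" "0 \<le> s" "s < 1" "0 \<le> t" "t < 1" by blast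
    have "x = f (vector [s, t])" by (simp add: f_def st)
    moreover have "vector [s, t] \<in> B" using st by (simp add: B_def)
    ultimately show "x \<in> f ` B" by blast
  qed (auto simp: f_def B_def)
  ultimately show ?thesis
    using measure_linear_image_2[of f B] B by (simp add: f_def axis_def)
qed

text \<open>The vectors spanning the chosen period parallelogram belong to the lattice, so its area is a non-zero
  integer multiple of the covolume \<open>d |p q|\<close>.\<close>
lemma cell_area_ge:
  assumes d: "d \<in> {1, 2}" and p: "p \<noteq> 0" and q: "q \<noteq> 0"
    and \<Lambda>: "complex_of_vec ` \<Lambda> = parity_lattice d p q"
    and pos: "cell_area \<Lambda> \<noteq> 0"
  shows "of_int d * \<bar>p * q\<bar> \<le> cell_area \<Lambda>"
proof -
  have mem: "v \<in> \<Lambda> \<longleftrightarrow> (\<exists>j k. d dvd j - k \<and> v $ 1 = p * of_int j \<and> v $ 2 = q * of_int k)" for v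
  proof -
    have "v \<in> \<Lambda> \<longleftrightarrow> complex_of_vec v \<in> parity_lattice d p q"
      unfolding \<Lambda>[symmetric] using complex_of_vec_inj by (simp add: inj_image_mem_iff)
    thus ?thesis by (auto simp: parity_lattice_def complex_of_vec_def)
  qed
  have "\<exists>P. period_parallelogram \<Lambda> P"
  proof -
    define v w :: "real^2" where "v = vector [of_int d * p, 0]" and "w = vector [p, q]"
    have "v \<noteq> w" using q by (auto simp: v_def w_def vec_eq_iff forall_2)
    moreover have "independent {v, w}"
    proof (rule independent_if_scalars_zero)
      fix f :: "real^2 \<Rightarrow> real" and x
      assume s: "(\<Sum>x\<in>{v, w}. f x *\<^sub>R x) = 0" and x: "x \<in> {v, w}"
      have "f v *\<^sub>R v + f w *\<^sub>R w = 0" using s \<open>v \<noteq> w\<close> by simp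
      hence "f v * (of_int d * p) + f w * p = 0" "f w * q = 0"
        by (auto simp: v_def w_def vec_eq_iff forall_2)
      thus "f x = 0" using x p q d by auto
    qed auto
    moreover have "\<Lambda> = {of_int m *\<^sub>R v + of_int n *\<^sub>R w | m n. True}"
    proof (intro equalityI subsetI)
      fix x assume "x \<in> \<Lambda>"
      then obtain j k where jk: "d dvd j - k" "x $ 1 = p * of_int j" "x $ 2 = q * of_int k" using mem by blast
      from jk(1) obtain m where "j - k = d * m" by (auto simp: dvd_def)
      hence "j = d * m + k" by simp
      hence "x = of_int m *\<^sub>R v + of_int k *\<^sub>R w"
        by (simp add: vec_eq_iff forall_2 jk v_def w_def algebra_simps)
      thus "x \<in> {of_int m *\<^sub>R v + of_int n *\<^sub>R w | m n. True}" by blast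
    next
      fix x assume "x \<in> {of_int m *\<^sub>R v + of_int n *\<^sub>R w | m n. True}"
      then obtain m n where "x = of_int m *\<^sub>R v + of_int n *\<^sub>R w" by blast
      hence "d dvd (d * m + n) - n \<and> x $ 1 = p * of_int (d * m + n) \<and> x $ 2 = q * of_int n"
        by (simp add: v_def w_def algebra_simps)
      thus "x \<in> \<Lambda>" unfolding mem by blast
    qed
    ultimately show ?thesis unfolding period_parallelogram_def by blast
  qed
  hence "period_parallelogram \<Lambda> (SOME P. period_parallelogram \<Lambda> P)" by (rule someI_ex)
  then obtain v w where vw: "\<Lambda> = {of_int m *\<^sub>R v + of_int n *\<^sub>R w | m n. True}"
    "(SOME P. period_parallelogram \<Lambda> P) = {s *\<^sub>R v + t *\<^sub>R w | s t. 0 \<le> s \<and> s < 1 \<and> 0 \<le> t \<and> t < 1}"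
    unfolding period_parallelogram_def by blast
  have area: "cell_area \<Lambda> = \<bar>v $ 1 * w $ 2 - w $ 1 * v $ 2\<bar>"
    unfolding cell_area_def vw(2) by (rule measure_parallelogram)
  have "v = of_int 1 *\<^sub>R v + of_int 0 *\<^sub>R w" "w = of_int 0 *\<^sub>R v + of_int 1 *\<^sub>R w" by simp_all
  hence "v \<in> \<Lambda>" "w \<in> \<Lambda>" unfolding vw(1) by blast+
  then obtain j k j' k' where jk: "d dvd j - k" "v $ 1 = p * of_int j" "v $ 2 = q * of_int k"
    "d dvd j' - k'" "w $ 1 = p * of_int j'" "w $ 2 = q * of_int k'" unfolding mem by blast
  have "d dvd (j - k) * k' - (j' - k') * k" by (intro dvd_diff dvd_mult2 jk(1) jk(4))
  also have "(j - k) * k' - (j' - k') * k = j * k' - j' * k" by (simp add: algebra_simps)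
  finally have dvd: "d dvd j * k' - j' * k" .
  have eq: "v $ 1 * w $ 2 - w $ 1 * v $ 2 = p * q * of_int (j * k' - j' * k)"
    by (simp add: jk algebra_simps)
  have "j * k' - j' * k \<noteq> 0"
  proof
    assume "j * k' - j' * k = 0"
    with pos show False unfolding area eq by (simp only: of_int_0 mult_zero_right abs_zero)
  qed
  hence "d \<le> \<bar>j * k' - j' * k\<bar>" using dvd_imp_le_int[OF _ dvd] d by auto
  hence "real_of_int d \<le> of_int \<bar>j * k' - j' * k\<bar>" by (simp only: of_int_le_iff)
  hence "of_int d * \<bar>p * q\<bar> \<le> of_int \<bar>j * k' - j' * k\<bar> * \<bar>p * q\<bar>" by (intro mult_right_mono) auto
  thus ?thesis unfolding area eq by (simp add: abs_mult mult_ac)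
qed

lemma dense_lattice_sigma:
  assumes "\<Lambda> \<in> gabor_lattices" "lattice_density \<Lambda> > 4"
  obtains p q \<alpha> S where "lattice_sigma (complex_of_vec ` \<Lambda>) p q \<alpha> S" "\<alpha> > 2 * pi"
    "\<And>l. l \<in> complex_of_vec ` \<Lambda> \<Longrightarrow> cnj l \<in> complex_of_vec ` \<Lambda>"
proof -
  obtain d p q where dpq: "d \<in> {1, 2}" "p \<noteq> 0" "q \<noteq> 0" "complex_of_vec ` \<Lambda> = parity_lattice d p q"
    using gabor_lattices_parity[OF assms(1)] by blast
  have cell: "cell_area \<Lambda> > 0" "cell_area \<Lambda> < 1 / 4"
  proof -
    have 1: "1 / cell_area \<Lambda> > 4" using assms(2) by (simp add: lattice_density_def)
    hence "1 / cell_area \<Lambda> > 0" by linarith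
    thus pos: "cell_area \<Lambda> > 0" by (simp add: zero_less_divide_iff)
    show "cell_area \<Lambda> < 1 / 4" using 1 pos by (simp add: field_simps)
  qed
  have small: "of_int d * \<bar>p * q\<bar> < 1 / 4"
    using cell_area_ge[OF dpq] cell by linarith
  have pos: "of_int d * \<bar>p * q\<bar> > 0" using dpq by auto
  obtain S where S: "lattice_sigma (parity_lattice d \<bar>p\<bar> \<bar>q\<bar>) \<bar>p\<bar> \<bar>q\<bar> (pi / (2 * of_int d * \<bar>p\<bar> * \<bar>q\<bar>)) S"
    using lattice_sigma_parity_lattice[of d "\<bar>p\<bar>" "\<bar>q\<bar>"] dpq by auto
  have "pi / (2 * of_int d * \<bar>p\<bar> * \<bar>q\<bar>) = pi / 2 * (1 / (of_int d * \<bar>p * q\<bar>))"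
    by (simp add: abs_mult)
  also have "1 / (of_int d * \<bar>p * q\<bar>) > 4" using small pos by (simp add: field_simps)
  hence "pi / 2 * (1 / (of_int d * \<bar>p * q\<bar>)) > pi / 2 * 4" by (intro mult_strict_left_mono) auto
  finally have "pi / (2 * of_int d * \<bar>p\<bar> * \<bar>q\<bar>) > 2 * pi" by simp
  with S show ?thesis
    using that[of "\<bar>p\<bar>" "\<bar>q\<bar>" _ S] parity_lattice_cnj[OF dpq(1)] unfolding parity_lattice_abs[OF dpq(1)] dpq(4) by blast
qed

section \<open>Random perturbations of a lattice\<close>

definition reflect :: "real^2 \<Rightarrow> real^2" where
  "reflect v = (\<chi> i. if i = 1 then v $ 1 else - v $ 2)"

lemma complex_of_vec_reflect: "complex_of_vec (reflect v) = cnj (complex_of_vec v)"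
  by (simp add: complex_of_vec_def reflect_def complex_eq_iff)

lemma norm_reflect: "norm (reflect v) = norm v"
  by (metis complex_mod_cnj complex_of_vec_reflect norm_complex_of_vec)

lemma (in lattice_sigma) countable_L: "countable L"
proof -
  have "L \<subseteq> range (\<lambda>(m::int, n::int). Complex (p * of_int m) (q * of_int n))"
    using L_sub by force
  thus ?thesis by (rule countable_subset) auto
qed

lemma (in lattice_sigma) infinite_L: "infinite L"
proof
  assume "finite L"
  hence "finite (range (\<lambda>m::int. Complex (2 * p * of_int m) (2 * q * of_int 0)))"
    by (rule finite_subset[rotated]) (use L_sup in blast)
  moreover have "inj (\<lambda>m::int. Complex (2 * p * of_int m) (2 * q * of_int 0))"
    using p_pos by (auto simp: inj_on_def)
  ultimately show False using finite_imageD infinite_UNIV_int by blast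
qed

text \<open>Relative to the radius \<open>f v\<close> of the disks, both ways in which the sample points can fail to be separated
  confine one of them to a strip of relative width \<open>\<kappa> v\<close> that is determined by the others. Such an event has
  probability \<open>O(\<kappa> v)\<close>, and the Borel-Cantelli lemma applies since \<open>\<kappa>\<close> is summable.\<close>
lemma (in prob_space) AE_eventually_separated:
  fixes Z :: "(real^2) \<times> nat \<Rightarrow> 'a \<Rightarrow> real^2"
  assumes ind: "indep_vars (\<lambda>_. borel) Z (\<Lambda> \<times> {1, 2})"
    and unif: "\<And>v l. v \<in> \<Lambda> \<Longrightarrow> l \<in> {1, 2} \<Longrightarrow> distr M borel (Z (v, l)) = uniform_measure lborel (cball v (f v))"
    and f_pos: "\<And>v. f v > 0" and f_reflect: "\<And>v. f (reflect v) = f v"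
    and \<Lambda>: "countable \<Lambda>" "infinite \<Lambda>" "\<And>v. v \<in> \<Lambda> \<Longrightarrow> reflect v \<in> \<Lambda>"
    and \<kappa>: "\<And>v. \<kappa> v > 0" "\<kappa> summable_on \<Lambda>"
  defines "w \<equiv> \<lambda>v i \<omega>. complex_of_vec (Z (v, i) \<omega>)"
  shows "AE \<omega> in M. \<exists>X. finite X \<and> (\<forall>v \<in> \<Lambda> - X.
      f v * \<kappa> v \<le> \<bar>Re (w v 2 \<omega> - w v 1 \<omega>)\<bar> \<and>
      (reflect v \<noteq> v \<longrightarrow> (f v)\<^sup>2 * (\<kappa> v)\<^sup>2 \<le>
         \<bar>Im (cnj (w v 2 \<omega> - w v 1 \<omega>) * (cnj (w (reflect v) 1 \<omega>) - w v 1 \<omega>))\<bar>))"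
proof -
  have rv: "random_variable borel (Z (v, l))" if "v \<in> \<Lambda>" "l \<in> {1, 2}" for v l
    using ind that by (auto simp: indep_vars_def)
  have comp: "(\<lambda>\<rho> :: (real^2) \<times> nat \<Rightarrow> real^2. \<rho> i $ k) \<in> borel_measurable (PiM A (\<lambda>_. borel))"
    if "i \<in> A" for i k and A :: "((real^2) \<times> nat) set"
    by (rule measurable_compose[OF measurable_component_singleton[OF that] borel_measurable_vec_nth])
  \<comment> \<open>The abscissae of the two samples around \<open>v\<close> are too close.\<close>
  define B1 where "B1 v = {\<omega> \<in> space M. \<bar>Z (v, 2) \<omega> $ 1 - Z (v, 1) \<omega> $ 1\<bar> \<le> f v * \<kappa> v}" for v
  \<comment> \<open>The conjugate of the sample around \<open>reflect v\<close> is too close to the line through the two samples around \<open>v\<close>.\<close>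
  define B2 where "B2 v = {\<omega> \<in> space M.
     (f v * \<kappa> v \<le> \<bar>Z (v, 2) \<omega> $ 2 - Z (v, 1) \<omega> $ 2\<bar> \<or> f v * \<kappa> v \<le> \<bar>Z (v, 2) \<omega> $ 1 - Z (v, 1) \<omega> $ 1\<bar>) \<and>
     \<bar>(Z (v, 2) \<omega> $ 2 - Z (v, 1) \<omega> $ 2) * Z (reflect v, 1) \<omega> $ 1 +
      (Z (v, 2) \<omega> $ 1 - Z (v, 1) \<omega> $ 1) * Z (reflect v, 1) \<omega> $ 2 -
      ((Z (v, 2) \<omega> $ 2 - Z (v, 1) \<omega> $ 2) * Z (v, 1) \<omega> $ 1 -
       (Z (v, 2) \<omega> $ 1 - Z (v, 1) \<omega> $ 1) * Z (v, 1) \<omega> $ 2)\<bar> \<le> (f v)\<^sup>2 * (\<kappa> v)\<^sup>2}" for v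
  define B where "B v = B1 v \<union> (if reflect v = v then {} else B2 v)" for v
  have coord: "(\<lambda>\<omega>. Z (v, l) \<omega> $ k) \<in> borel_measurable M" if "v \<in> \<Lambda>" "l \<in> {1, 2}" for v l k
    by (rule measurable_compose[OF rv[OF that] borel_measurable_vec_nth])
  have B1_ev: "B1 v \<in> events" if "v \<in> \<Lambda>" for v
  proof -
    have [measurable]: "(\<lambda>\<omega>. Z (v, 2) \<omega> $ 1) \<in> borel_measurable M" "(\<lambda>\<omega>. Z (v, 1) \<omega> $ 1) \<in> borel_measurable M"
      using that by (auto intro: coord)
    show ?thesis unfolding B1_def by measurable
  qed
  have B2_ev: "B2 v \<in> events" if "v \<in> \<Lambda>" for v
    unfolding B2_def using that \<Lambda>(3)
    by (intro strip_event_measurable borel_measurable_diff borel_measurable_times coord) auto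
  have B_ev: "B v \<in> events" if "v \<in> \<Lambda>" for v
    unfolding B_def using B1_ev[OF that] B2_ev[OF that] by auto
  have B1_prob: "prob (B1 v) \<le> 4 / pi * \<kappa> v" if v: "v \<in> \<Lambda>" for v
  proof -
    have "prob {\<omega> \<in> space M. (1 \<le> \<bar>1::real\<bar> \<or> 1 \<le> \<bar>0::real\<bar>) \<and>
        \<bar>1 * Z (v, 2) \<omega> $ 1 + 0 * Z (v, 2) \<omega> $ 2 - restrict (\<lambda>i. Z i \<omega>) {(v, 1)} (v, 1) $ 1\<bar> \<le> f v * \<kappa> v}
        \<le> 4 * (f v * \<kappa> v) / (pi * f v * 1)"
      by (rule prob_random_strip_le[OF ind _ _ _ unif, where A = "{(v, 1)}" and P = "\<lambda>_. 1" and Q = "\<lambda>_. 0" and C = "\<lambda>\<rho>. \<rho> (v, 1) $ 1"])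
        (use v f_pos[of v] \<kappa>(1)[of v] in \<open>auto intro: comp less_imp_le\<close>)
    thus ?thesis using f_pos[of v] by (simp add: B1_def)
  qed
  have B2_prob: "prob (B2 v) \<le> 4 / pi * \<kappa> v" if v: "v \<in> \<Lambda>" "reflect v \<noteq> v" for v
  proof -
    let ?A = "{(v, 1), (v, 2 :: nat)}"
    let ?X = "\<lambda>\<omega>. restrict (\<lambda>i. Z i \<omega>) ?A"
    let ?P = "\<lambda>\<rho> :: (real^2) \<times> nat \<Rightarrow> real^2. \<rho> (v, 2) $ 2 - \<rho> (v, 1) $ 2"
    let ?Q = "\<lambda>\<rho> :: (real^2) \<times> nat \<Rightarrow> real^2. \<rho> (v, 2) $ 1 - \<rho> (v, 1) $ 1"
    let ?C = "\<lambda>\<rho> :: (real^2) \<times> nat \<Rightarrow> real^2. ?P \<rho> * \<rho> (v, 1) $ 1 - ?Q \<rho> * \<rho> (v, 1) $ 2"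
    have pos: "f v * \<kappa> v > 0" using f_pos \<kappa> by simp
    have "prob {\<omega> \<in> space M. (f v * \<kappa> v \<le> \<bar>?P (?X \<omega>)\<bar> \<or> f v * \<kappa> v \<le> \<bar>?Q (?X \<omega>)\<bar>) \<and>
        \<bar>?P (?X \<omega>) * Z (reflect v, 1) \<omega> $ 1 + ?Q (?X \<omega>) * Z (reflect v, 1) \<omega> $ 2 - ?C (?X \<omega>)\<bar> \<le> (f v)\<^sup>2 * (\<kappa> v)\<^sup>2}
        \<le> 4 * ((f v)\<^sup>2 * (\<kappa> v)\<^sup>2) / (pi * f (reflect v) * (f v * \<kappa> v))"
    proof (rule prob_random_strip_le[OF ind _ _ _ unif])
      show "?P \<in> borel_measurable (PiM ?A (\<lambda>_. borel))" "?Q \<in> borel_measurable (PiM ?A (\<lambda>_. borel))"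
        "?C \<in> borel_measurable (PiM ?A (\<lambda>_. borel))"
        by (intro borel_measurable_diff borel_measurable_times comp; simp)+
    qed (use v \<Lambda>(3) f_pos pos in auto)
    also have "4 * ((f v)\<^sup>2 * (\<kappa> v)\<^sup>2) / (pi * f (reflect v) * (f v * \<kappa> v)) = 4 / pi * \<kappa> v"
      unfolding f_reflect using f_pos[of v] \<kappa>(1)[of v] by (simp add: power2_eq_square field_simps)
    finally show ?thesis by (simp add: B2_def)
  qed
  have B_prob: "prob (B v) \<le> 8 / pi * \<kappa> v" if v: "v \<in> \<Lambda>" for v
  proof (cases "reflect v = v")
    case True
    have "prob (B v) \<le> 4 / pi * \<kappa> v" using B1_prob[OF v] True by (simp add: B_def)
    also have "\<dots> \<le> 8 / pi * \<kappa> v"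
      using \<kappa>(1)[of v] by (intro mult_right_mono divide_right_mono) auto
    finally show ?thesis .
  next
    case False
    have "prob (B v) \<le> prob (B1 v) + prob (B2 v)"
      using False B1_ev[OF v] B2_ev[OF v] by (simp add: B_def measure_Un_le)
    also have "\<dots> \<le> 8 / pi * \<kappa> v" using B1_prob[OF v] B2_prob[OF v False] by simp
    finally show ?thesis .
  qed
  define g where "g = from_nat_into \<Lambda>"
  have g: "bij_betw g UNIV \<Lambda>" unfolding g_def by (rule bij_betw_from_nat_into[OF \<Lambda>(1,2)])
  have g_in: "g n \<in> \<Lambda>" for n using g by (auto simp: bij_betw_def)
  have "(\<lambda>n. \<kappa> (g n)) summable_on UNIV"
    using summable_on_reindex_bij_betw[OF g, of \<kappa>] \<kappa>(2) by simp
  hence "summable (\<lambda>n. \<kappa> (g n))" by (rule summable_on_imp_summable)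
  hence "summable (\<lambda>n. 8 / pi * \<kappa> (g n))" by (rule summable_mult)
  hence "summable (\<lambda>n. prob (B (g n)))"
    by (rule summable_comparison_test_ev[rotated]) (use B_prob[OF g_in] in auto)
  hence "AE \<omega> in M. \<forall>\<^sub>F n in sequentially. \<omega> \<in> space M - B (g n)"
    by (intro borel_cantelli_AE1 B_ev g_in) (auto simp: emeasure_eq_measure)
  thus ?thesis
  proof eventually_elim
    case (elim \<omega>)
    then obtain N where N: "\<And>n. n \<ge> N \<Longrightarrow> \<omega> \<in> space M - B (g n)" by (auto simp: eventually_sequentially)
    show ?case
    proof (intro exI[of _ "g ` {..<N}"] conjI ballI)
      fix v assume v: "v \<in> \<Lambda> - g ` {..<N}"
      then obtain n where n: "v = g n" using g by (auto simp: bij_betw_def)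
      with v have "n \<ge> N" by (meson DiffD2 image_eqI lessThan_iff not_le)
      hence \<omega>: "\<omega> \<in> space M" "\<omega> \<notin> B v" using N n by auto
      have B1: "f v * \<kappa> v < \<bar>Z (v, 2) \<omega> $ 1 - Z (v, 1) \<omega> $ 1\<bar>"
        using \<omega> by (auto simp: B_def B1_def)
      show "f v * \<kappa> v \<le> \<bar>Re (w v 2 \<omega> - w v 1 \<omega>)\<bar>"
        using B1 by (simp add: w_def complex_of_vec_def)
      show "reflect v \<noteq> v \<longrightarrow> (f v)\<^sup>2 * (\<kappa> v)\<^sup>2 \<le>
         \<bar>Im (cnj (w v 2 \<omega> - w v 1 \<omega>) * (cnj (w (reflect v) 1 \<omega>) - w v 1 \<omega>))\<bar>"
      proof
        assume "reflect v \<noteq> v"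
        hence "\<omega> \<notin> B2 v" using \<omega> by (simp add: B_def)
        define c where "c = (Z (v, 2) \<omega> $ 2 - Z (v, 1) \<omega> $ 2) * Z (reflect v, 1) \<omega> $ 1 +
          (Z (v, 2) \<omega> $ 1 - Z (v, 1) \<omega> $ 1) * Z (reflect v, 1) \<omega> $ 2 -
          ((Z (v, 2) \<omega> $ 2 - Z (v, 1) \<omega> $ 2) * Z (v, 1) \<omega> $ 1 -
           (Z (v, 2) \<omega> $ 1 - Z (v, 1) \<omega> $ 1) * Z (v, 1) \<omega> $ 2)"
        have "(f v)\<^sup>2 * (\<kappa> v)\<^sup>2 < \<bar>c\<bar>"
          using \<open>\<omega> \<notin> B2 v\<close> \<omega>(1) less_imp_le[OF B1] by (auto simp: B2_def c_def)
        moreover have "Im (cnj (w v 2 \<omega> - w v 1 \<omega>) * (cnj (w (reflect v) 1 \<omega>) - w v 1 \<omega>)) = - c"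
          unfolding w_def c_def by (simp add: complex_of_vec_def algebra_simps)
        ultimately show "(f v)\<^sup>2 * (\<kappa> v)\<^sup>2 \<le>
         \<bar>Im (cnj (w v 2 \<omega> - w v 1 \<omega>) * (cnj (w (reflect v) 1 \<omega>) - w v 1 \<omega>))\<bar>" by simp
      qed
    qed auto
  qed
qed

lemma (in prob_space) AE_uniform_in_ball:
  assumes X: "random_variable borel X" and D: "distr M borel X = uniform_measure lborel (cball z r)"
  shows "AE \<omega> in M. X \<omega> \<in> cball z r"
proof -
  have "AE x in distr M borel X. x \<in> cball z r"
    unfolding D by (rule AE_uniform_measureI) auto
  thus ?thesis by (rule AE_distrD[OF X])
qed

lemma norm_bargmann_eq_if_gabor_eq:
  assumes "g \<in> L2_real" "h \<in> L2_real" "norm (gabor g u) = norm (gabor h u)"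
  shows "norm (bargmann g (complex_of_vec u)) = norm (bargmann h (complex_of_vec u))"
proof -
  have "norm (bargmann g (Complex (u $ 1) (- u $ 2))) = norm (bargmann h (Complex (u $ 1) (- u $ 2)))"
    using assms(3) unfolding norm_gabor by simp
  moreover have "Complex (u $ 1) (- u $ 2) = cnj (complex_of_vec u)"
    by (simp add: complex_of_vec_def complex_eq_iff)
  ultimately show ?thesis using assms(1,2) by (simp add: bargmann_cnj)
qed

theorem theorem2p10:
  fixes \<gamma> :: real
    and f :: "real^2 \<Rightarrow> real"
    and \<Lambda> :: "(real^2) set"
    and M :: "'w measure"
    and Z :: "(real^2) \<times> nat \<Rightarrow> 'w \<Rightarrow> real^2"
  assumes "\<gamma> > 2 * pi"
    and "\<And>z. f z = exp (- \<gamma> * (norm z)\<^sup>2)"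
    and "\<Lambda> \<in> gabor_lattices"
    and "lattice_density \<Lambda> > 4"
    and "prob_space M"
    and "prob_space.indep_vars M (\<lambda>_. borel) Z (\<Lambda> \<times> {1, 2})"
    and "\<And>z l. z \<in> \<Lambda> \<Longrightarrow> l \<in> {1, 2} \<Longrightarrow>
           distr M borel (Z (z, l)) = uniform_measure lborel (cball z (f z))"
  shows "AE \<omega> in M. gabor_uniqueness_set ((\<lambda>i. Z i \<omega>) ` (\<Lambda> \<times> {1, 2})) L2_real"
proof -
  interpret prob_space M by fact
  obtain p q \<alpha> S where S: "lattice_sigma (complex_of_vec ` \<Lambda>) p q \<alpha> S" "\<alpha> > 2 * pi"
    "\<And>l. l \<in> complex_of_vec ` \<Lambda> \<Longrightarrow> cnj l \<in> complex_of_vec ` \<Lambda>"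
    using dense_lattice_sigma[OF assms(3,4)] by blast
  interpret lattice_sigma "complex_of_vec ` \<Lambda>" p q \<alpha> S by (rule S(1))
  have inj: "inj_on complex_of_vec \<Lambda>" using complex_of_vec_inj by (rule inj_on_subset) auto
  have countable: "countable \<Lambda>"
    using countable_L inj by (rule countable_image_inj_on)
  have infinite: "infinite \<Lambda>" using infinite_L by blast
  have reflect: "reflect v \<in> \<Lambda>" if "v \<in> \<Lambda>" for v
  proof -
    have "complex_of_vec (reflect v) \<in> complex_of_vec ` \<Lambda>"
      unfolding complex_of_vec_reflect using S(3) that by blast
    thus ?thesis using complex_of_vec_inj by (simp add: inj_image_mem_iff)
  qed
  define \<kappa> where "\<kappa> v = exp (- pi / 16 * (norm v)\<^sup>2)" for v :: "real^2"
  have \<kappa>_sum: "\<kappa> summable_on \<Lambda>"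
  proof -
    have "(\<lambda>z. exp (- (pi / 16) * (norm z)\<^sup>2)) summable_on complex_of_vec ` \<Lambda>"
      by (rule summable_L) simp
    hence "(\<lambda>z. exp (- (pi / 16) * (norm z)\<^sup>2)) \<circ> complex_of_vec summable_on \<Lambda>"
      by (simp only: summable_on_reindex[OF inj])
    thus ?thesis by (simp add: o_def norm_complex_of_vec \<kappa>_def[abs_def])
  qed
  have "AE \<omega> in M. \<exists>X. finite X \<and> (\<forall>v \<in> \<Lambda> - X.
      f v * \<kappa> v \<le> \<bar>Re (complex_of_vec (Z (v, 2) \<omega>) - complex_of_vec (Z (v, 1) \<omega>))\<bar> \<and>
      (reflect v \<noteq> v \<longrightarrow> (f v)\<^sup>2 * (\<kappa> v)\<^sup>2 \<le>
         \<bar>Im (cnj (complex_of_vec (Z (v, 2) \<omega>) - complex_of_vec (Z (v, 1) \<omega>)) *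
           (cnj (complex_of_vec (Z (reflect v, 1) \<omega>)) - complex_of_vec (Z (v, 1) \<omega>)))\<bar>))"
    by (rule AE_eventually_separated[OF assms(6,7) _ _ countable infinite reflect _ \<kappa>_sum])
      (auto simp: assms(2) norm_reflect \<kappa>_def)
  moreover have "AE \<omega> in M. \<forall>i\<in>\<Lambda> \<times> {1, 2}. Z i \<omega> \<in> cball (fst i) (f (fst i))"
  proof (rule AE_ball_countable[THEN iffD2])
    show "countable (\<Lambda> \<times> {1, 2 :: nat})" using countable by auto
    show "\<forall>i\<in>\<Lambda> \<times> {1, 2}. AE \<omega> in M. Z i \<omega> \<in> cball (fst i) (f (fst i))"
    proof
      fix i assume i: "i \<in> \<Lambda> \<times> {1, 2 :: nat}"
      show "AE \<omega> in M. Z i \<omega> \<in> cball (fst i) (f (fst i))"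
      proof (rule AE_uniform_in_ball)
        show "random_variable borel (Z i)" using assms(6) i by (auto simp: indep_vars_def)
        show "distr M borel (Z i) = uniform_measure lborel (cball (fst i) (f (fst i)))"
          using assms(7)[of "fst i" "snd i"] i by auto
      qed
    qed
  qed
  ultimately show ?thesis
  proof eventually_elim
    case (elim \<omega>)
    then obtain X where X: "finite X" and sep: "\<And>v. v \<in> \<Lambda> - X \<Longrightarrow>
      f v * \<kappa> v \<le> \<bar>Re (complex_of_vec (Z (v, 2) \<omega>) - complex_of_vec (Z (v, 1) \<omega>))\<bar> \<and>
      (reflect v \<noteq> v \<longrightarrow> (f v)\<^sup>2 * (\<kappa> v)\<^sup>2 \<le>
         \<bar>Im (cnj (complex_of_vec (Z (v, 2) \<omega>) - complex_of_vec (Z (v, 1) \<omega>)) *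
           (cnj (complex_of_vec (Z (reflect v, 1) \<omega>)) - complex_of_vec (Z (v, 1) \<omega>)))\<bar>)" by blast
    define vec where "vec = inv complex_of_vec"
    have vec: "vec (complex_of_vec v) = v" for v
      unfolding vec_def using complex_of_vec_inj by simp
    define w where "w l i = complex_of_vec (Z (vec l, i) \<omega>)" for l i
    have w: "w (complex_of_vec v) i = complex_of_vec (Z (v, i) \<omega>)"
      "w (cnj (complex_of_vec v)) i = complex_of_vec (Z (reflect v, i) \<omega>)" for v i
      by (simp_all add: w_def vec flip: complex_of_vec_reflect)
    show ?case
      unfolding gabor_uniqueness_set_def
    proof (intro ballI impI)
      fix g h assume g: "g \<in> L2_real" and h: "h \<in> L2_real"
        and eq: "\<forall>u\<in>(\<lambda>i. Z i \<omega>) ` (\<Lambda> \<times> {1, 2}). norm (gabor g u) = norm (gabor h u)"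
      have L2: "g \<in> L2" "h \<in> L2" using g h by (auto simp: L2_real_def)
      obtain Cg where Cg: "\<And>z. norm (bargmann g z) \<le> Cg * exp (pi / 2 * (norm z)\<^sup>2)"
        using bargmann_growth[OF L2(1)] by blast
      obtain Ch where Ch: "\<And>z. norm (bargmann h z) \<le> Ch * exp (pi / 2 * (norm z)\<^sup>2)"
        using bargmann_growth[OF L2(2)] by blast
      have "\<exists>c. norm c = 1 \<and> (\<forall>z. bargmann g z = c * bargmann h z)"
      proof (rule equal_modulus_near_lattice[where w = w, OF S(2) assms(1) S(3)
            bargmann_holomorphic[OF L2(1)] Cg bargmann_cnj[OF g] bargmann_holomorphic[OF L2(2)] Ch bargmann_cnj[OF h]])
        show "finite (complex_of_vec ` X)" using X by simp
        fix l assume l: "l \<in> complex_of_vec ` \<Lambda>"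
        then obtain v where v: "v \<in> \<Lambda>" "l = complex_of_vec v" by blast
        fix i :: nat assume i: "i \<in> {1, 2}"
        have "Z (v, i) \<omega> \<in> cball v (f v)" using elim(2) v i by force
        hence "norm (complex_of_vec (Z (v, i) \<omega> - v)) \<le> f v"
          unfolding norm_complex_of_vec by (simp add: dist_norm norm_minus_commute)
        thus "norm (w l i - l) \<le> exp (- \<gamma> * (norm l)\<^sup>2)"
          by (simp add: v(2) w complex_of_vec_diff assms(2) norm_complex_of_vec)
        have "norm (gabor g (Z (v, i) \<omega>)) = norm (gabor h (Z (v, i) \<omega>))"
          using eq v i by blast
        from norm_bargmann_eq_if_gabor_eq[OF g h this]
        show "norm (bargmann g (w l i)) = norm (bargmann h (w l i))" by (simp add: v(2) w)
      next
        fix l assume l: "l \<in> complex_of_vec ` \<Lambda> - complex_of_vec ` X"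
        then obtain v where v: "v \<in> \<Lambda> - X" "l = complex_of_vec v" by blast
        show "exp (- \<gamma> * (norm l)\<^sup>2) * exp (- pi / 16 * (norm l)\<^sup>2) \<le> \<bar>Re (w l 2 - w l 1)\<bar>"
          using sep[OF v(1)] unfolding v(2) w norm_complex_of_vec \<kappa>_def assms(2) by blast
        assume "Im l \<noteq> 0"
        hence "reflect v \<noteq> v" by (auto simp: v(2) complex_of_vec_def reflect_def vec_eq_iff forall_2)
        thus "(exp (- \<gamma> * (norm l)\<^sup>2))\<^sup>2 * (exp (- pi / 16 * (norm l)\<^sup>2))\<^sup>2 \<le>
            \<bar>Im (cnj (w l 2 - w l 1) * (cnj (w (cnj l) 1) - w l 1))\<bar>"
          using sep[OF v(1)] unfolding v(2) w norm_complex_of_vec \<kappa>_def assms(2) by blast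
      qed
      then obtain c where c: "norm c = 1" "\<And>z. bargmann g z = c * bargmann h z" by blast
      from bargmann_proportional_imp_AE[OF L2 c(2)] c(1)
      show "\<exists>\<tau>. norm \<tau> = 1 \<and> (AE t in lebesgue. g t = \<tau> * h t)" by blast
    qed
  qed
qed

end
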